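(* Fix $\beta_*=\sigma_*+i\tau_*\in E_1\cap\{\beta\in\mathbb{C}:|\operatorname{Re}\beta|<\frac{\sigma_1}{2}\}$. Then the following convergence of random analytic functions holds weakly on $\mathcal{H}(\mathbb{C})$ as $n\to\infty$: $$\left\{\frac{\mathcal{Z}_n\left(\beta_*+\frac{t}{\sqrt n}\right)-\mathbb{E}\mathcal{Z}_n\left(\beta_*+\frac{t}{\sqrt n}\right)}{N_{n,1}^{1/2}\,e^{a_1\left(\sigma_*+\frac{t}{\sqrt n}\right)^2n}\,e^{\tilde c_n\left(\beta_*+\frac{t}{\sqrt n}\right)}}:t\in\mathbb{C}\right\}\longrightarrow\{\mathbb{X}(\sqrt{a_1}\,t):t\in\mathbb{C}\},$$ where $\mathbb{X}$ is the plane Gaussian analytic function.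
   Context: GREM. Fix $d\in\mathbb{N}$, variances $a_1,\dots,a_d>0$, branching exponents $\alpha_1,\dots,\alpha_d>1$, and sequences of natural numbers $N_{n,1},\dots,N_{n,d}$ with $\lim_{n\to\infty}N_{n,j}/\alpha_j^n=1$ for each $j$. Let $\mathbb{S}_n=\{\varepsilon=(\varepsilon_1,\dots,\varepsilon_d)\in\mathbb{N}^d:1\le\varepsilon_j\le N_{n,j},\ 1\le j\le d\}$. Let $\{\xi_{\varepsilon_1\dots\varepsilon_j}:1\le j\le d,\ 1\le\varepsilon_i\le N_{n,i}\}$ be independent real standard normal random variables, $X_\varepsilon=\sum_{j=1}^d\sqrt{a_j}\,\xi_{\varepsilon_1\dots\varepsilon_j}$, and $\mathcal{Z}_n(\beta)=\sum_{\varepsilon\in\mathbb{S}_n}e^{\beta\sqrt n X_\varepsilon}$, $\beta=\sigma+i\tau\in\mathbb{C}$. Put $\sigma_j=\sqrt{2\log\alpha_j/a_j}$; it is assumed throughout that $\sigma_1<\dots<\sigma_d$. $E_1=\mathbb{C}\setminus\overline{G_1\cup F_1}$, where $G_1=\{\beta:2|\sigma|>\sigma_1,\ |\sigma|+|\tau|>\sigma_1\}$ and $F_1=\{\beta:2|\sigma|<\sigma_1,\ 2(\sigma^2+\tau^2)>\sigma_1^2\}$. Normalization: $\tilde c_n(\beta)=\sum_{k=2}^d\left(\log N_{n,k}+\frac12a_k\beta^2n\right)$, $\beta\in\mathbb{C}$. Plane Gaussian analytic function: $\mathbb{X}(t)=e^{-t^2/2}\sum_{k=0}^\infty N_k\frac{t^k}{\sqrt{k!}}$,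 $t\in\mathbb{C}$, where $N_0,N_1,\dots$ are i.i.d. $N_{\mathbb{C}}(0,1)$ (law of $X+iY$ with $X,Y$ independent real centered Gaussian of variance $1/2$). $\mathcal{H}(\mathbb{C})$ is the space of entire functions with the topology of locally uniform convergence; weak convergence on it means convergence in distribution of random elements.
   Formalization: The formal theorem additionally assumes τ_* ≠ 0 (β_* not real): for real β_* in the stated region the normalized process is real at real t, while 𝕏(√a₁ t) is almost surely non-real, so the stated convergence fails there. *)

theory Defs
  imports "HOL-Probability.Probability" "HOL-Complex_Analysis.Complex_Analysis"
begin

section \<open>Entire functions and weak convergence\<close>

definition entire_functions :: "(complex \<Rightarrow> complex) set" where
  "entire_functions = {f. f holomorphic_on UNIV}"

text \<open>
  The topology of locally uniform convergence: the sets
  \<open>{g. \<forall>z\<in>K. dist (g z) (f z) < e}\<close> with \<open>K\<close> compact and \<open>e > 0\<close> form a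
  neighbourhood base at \<open>f\<close>.
\<close>

definition entire_open :: "(complex \<Rightarrow> complex) set \<Rightarrow> bool" where
  "entire_open U \<longleftrightarrow> U \<subseteq> entire_functions \<and>
     (\<forall>f\<in>U. \<exists>K e. compact K \<and> e > 0 \<and>
        (\<forall>g\<in>entire_functions. (\<forall>z\<in>K. dist (g z) (f z) < e) \<longrightarrow> g \<in> U))"

definition entire_topology :: "(complex \<Rightarrow> complex) topology" where
  "entire_topology = topology entire_open"

lemma istopology_entire_open: "istopology entire_open"
  unfolding istopology_def
proof (intro conjI allI impI)
  fix S T assume S: "entire_open S" and T: "entire_open T"
  show "entire_open (S \<inter> T)"
    unfolding entire_open_def
  proof (intro conjI ballI)
    show "S \<inter> T \<subseteq> entire_functions" using S by (auto simp: entire_open_def)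
    fix f assume f: "f \<in> S \<inter> T"
    obtain K e where K: "compact K" "e > 0"
      "\<forall>g\<in>entire_functions. (\<forall>z\<in>K. dist (g z) (f z) < e) \<longrightarrow> g \<in> S"
      using S f by (auto simp: entire_open_def)
    obtain L r where L: "compact L" "r > 0"
      "\<forall>g\<in>entire_functions. (\<forall>z\<in>L. dist (g z) (f z) < r) \<longrightarrow> g \<in> T"
      using T f by (auto simp: entire_open_def)
    show "\<exists>K e. compact K \<and> e > 0 \<and>
        (\<forall>g\<in>entire_functions. (\<forall>z\<in>K. dist (g z) (f z) < e) \<longrightarrow> g \<in> S \<inter> T)"
      by (rule exI[of _ "K \<union> L"], rule exI[of _ "min e r"])
         (use K L in \<open>auto simp: compact_Un\<close>)
  qed
next
  fix \<K> :: "(complex \<Rightarrow> complex) set set"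
  assume *: "\<forall>S\<in>\<K>. entire_open S"
  show "entire_open (\<Union>\<K>)"
    unfolding entire_open_def
  proof (intro conjI ballI)
    show "\<Union>\<K> \<subseteq> entire_functions" using * by (auto simp: entire_open_def)
    fix f assume "f \<in> \<Union>\<K>"
    then obtain S where S: "S \<in> \<K>" "f \<in> S" by blast
    then obtain K e where K: "compact K" "e > 0"
      "\<forall>g\<in>entire_functions. (\<forall>z\<in>K. dist (g z) (f z) < e) \<longrightarrow> g \<in> S"
      using * by (fastforce simp: entire_open_def)
    show "\<exists>K e. compact K \<and> e > 0 \<and>
        (\<forall>g\<in>entire_functions. (\<forall>z\<in>K. dist (g z) (f z) < e) \<longrightarrow> g \<in> \<Union>\<K>)"
      by (rule exI[of _ K], rule exI[of _ e]) (use K S(1) in blast)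
  qed
qed

lemma openin_entire_topology: "openin entire_topology U \<longleftrightarrow> entire_open U"
  unfolding entire_topology_def
  using topology_inverse'[OF istopology_entire_open] by simp

lemma topspace_entire_topology: "topspace entire_topology = entire_functions"
proof -
  have "entire_open entire_functions"
    unfolding entire_open_def by (auto intro!: exI[of _ "{}"] exI[of _ "1::real"])
  thus ?thesis
    unfolding topspace_def openin_entire_topology by (auto simp: entire_open_def)
qed

definition borel_sets_of :: "'x topology \<Rightarrow> 'x measure" where
  "borel_sets_of T = sigma (topspace T) {U. openin T U}"

text \<open>
  Convergence in distribution of random elements of \<open>T\<close>.  The prelimit variables may live on
  different probability spaces.  Measurability is part of the notion; in particular it forces
  \<open>X n \<omega>\<close> and \<open>Y \<omega>\<close> to lie in \<open>topspace T\<close>.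
\<close>

definition weakly_converges ::
  "'x topology \<Rightarrow> (nat \<Rightarrow> 'a measure) \<Rightarrow> (nat \<Rightarrow> 'a \<Rightarrow> 'x) \<Rightarrow> 'b measure \<Rightarrow> ('b \<Rightarrow> 'x) \<Rightarrow> bool"
where
  "weakly_converges T M X P Y \<longleftrightarrow>
     (\<forall>n. X n \<in> measurable (M n) (borel_sets_of T)) \<and>
     Y \<in> measurable P (borel_sets_of T) \<and>
     (\<forall>F :: 'x \<Rightarrow> real. continuous_map T euclideanreal F \<longrightarrow> bounded (F ` topspace T) \<longrightarrow>
        (\<lambda>n. \<integral>\<omega>. F (X n \<omega>) \<partial>M n) \<longlonglongrightarrow> (\<integral>\<omega>. F (Y \<omega>) \<partial>P))"


section \<open>The plane Gaussian analytic function\<close>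

definition std_complex_normal :: "complex measure" where
  "std_complex_normal =
     distr (density lborel (normal_density 0 (sqrt (1/2))) \<Otimes>\<^sub>M
            density lborel (normal_density 0 (sqrt (1/2))))
       borel (\<lambda>(x, y). Complex x y)"

text \<open>
  For i.i.d. standard complex normal \<open>\<zeta> k\<close> the series converges for all \<open>t\<close> almost surely;
  on the exceptional null set the function is set to \<open>0\<close>, so that every realisation is entire.
\<close>

definition plane_GAF :: "(nat \<Rightarrow> 'b \<Rightarrow> complex) \<Rightarrow> 'b \<Rightarrow> complex \<Rightarrow> complex" where
  "plane_GAF \<zeta> \<omega> t =
     (if \<forall>s::complex. summable (\<lambda>k. \<zeta> k \<omega> * s ^ k / of_real (sqrt (fact k)))
      then exp (- (t ^ 2) / 2) * (\<Sum>k. \<zeta> k \<omega> * t ^ k / of_real (sqrt (fact k)))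
      else 0)"


section \<open>The generalized random energy model\<close>

text \<open>
  Levels are numbered \<open>1, \<dots>, d\<close>.  A multi-index \<open>(\<epsilon>\<^sub>1, \<dots>, \<epsilon>\<^sub>j)\<close> is a list of length \<open>j\<close>,
  with \<open>\<epsilon>\<^sub>i\<close> stored at list position \<open>i - 1\<close>; \<open>N n j\<close> is the branching number of level \<open>j\<close>.
  The field \<open>\<xi>\<close> below is the one for a fixed \<open>n\<close>.
\<close>

definition grem_words :: "(nat \<Rightarrow> nat \<Rightarrow> nat) \<Rightarrow> nat \<Rightarrow> nat \<Rightarrow> nat list set" where
  "grem_words N n j = {\<epsilon>. length \<epsilon> = j \<and> (\<forall>i\<in>{1..j}. \<epsilon> ! (i - 1) \<in> {1..N n i})}"

definition grem_X :: "nat \<Rightarrow> (nat \<Rightarrow> real) \<Rightarrow> (nat list \<Rightarrow> 'a \<Rightarrow> real) \<Rightarrow> nat list \<Rightarrow> 'a \<Rightarrow> real" where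
  "grem_X d a \<xi> \<epsilon> \<omega> = (\<Sum>j=1..d. sqrt (a j) * \<xi> (take j \<epsilon>) \<omega>)"

definition grem_Z ::
  "nat \<Rightarrow> (nat \<Rightarrow> real) \<Rightarrow> (nat \<Rightarrow> nat \<Rightarrow> nat) \<Rightarrow> (nat list \<Rightarrow> 'a \<Rightarrow> real) \<Rightarrow> nat \<Rightarrow> complex \<Rightarrow> 'a \<Rightarrow> complex"
where
  "grem_Z d a N \<xi> n \<beta> \<omega> =
     (\<Sum>\<epsilon>\<in>grem_words N n d. exp (\<beta> * of_real (sqrt (real n)) * of_real (grem_X d a \<xi> \<epsilon> \<omega>)))"

definition grem_sigma :: "(nat \<Rightarrow> real) \<Rightarrow> (nat \<Rightarrow> real) \<Rightarrow> nat \<Rightarrow> real" where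
  "grem_sigma a \<alpha> j = sqrt (2 * ln (\<alpha> j) / a j)"

definition grem_c :: "nat \<Rightarrow> (nat \<Rightarrow> real) \<Rightarrow> (nat \<Rightarrow> nat \<Rightarrow> nat) \<Rightarrow> nat \<Rightarrow> complex \<Rightarrow> complex" where
  "grem_c d a N n \<beta> =
     (\<Sum>k=2..d. of_real (ln (real (N n k))) + 1/2 * of_real (a k) * \<beta> ^ 2 * of_nat n)"

text \<open>The regions attached to a critical value \<open>s\<close>, to be used with \<open>s = \<sigma>\<^sub>1\<close>.\<close>

definition region_G :: "real \<Rightarrow> complex set" where
  "region_G s = {\<beta>. 2 * \<bar>Re \<beta>\<bar> > s \<and> \<bar>Re \<beta>\<bar> + \<bar>Im \<beta>\<bar> > s}"

definition region_F :: "real \<Rightarrow> complex set" where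
  "region_F s = {\<beta>. 2 * \<bar>Re \<beta>\<bar> < s \<and> 2 * ((Re \<beta>)\<^sup>2 + (Im \<beta>)\<^sup>2) > s\<^sup>2}"

text \<open>
  This region contains a segment of the real axis.  At a real \<open>\<beta>\<close> the normalized fluctuations are
  real for real arguments, hence have no limit with complex Gaussian coefficients.
\<close>

definition region_E :: "real \<Rightarrow> complex set" where
  "region_E s = UNIV - closure (region_G s \<union> region_F s)"

end

theory Submission
  imports Defs
begin

text \<open>
  Write \<open>Z = E Z \<cdot> (1 + \<Sum>m<d. D\<^sub>m)\<close> where \<open>D\<^sub>m\<close> collects the fluctuation of the level \<open>m + 1\<close>
  variables given the previous levels.  Increments attached to different words are orthogonal, so
  after normalization \<open>D\<^sub>m\<close> has second moment of order \<open>\<Prod>2\<le>j\<le>m+1. exp (a\<^sub>j |\<beta>|\<^sup>2 n) / N\<^sub>j\<close>, and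
  \<open>a\<^sub>j |\<beta>|\<^sup>2 < log \<alpha>\<^sub>j\<close> on the strip part of \<open>E\<^sub>1\<close>.  Hence only \<open>D\<^sub>0\<close>, a sum of i.i.d. variables,
  survives.  Linear functionals of \<open>D\<^sub>0\<close> obey a Lindeberg central limit theorem: the weight
  \<open>|exp (\<beta> sqrt n X)|\<^sup>2\<close> shifts the Gaussian, which makes the covariance exactly that of the plane
  Gaussian analytic function and turns the Lindeberg condition into dominated convergence; the
  pseudo-covariance vanishes because \<open>Im \<beta> \<noteq> 0\<close>.  The bounds on \<open>E |X\<^sub>n(t)|\<close> on circles give tightness
  through Cauchy's estimate for the Taylor coefficients, and on a compact set of power series every
  continuous functional is uniformly approximated by trigonometric polynomials in point evaluations
  (Stone-Weierstrass).
\<close>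

section \<open>The space of entire functions\<close>

text \<open>The position of \<open>\<beta>s\<close> enters in two ways. The strip |Re \<beta>| <
  \<sigma>_1 / 2 says 2 a_1 (Re \<beta>)^2 < log \<alpha>_1. This is what the Lindeberg condition
  needs: after the shift of the Gaussian one summand is of size exp (a_1 (Re \<beta>)^2 n + O(sqrt
  n)) and has to be small against sqrt N_1. The disc 2 |\<beta>|^2 < \<sigma>_1^2, forced by the
  distance from the closure of F_1, suppresses the deeper levels, since \<sigma>_1 \<le> \<sigma>_j
  carries it to every level. The obstacle on the analytic side is that weak convergence tests
  arbitrary bounded continuous functionals, while the limit theorem only controls finitely many
  point evaluations. The argument is direct and extracts no subsequences: one compact set of power
  series carries all laws up to mass e, the limit law included, and on it a functional is replaced
  by a trigonometric polynomial, whose expectation is a finite combination of characteristic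
  functions. Measurability is demanded for every n, whereas moment bounds hold only from some n on,
  because finitely many branching numbers may vanish.\<close>

definition coef :: "(complex \<Rightarrow> complex) \<Rightarrow> nat \<Rightarrow> complex" where
  "coef f k = (deriv ^^ k) f 0 / fact k"

lemma coef_sums:
  assumes "f \<in> entire_functions"
  shows "(\<lambda>k. coef f k * z ^ k) sums f z"
  using holomorphic_power_series[of f 0 "norm z + 1" z] assms
  by (simp add: entire_functions_def coef_def holomorphic_on_subset)

text \<open>The topology is given by neighbourhood bases and carries no metric here, so continuity
  is translated into an epsilon-delta criterion in which the compact set is chosen together with
  delta.\<close>

lemma continuous_map_entireI:
  fixes F :: "(complex \<Rightarrow> complex) \<Rightarrow> 'b::metric_space"
  assumes "\<And>f e. f \<in> entire_functions \<Longrightarrow> e > 0 \<Longrightarrow> \<exists>K \<delta>. compact K \<and> \<delta> > 0 \<and>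
             (\<forall>g\<in>entire_functions. (\<forall>z\<in>K. dist (g z) (f z) < \<delta>) \<longrightarrow> dist (F g) (F f) < e)"
  shows "continuous_map entire_topology euclidean F"
  unfolding continuous_map_def topspace_entire_topology openin_entire_topology
proof (intro conjI allI impI)
  fix U :: "'b set" assume "openin euclidean U"
  hence U: "open U" by simp
  show "entire_open {x \<in> entire_functions. F x \<in> U}"
    unfolding entire_open_def
  proof (intro conjI ballI)
    fix f assume f: "f \<in> {x \<in> entire_functions. F x \<in> U}"
    then obtain e where e: "e > 0" "\<And>y. dist y (F f) < e \<Longrightarrow> y \<in> U"
      using U by (auto simp: open_dist)
    obtain K \<delta> where "compact K" "\<delta> > 0"
      "\<forall>g\<in>entire_functions. (\<forall>z\<in>K. dist (g z) (f z) < \<delta>) \<longrightarrow> dist (F g) (F f) < e"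
      using assms[of f e] f e(1) by blast
    thus "\<exists>K e. compact K \<and> 0 < e \<and> (\<forall>g\<in>entire_functions. (\<forall>z\<in>K. dist (g z) (f z) < e) \<longrightarrow>
             g \<in> {x \<in> entire_functions. F x \<in> U})"
      using e(2) by (intro exI[of _ K] exI[of _ \<delta>]) auto
  qed auto
qed auto

lemma continuous_map_entireD:
  fixes F :: "(complex \<Rightarrow> complex) \<Rightarrow> 'b::metric_space"
  assumes "continuous_map entire_topology euclidean F" "f \<in> entire_functions" "e > 0"
  obtains K \<delta> where "compact K" "\<delta> > 0"
    "\<And>g. g \<in> entire_functions \<Longrightarrow> (\<And>z. z \<in> K \<Longrightarrow> dist (g z) (f z) < \<delta>) \<Longrightarrow> dist (F g) (F f) < e"
proof -
  have "openin entire_topology {g \<in> topspace entire_topology. F g \<in> ball (F f) e}"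
    by (rule openin_continuous_map_preimage[OF assms(1)]) simp
  hence "entire_open {g \<in> entire_functions. F g \<in> ball (F f) e}"
    by (simp add: openin_entire_topology topspace_entire_topology)
  moreover have "f \<in> {g \<in> entire_functions. F g \<in> ball (F f) e}" using assms by simp
  ultimately have "\<exists>K \<delta>. compact K \<and> \<delta> > 0 \<and> (\<forall>g\<in>entire_functions. (\<forall>z\<in>K. dist (g z) (f z) < \<delta>) \<longrightarrow> 
       g \<in> {g \<in> entire_functions. F g \<in> ball (F f) e})"
    unfolding entire_open_def by blast
  then obtain K \<delta> where *: "compact K" "\<delta> > 0"
    "\<forall>g\<in>entire_functions. (\<forall>z\<in>K. dist (g z) (f z) < \<delta>) \<longrightarrow> 
       g \<in> {g \<in> entire_functions. F g \<in> ball (F f) e}"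
    by blast
  show ?thesis using that[OF *(1,2)] *(3) by (auto simp: dist_commute)
qed

lemma measurable_continuous_map_compose:
  fixes F :: "'x \<Rightarrow> 'b::topological_space"
  assumes "X \<in> measurable M (borel_sets_of T)" "continuous_map T euclidean F"
  shows "(\<lambda>\<omega>. F (X \<omega>)) \<in> borel_measurable M"
proof (rule measurable_compose[OF assms(1)], rule borel_measurableI)
  fix S :: "'b set" assume "open S"
  hence "openin T {x \<in> topspace T. F x \<in> S}"
    by (intro openin_continuous_map_preimage[OF assms(2)]) simp
  moreover have "F -` S \<inter> space (borel_sets_of T) = {x \<in> topspace T. F x \<in> S}"
    by (auto simp: borel_sets_of_def space_measure_of_conv)
  moreover have "{U. openin T U} \<subseteq> Pow (topspace T)" by (auto dest: openin_subset)
  ultimately show "F -` S \<inter> space (borel_sets_of T) \<in> sets (borel_sets_of T)"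
    by (auto simp: borel_sets_of_def)
qed

text \<open>Cauchy's formula in its L1 form. A mean over the circle, unlike the supremum in the
  usual estimate, commutes with expectations, and the nonnegative integral lets Tonelli apply
  without prior integrability.\<close>

lemma norm_coef_le_circle:
  assumes f: "f \<in> entire_functions" and R: "R > 0"
  shows "ennreal (norm (coef f k) * R ^ k) \<le>
    (\<integral>\<^sup>+x. ennreal (norm (f (R * cis (2 * pi * x)))) * indicator {0..1} x \<partial>lborel)"
proof -
  define c where "c = circlepath 0 R"
  have hol: "f holomorphic_on UNIV" using f by (simp add: entire_functions_def)
  have cont: "continuous_on S f" for S
    using hol holomorphic_on_imp_continuous_on continuous_on_subset by blast
  have cx: "c x = R * cis (2 * pi * x)" for x
    by (simp add: c_def circlepath cis_conv_exp mult_ac)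
  have "((\<lambda>u. f u / (u - 0) ^ Suc k) has_contour_integral (2 * pi * \<i> / fact k * (deriv ^^ k) f 0)) c"
    unfolding c_def
    by (rule Cauchy_has_contour_integral_higher_derivative_circlepath)
       (use R hol cont in \<open>auto intro: holomorphic_on_subset\<close>)
  hence 1: "((\<lambda>x. f (c x) / c x ^ Suc k * vector_derivative c (at x within {0..1})) has_integral
               (2 * pi * \<i> * coef f k)) {0..1}"
    by (simp add: has_contour_integral_def coef_def)
  have contn: "continuous_on {0..1} (\<lambda>x. norm (f (R * cis (2 * pi * x))))"
    by (intro continuous_intros continuous_on_compose2[OF cont[of UNIV]]) auto
  define J where "J = integral {0..1} (\<lambda>x. norm (f (R * cis (2 * pi * x))))"
  have 2: "((\<lambda>x. norm (f (R * cis (2 * pi * x)))) has_integral J) {0..1}"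
    unfolding J_def using integrable_continuous_real[OF contn] by blast
  have "norm (2 * pi * \<i> * coef f k) \<le> integral {0..1} (\<lambda>x. 2 * pi / R ^ k * norm (f (R * cis (2 * pi * x))))"
    unfolding integral_unique[OF 1, symmetric]
  proof (rule integral_norm_bound_integral)
    show "(\<lambda>x. 2 * pi / R ^ k * norm (f (R * cis (2 * pi * x)))) integrable_on {0..1}"
      by (intro integrable_continuous_real continuous_intros contn)
    fix x :: real assume x: "x \<in> {0..1}"
    have "vector_derivative c (at x within {0..1}) = 2 * pi * \<i> * R * exp (2 * of_real pi * \<i> * x)"
      unfolding c_def using x by (intro vector_derivative_circlepath01) auto
    hence "norm (vector_derivative c (at x within {0..1})) = 2 * pi * R"
      using R by (simp add: norm_mult)
    thus "norm (f (c x) / c x ^ Suc k * vector_derivative c (at x within {0..1}))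
       \<le> 2 * pi / R ^ k * norm (f (R * cis (2 * pi * x)))"
      using R by (simp add: norm_mult norm_divide norm_power cx mult.commute)
  qed (use 1 in blast)
  also have "\<dots> = 2 * pi / R ^ k * J"
    by (simp add: J_def)
  finally have "norm (coef f k) * R ^ k \<le> J"
    using R by (simp add: norm_mult field_simps)
  \<comment> \<open>\<open>J\<close> is a gauge integral, as contour integrals are. For a
    nonnegative Borel integrand it agrees with the Lebesgue integral.\<close>
  moreover have "(\<integral>\<^sup>+x. ennreal (norm (f (R * cis (2 * pi * x)))) * indicator {0..1} x \<partial>lborel) = ennreal J"
  proof -
    have "set_borel_measurable borel {0..1} (\<lambda>x. norm (f (R * cis (2 * pi * x))))"
      by (rule set_measurable_continuous_on) (use contn in auto)
    hence m: "(\<lambda>x. indicator {0..1} x * norm (f (R * cis (2 * pi * x)))) \<in> borel_measurable borel"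
      by (simp add: set_borel_measurable_def)
    have "((\<lambda>x. if x \<in> {0..1} then norm (f (R * cis (2 * pi * x))) else 0) has_integral J) UNIV"
      using 2 by (simp only: has_integral_restrict_UNIV)
    also have "(\<lambda>x. if x \<in> {0..1} then norm (f (R * cis (2 * pi * x))) else 0) =
               (\<lambda>x. indicator {0..1} x * norm (f (R * cis (2 * pi * x))))"
      by (auto simp: indicator_def)
    finally have "((\<lambda>x. indicator {0..1} x * norm (f (R * cis (2 * pi * x)))) has_integral J) UNIV" .
    hence "(\<integral>\<^sup>+x. ennreal (indicator {0..1} x * norm (f (R * cis (2 * pi * x)))) \<partial>lborel) = ennreal J"
      by (intro nn_integral_has_integral_lborel m) auto
    thus ?thesis by (subst (asm) nn_integral_cong) (auto simp: indicator_def ennreal_mult'')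
  qed
  ultimately show ?thesis by (simp add: ennreal_leI)
qed

lemma norm_coef_le:
  assumes f: "f \<in> entire_functions" and "R > 0" and B: "\<And>z. norm z = R \<Longrightarrow> norm (f z) \<le> B"
  shows "norm (coef f k) \<le> B / R ^ k"
proof -
  have "norm ((deriv ^^ k) f 0) \<le> fact k * B / R ^ k"
    using f assms(2) B by (intro Cauchy_inequality)
      (auto simp: entire_functions_def intro: holomorphic_on_subset holomorphic_on_imp_continuous_on)
  thus ?thesis by (simp add: coef_def norm_divide field_simps)
qed

lemma coef_diff:
  assumes "f \<in> entire_functions" "g \<in> entire_functions"
  shows "coef (\<lambda>z. f z - g z) k = coef f k - coef g k"
  using higher_deriv_diff[of f UNIV g 0 k] assms
  by (simp add: coef_def entire_functions_def diff_divide_distrib)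

text \<open>By Cauchy's estimate with R = 1 a coefficient is 1-Lipschitz for the supremum norm on
  the unit disc; \<open>e / 2\<close> restores the strict inequality.\<close>

lemma continuous_map_coef: "continuous_map entire_topology euclidean (\<lambda>f. coef f k)"
proof (rule continuous_map_entireI, rule exI[of _ "cball 0 1"], rule exI)
  fix f :: "complex \<Rightarrow> complex" and e :: real assume f: "f \<in> entire_functions" and e: "e > 0"
  show "compact (cball (0::complex) 1) \<and> e / 2 > 0 \<and> (\<forall>g\<in>entire_functions.
     (\<forall>z\<in>cball 0 1. dist (g z) (f z) < e / 2) \<longrightarrow> dist (coef g k) (coef f k) < e)"
  proof (intro conjI ballI impI)
    fix g assume g: "g \<in> entire_functions" "\<forall>z\<in>cball 0 1. dist (g z) (f z) < e / 2"
    have "norm (coef (\<lambda>z. g z - f z) k) \<le> (e / 2) / 1 ^ k"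
      by (rule norm_coef_le) (use f g in \<open>auto simp: entire_functions_def dist_norm less_imp_le intro: holomorphic_on_diff\<close>)
    thus "dist (coef g k) (coef f k) < e"
      using e by (simp add: coef_diff f g dist_norm)
  qed (use e in auto)
qed

text \<open>The tail bound depends on the majorant \<open>A\<close> and the radius only. This
  uniformity over all admissible coefficient sequences is what makes the poly-disc of coefficients a
  compact set of functions later on.\<close>

lemma powser_tail_bound:
  fixes c :: "nat \<Rightarrow> complex"
  assumes sum: "summable (\<lambda>k. A k * R ^ k)" and c: "\<And>k. norm (c k) \<le> A k" and z: "norm z \<le> R"
  shows "summable (\<lambda>k. c k * z ^ k)"
    and "norm ((\<Sum>k. c k * z ^ k) - (\<Sum>k<n. c k * z ^ k)) \<le> (\<Sum>k. A (k + n) * R ^ (k + n))"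
proof -
  have A: "A k \<ge> 0" for k using c[of k] norm_ge_zero order_trans by blast
  have *: "norm (c k * z ^ k) \<le> A k * R ^ k" for k
    unfolding norm_mult norm_power by (intro mult_mono power_mono c z A) auto
  show s: "summable (\<lambda>k. c k * z ^ k)"
    by (rule summable_comparison_test'[OF sum, of 0]) (use * in auto)
  have "(\<Sum>k. c k * z ^ k) - (\<Sum>k<n. c k * z ^ k) = (\<Sum>k. c (k + n) * z ^ (k + n))"
    using suminf_minus_initial_segment[OF s, of n] by simp
  also have "norm \<dots> \<le> (\<Sum>k. A (k + n) * R ^ (k + n))"
    using * sum by (intro norm_suminf_le) (auto intro: summable_ignore_initial_segment)
  finally show "norm ((\<Sum>k. c k * z ^ k) - (\<Sum>k<n. c k * z ^ k)) \<le> (\<Sum>k. A (k + n) * R ^ (k + n))" .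
qed

lemma summable_norm_coef:
  assumes "f \<in> entire_functions" "R \<ge> 0"
  shows "summable (\<lambda>k. norm (coef f k) * R ^ k)"
proof -
  have "summable (\<lambda>k. norm (coef f k * of_real R ^ k))"
    using assms(2) by (intro powser_insidea[OF sums_summable[OF coef_sums[OF assms(1), of "of_real (R + 1)"]]])
       (simp add: abs_if del: of_real_add)
  thus ?thesis using assms(2) by (simp add: norm_mult norm_power)
qed

text \<open>Polynomials are encoded as coefficient lists, so that a countable dense \<open>S\<close>
  yields the countable set \<open>lists S\<close>; this is separability of the space of entire
  functions. Half of \<delta> pays for the tail, half for moving the coefficients into
  \<open>S\<close>.\<close>

lemma entire_poly_approx:
  assumes f: "f \<in> entire_functions" and "\<delta> > 0" "R \<ge> 0"
    and S: "\<And>X::complex set. open X \<Longrightarrow> X \<noteq> {} \<Longrightarrow> \<exists>d\<in>S. d \<in> X"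
  shows "\<exists>xs\<in>lists S. \<forall>z\<in>cball 0 R. dist (f z) (\<Sum>k<length xs. xs ! k * z ^ k) \<le> \<delta>"
proof -
  note sm = summable_norm_coef[OF f assms(3)]
  obtain n where "norm (\<Sum>k. norm (coef f (k + n)) * R ^ (k + n)) < \<delta> / 2"
    using suminf_exist_split[OF half_gt_zero[OF assms(2)] sm] by blast
  hence n: "(\<Sum>k. norm (coef f (k + n)) * R ^ (k + n)) < \<delta> / 2" by simp
  \<comment> \<open>The added 1 keeps \<open>D\<close> positive when \<open>n = 0\<close>.\<close>
  define D where "D = (\<Sum>k<n. R ^ k) + 1"
  have D: "D > 0" unfolding D_def using assms(3) by (intro add_nonneg_pos sum_nonneg) auto
  define \<eta> where "\<eta> = \<delta> / 2 / D"
  have \<eta>: "\<eta> > 0" "\<eta> * D = \<delta> / 2" using assms(2) D by (auto simp: \<eta>_def)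
  have "\<exists>d\<in>S. d \<in> ball (coef f k) \<eta>" for k
    using \<eta> by (intro S) auto
  then obtain x where x: "\<And>k. x k \<in> S" "\<And>k. dist (coef f k) (x k) < \<eta>" by (metis mem_ball)
  have "dist (f z) (\<Sum>k<n. x k * z ^ k) \<le> \<delta>" if z: "norm z \<le> R" for z
  proof -
    have "norm (f z - (\<Sum>k<n. coef f k * z ^ k)) \<le> \<delta> / 2"
      using powser_tail_bound(2)[OF sm, of "coef f" z n] z n sums_unique[OF coef_sums[OF f, of z]] by auto
    moreover have "norm ((\<Sum>k<n. coef f k * z ^ k) - (\<Sum>k<n. x k * z ^ k)) \<le> (\<Sum>k<n. \<eta> * R ^ k)"
      unfolding sum_subtractf[symmetric] left_diff_distrib[symmetric]
      by (intro sum_norm_le, unfold norm_mult norm_power, intro mult_mono power_mono z)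
         (use x(2) assms(3) \<eta> in \<open>auto simp: dist_norm less_imp_le\<close>)
    moreover have "(\<Sum>k<n. \<eta> * R ^ k) \<le> \<delta> / 2"
      using \<eta> by (simp add: sum_distrib_left[symmetric] D_def algebra_simps)
    ultimately show ?thesis
      unfolding dist_norm by norm
  qed
  thus ?thesis
    by (intro bexI[of _ "map x [0..<n]"]) (auto simp: x(1))
qed

text \<open>Point evaluations generate the Borel sets. By separability an open set is a countable
  union of closed balls around polynomials with coefficients in a countable dense set, and by
  continuity each ball is cut out by countably many evaluations.\<close>

lemma measurable_entireI:
  assumes ent: "\<And>\<omega>. \<omega> \<in> space M \<Longrightarrow> X \<omega> \<in> entire_functions"
    and meas: "\<And>t. (\<lambda>\<omega>. X \<omega> t) \<in> borel_measurable M"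
  shows "X \<in> measurable M (borel_sets_of entire_topology)"
  unfolding borel_sets_of_def
proof (rule measurable_measure_of)
  show "{U. openin entire_topology U} \<subseteq> Pow (topspace entire_topology)"
    by (auto dest: openin_subset)
  show "X \<in> space M \<rightarrow> topspace entire_topology"
    using ent by (auto simp: topspace_entire_topology)
next
  fix U assume "U \<in> {U. openin entire_topology U}"
  hence U: "entire_open U" by (simp add: openin_entire_topology)
  obtain S :: "complex set" where S: "countable S" "\<And>X. open X \<Longrightarrow> X \<noteq> {} \<Longrightarrow> \<exists>d\<in>S. d \<in> X"
    using countable_dense_exists[where 'a=complex] by (auto 4 3)
  \<comment> \<open>The condition is the non-strict one, since only a closed condition extends from
    a dense subset of the disc to the whole disc.\<close>
  define B where "B = (\<lambda>(xs, m::nat, q::nat). {g\<in>entire_functions. \<forall>z\<in>cball 0 (real m).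
     dist (g z) (\<Sum>k<length xs. xs ! k * z ^ k) \<le> 1 / Suc q})"
  define I where "I = {i \<in> lists S \<times> UNIV \<times> UNIV. B i \<subseteq> U}"
  have "countable I"
    by (rule countable_subset[of _ "lists S \<times> UNIV \<times> UNIV"]) (auto simp: I_def S(1))
  have UB: "U = (\<Union>i\<in>I. B i)"
  proof (intro equalityI subsetI)
    fix f assume f: "f \<in> U"
    then obtain K e where K: "compact K" "e > 0"
      "\<forall>g\<in>entire_functions. (\<forall>z\<in>K. dist (g z) (f z) < e) \<longrightarrow> g \<in> U"
      using U by (auto simp: entire_open_def)
    have fe: "f \<in> entire_functions" using U f by (auto simp: entire_open_def)
    obtain b where b: "\<And>z. z \<in> K \<Longrightarrow> norm z \<le> b" using compact_imp_bounded[OF K(1)] by (auto simp: bounded_iff)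
    obtain m :: nat where m: "b \<le> m" using real_arch_simple by blast
    obtain q :: nat where q: "1 / Suc q < e / 2" using K(2) nat_approx_posE half_gt_zero by blast
    obtain xs where xs: "xs \<in> lists S" "\<forall>z\<in>cball 0 (real m). dist (f z) (\<Sum>k<length xs. xs ! k * z ^ k) \<le> 1 / Suc q"
      using entire_poly_approx[OF fe, of "1 / Suc q" "real m" S] S(2) by auto
    have "B (xs, m, q) \<subseteq> U"
    proof
      fix g assume g: "g \<in> B (xs, m, q)"
      have "dist (g z) (f z) < e" if "z \<in> K" for z
      proof -
        have "z \<in> cball 0 (real m)" using b[OF that] m by simp
        hence "dist (f z) (\<Sum>k<length xs. xs ! k * z ^ k) \<le> 1 / Suc q" "dist (g z) (\<Sum>k<length xs. xs ! k * z ^ k) \<le> 1 / Suc q"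
          using g xs(2) by (auto simp: B_def)
        thus ?thesis using q dist_triangle2[of "g z" "f z" "\<Sum>k<length xs. xs ! k * z ^ k"] by linarith
      qed
      thus "g \<in> U" using K(3) g by (auto simp: B_def)
    qed
    hence "(xs, m, q) \<in> I" using xs(1) by (auto simp: I_def)
    moreover have "f \<in> B (xs, m, q)" using fe xs(2) by (auto simp: B_def)
    ultimately show "f \<in> (\<Union>i\<in>I. B i)" by blast
  qed (auto simp: I_def)
  have "X -` B i \<inter> space M \<in> sets M" for i
  proof -
    obtain xs m q where i: "i = (xs, m, q)" by (cases i) auto
    obtain D where D: "countable D" "D \<subseteq> cball (0::complex) (real m)" "cball 0 (real m) \<subseteq> closure D"
      using separable[of "cball (0::complex) (real m)"] by blast
    have *: "(\<forall>z\<in>cball 0 (real m). dist (g z) (\<Sum>k<length xs. xs ! k * z ^ k) \<le> 1 / Suc q) \<longleftrightarrow>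
             (\<forall>z\<in>D. dist (g z) (\<Sum>k<length xs. xs ! k * z ^ k) \<le> 1 / Suc q)" if "g \<in> entire_functions" for g
    proof
      assume **: "\<forall>z\<in>D. dist (g z) (\<Sum>k<length xs. xs ! k * z ^ k) \<le> 1 / Suc q"
      have "continuous_on (closure D) g"
        using that by (auto simp: entire_functions_def intro: holomorphic_on_imp_continuous_on holomorphic_on_subset)
      hence "continuous_on (closure D) (\<lambda>z. dist (g z) (\<Sum>k<length xs. xs ! k * z ^ k))"
        by (intro continuous_intros)
      thus "\<forall>z\<in>cball 0 (real m). dist (g z) (\<Sum>k<length xs. xs ! k * z ^ k) \<le> 1 / Suc q"
        using ** D(3) continuous_le_on_closure[of D "\<lambda>z. dist (g z) (\<Sum>k<length xs. xs ! k * z ^ k)"]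
        by blast
    qed (use D(2) in blast)
    have "X -` B i \<inter> space M = {\<omega>\<in>space M. \<forall>z\<in>D. dist (X \<omega> z) (\<Sum>k<length xs. xs ! k * z ^ k) \<le> 1 / Suc q}"
      using ent * by (auto simp: B_def i)
    also have "\<dots> \<in> sets M" 
      using D(1) by (intro sets.sets_Collect_countable_All' borel_measurable_le borel_measurable_dist meas borel_measurable_const)
    finally show ?thesis .
  qed
  hence "(\<Union>i\<in>I. X -` B i \<inter> space M) \<in> sets M"
    using \<open>countable I\<close> by (intro sets.countable_UN') auto
  also have "(\<Union>i\<in>I. X -` B i \<inter> space M) = X -` U \<inter> space M" unfolding UB by auto
  finally show "X -` U \<inter> space M \<in> sets M" .
qed

text \<open>The Caratheodory argument for joint measurability: rounding the angle down to a multiple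
  of \<open>1 / Suc i\<close> leaves countably many evaluations, and continuity in the angle gives
  the pointwise limit.\<close>

lemma measurable_entire_circle:
  assumes ent: "\<And>\<omega>. \<omega> \<in> space M \<Longrightarrow> X \<omega> \<in> entire_functions"
    and meas: "\<And>t. (\<lambda>\<omega>. X \<omega> t) \<in> borel_measurable M"
  shows "(\<lambda>(\<omega>, x). X \<omega> (of_real R * cis (2 * pi * x))) \<in> borel_measurable (M \<Otimes>\<^sub>M lborel)"
proof (rule borel_measurable_LIMSEQ_metric)
  define u where "u = (\<lambda>i::nat. \<lambda>x::real. real_of_int \<lfloor>real (Suc i) * x\<rfloor> / real (Suc i))"
  show "(\<lambda>(\<omega>, x). X \<omega> (of_real R * cis (2 * pi * u i x))) \<in> borel_measurable (M \<Otimes>\<^sub>M lborel)" for i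
  proof -
    have "(\<lambda>p. (\<lambda>j p. X (fst p) (of_real R * cis (2 * pi * (real_of_int j / real (Suc i))))) 
                 \<lfloor>real (Suc i) * snd p\<rfloor> p) \<in> borel_measurable (M \<Otimes>\<^sub>M lborel)"
    proof (rule measurable_compose_countable[where g = "\<lambda>p. \<lfloor>real (Suc i) * snd p\<rfloor>"
          and f = "\<lambda>j p. X (fst p) (of_real R * cis (2 * pi * (real_of_int j / real (Suc i))))"])
      show "(\<lambda>p. X (fst p) (of_real R * cis (2 * pi * (real_of_int j / real (Suc i))))) \<in> borel_measurable (M \<Otimes>\<^sub>M lborel)" for j
        by (rule measurable_compose[OF measurable_fst meas])
    qed measurable
    thus ?thesis by (simp add: u_def case_prod_beta')
  qed
  fix p assume "p \<in> space (M \<Otimes>\<^sub>M (lborel :: real measure))"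
  then obtain \<omega> x where p: "p = (\<omega>, x)" "\<omega> \<in> space M" by (auto simp: space_pair_measure)
  have "continuous_on UNIV (X \<omega>)"
    using ent[OF p(2)] by (auto simp: entire_functions_def intro: holomorphic_on_imp_continuous_on)
  hence c: "isCont (X \<omega>) z" for z by (simp add: continuous_on_eq_continuous_at)
  have "(\<lambda>i. u i x) \<longlonglongrightarrow> x"
  proof (rule tendsto_sandwich[of "\<lambda>i. x - 1 / Suc i" _ _ "\<lambda>i. x"])
    have "(\<lambda>i. x - 1 / Suc i) \<longlonglongrightarrow> x - 0"
      by (intro tendsto_diff tendsto_const LIMSEQ_Suc[OF lim_1_over_n])
    thus "(\<lambda>i. x - 1 / Suc i) \<longlonglongrightarrow> x" by simp
    show "\<forall>\<^sub>F i in sequentially. x - 1 / Suc i \<le> u i x"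
    proof (rule always_eventually, rule allI)
      fix i
      have "real (Suc i) * x - 1 \<le> real_of_int \<lfloor>real (Suc i) * x\<rfloor>" by linarith
      hence "(real (Suc i) * x - 1) / Suc i \<le> u i x" unfolding u_def by (intro divide_right_mono) auto
      thus "x - 1 / Suc i \<le> u i x" by (simp add: diff_divide_distrib)
    qed
    show "\<forall>\<^sub>F i in sequentially. u i x \<le> x"
    proof (rule always_eventually, rule allI)
      fix i
      have "real_of_int \<lfloor>real (Suc i) * x\<rfloor> \<le> real (Suc i) * x" by linarith
      hence "u i x \<le> real (Suc i) * x / real (Suc i)" unfolding u_def by (intro divide_right_mono) auto
      thus "u i x \<le> x" by simp
    qed
  qed auto
  hence "(\<lambda>i. X \<omega> (of_real R * cis (2 * pi * u i x))) \<longlonglongrightarrow> X \<omega> (of_real R * cis (2 * pi * x))"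
    unfolding cis_conv_exp by (intro isCont_tendsto_compose[OF c] tendsto_intros)
  thus "(\<lambda>i. case p of (\<omega>, x) \<Rightarrow> X \<omega> (of_real R * cis (2 * pi * u i x))) \<longlonglongrightarrow>
          (case p of (\<omega>, x) \<Rightarrow> X \<omega> (of_real R * cis (2 * pi * x)))" by (simp add: p)
qed

text \<open>Integrating the L1 Cauchy estimate and exchanging the integrals reduces a coefficient to
  first moments at single points of one circle. No bound on the expectation of a supremum is
  involved.\<close>

lemma coef_moment_bound:
  assumes "prob_space M" and R: "R > 0"
    and ent: "\<And>\<omega>. \<omega> \<in> space M \<Longrightarrow> X \<omega> \<in> entire_functions"
    and meas: "\<And>t. (\<lambda>\<omega>. X \<omega> t) \<in> borel_measurable M"
    and C: "\<And>t. norm t = R \<Longrightarrow> (\<integral>\<^sup>+\<omega>. norm (X \<omega> t) \<partial>M) \<le> ennreal C"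
  shows "(\<integral>\<^sup>+\<omega>. norm (coef (X \<omega>) k) \<partial>M) \<le> ennreal (C / R ^ k)"
proof -
  interpret prob_space M by fact
  interpret pair_sigma_finite M "lborel :: real measure" ..
  have m1: "(\<lambda>\<omega>. coef (X \<omega>) k) \<in> borel_measurable M"
    by (rule measurable_continuous_map_compose[OF measurable_entireI[OF ent meas] continuous_map_coef])
  have m2[measurable]: "(\<lambda>p. X (fst p) (of_real R * cis (2 * pi * snd p))) \<in> borel_measurable (M \<Otimes>\<^sub>M lborel)"
    using measurable_entire_circle[OF ent meas] by (simp add: case_prod_beta')
  have "ennreal (R ^ k) * (\<integral>\<^sup>+\<omega>. norm (coef (X \<omega>) k) \<partial>M) = (\<integral>\<^sup>+\<omega>. ennreal (norm (coef (X \<omega>) k) * R ^ k) \<partial>M)"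
    using R m1 by (subst nn_integral_cmult[symmetric]) (auto simp: ennreal_mult'' mult.commute)
  also have "\<dots> \<le> (\<integral>\<^sup>+\<omega>. (\<integral>\<^sup>+x. ennreal (norm (X \<omega> (R * cis (2 * pi * x)))) * indicator {0..1} x \<partial>lborel) \<partial>M)"
    by (intro nn_integral_mono norm_coef_le_circle ent R)
  also have "\<dots> = (\<integral>\<^sup>+x. (\<integral>\<^sup>+\<omega>. ennreal (norm (X \<omega> (R * cis (2 * pi * x)))) * indicator {0..1} x \<partial>M) \<partial>lborel)"
    by (subst Fubini') (auto simp: case_prod_beta')
  also have "\<dots> \<le> (\<integral>\<^sup>+x. ennreal C * indicator {0..1::real} x \<partial>lborel)"
  proof (rule nn_integral_mono)
    fix x :: real
    have "(\<integral>\<^sup>+\<omega>. ennreal (norm (X \<omega> (R * cis (2 * pi * x)))) \<partial>M) \<le> ennreal C"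
      using R by (intro C) (simp add: norm_mult)
    thus "(\<integral>\<^sup>+\<omega>. ennreal (norm (X \<omega> (R * cis (2 * pi * x)))) * indicator {0..1} x \<partial>M) \<le> ennreal C * indicator {0..1::real} x"
      by (cases "x \<in> {0..1}") auto
  qed
  also have "\<dots> = ennreal C" by (simp add: nn_integral_cmult)
  finally have "ennreal (R ^ k) * (\<integral>\<^sup>+\<omega>. norm (coef (X \<omega>) k) \<partial>M) \<le> ennreal C" .
  hence "ennreal (1 / R ^ k) * (ennreal (R ^ k) * (\<integral>\<^sup>+\<omega>. norm (coef (X \<omega>) k) \<partial>M)) \<le> ennreal (1 / R ^ k) * ennreal C"
    by (rule mult_left_mono) simp
  thus ?thesis using R by (simp add: mult.assoc[symmetric] ennreal_mult'[symmetric])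
qed

section \<open>Compact sets of power series and trigonometric functionals\<close>

text \<open>Every real-linear functional of finitely many complex values has this form, so the
  expectations of \<open>cis (lin I lam X)\<close> are the finite-dimensional characteristic
  functions.\<close>

definition lin :: "complex set \<Rightarrow> (complex \<Rightarrow> complex) \<Rightarrow> (complex \<Rightarrow> complex) \<Rightarrow> real" where
  "lin I lam f = Re (\<Sum>t\<in>I. lam t * f t)"

lemma lin_add:
  assumes "finite I" "finite J"
  shows "\<exists>K kap. finite K \<and> (\<forall>f. lin K kap f = lin I lam f + lin J mu f)"
proof (intro exI conjI allI)
  let ?kap = "\<lambda>t. (if t \<in> I then lam t else 0) + (if t \<in> J then mu t else 0)"
  fix f
  have "(\<Sum>t\<in>I \<union> J. ?kap t * f t) =
        (\<Sum>t\<in>I \<union> J. if t \<in> I then lam t * f t else 0) + (\<Sum>t\<in>I \<union> J. if t \<in> J then mu t * f t else 0)"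
    by (subst sum.distrib[symmetric], rule sum.cong) (auto simp: algebra_simps)
  also have "\<dots> = (\<Sum>t\<in>I. lam t * f t) + (\<Sum>t\<in>J. mu t * f t)"
    using assms by (simp add: sum.inter_restrict[symmetric] Int_absorb1 Int_absorb2)
  finally show "lin (I \<union> J) ?kap f = lin I lam f + lin J mu f"
    by (simp add: lin_def)
qed (use assms in auto)

lemma lin_uminus: "lin I (\<lambda>t. - lam t) f = - lin I lam f"
  by (simp add: lin_def sum_negf)

text \<open>The complex amplitude \<open>w\<close> provides sines and cosines at once. Only sums are
  generators and closure under products is derived, so that convergence of expectations follows by
  an induction that uses linearity alone.\<close>

inductive_set trig_alg :: "((complex \<Rightarrow> complex) \<Rightarrow> real) set" where
  wave: "finite I \<Longrightarrow> (\<lambda>f. Re (w * cis (lin I lam f))) \<in> trig_alg"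
| add: "p \<in> trig_alg \<Longrightarrow> q \<in> trig_alg \<Longrightarrow> (\<lambda>f. p f + q f) \<in> trig_alg"

lemma trig_alg_const: "(\<lambda>_. c) \<in> trig_alg"
  using trig_alg.wave[of "{}" "of_real c" "\<lambda>_. 0"] by (simp add: lin_def)

lemma trig_alg_mult:
  assumes "p \<in> trig_alg" "q \<in> trig_alg"
  shows "(\<lambda>f. p f * q f) \<in> trig_alg"
  using assms(1)
proof (induction rule: trig_alg.induct)
  case (wave I w lam)
  show ?case using assms(2)
  proof (induction rule: trig_alg.induct)
    case (wave J v mu)
    obtain K kap where K: "finite K" "\<And>f. lin K kap f = lin I lam f + lin J mu f"
      using lin_add[OF \<open>finite I\<close> wave, of lam mu] by blast
    obtain L nu where L: "finite L" "\<And>f. lin L nu f = lin I lam f - lin J mu f"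
      using lin_add[OF \<open>finite I\<close> wave, of lam "\<lambda>t. - mu t"] by (auto simp: lin_uminus)
    \<comment> \<open>The identity Re x * Re y = Re (x * y) / 2 + Re (x * cnj y) / 2: a product of
      waves is a sum of waves with added and subtracted frequencies.\<close>
    have "(\<lambda>f. Re (w * cis (lin I lam f)) * Re (v * cis (lin J mu f))) =
          (\<lambda>f. Re (w * v / 2 * cis (lin K kap f)) + Re (w * cnj v / 2 * cis (lin L nu f)))"
      by (rule ext) (simp add: K L cis.simps cos_add cos_diff sin_add sin_diff field_simps)
    thus ?case by (simp only:) (intro trig_alg.add trig_alg.wave K(1) L(1))
  next
    case (add p q)
    thus ?case using trig_alg.add by (simp add: distrib_left)
  qed
next
  case (add p q)
  thus ?case using trig_alg.add by (simp add: distrib_right)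
qed

text \<open>Serves to truncate: composing with a polynomial close to a clamping function makes an
  approximant globally bounded without leaving the algebra.\<close>

lemma trig_alg_polynomial:
  fixes q :: "real \<Rightarrow> real"
  assumes "real_polynomial_function q" "p \<in> trig_alg"
  shows "(\<lambda>f. q (p f)) \<in> trig_alg"
  using assms(1)
proof (induction rule: real_polynomial_function.induct)
  case (linear h)
  then interpret bounded_linear h .
  have "(\<lambda>f. h (p f)) = (\<lambda>f. h 1 * p f)" 
  proof
    fix f show "h (p f) = h 1 * p f"
      using scale[of "p f" 1] by (simp add: mult.commute)
  qed
  thus ?case using trig_alg_mult[OF trig_alg_const[of "h 1"] assms(2)] by (simp only:)
qed (use trig_alg_const trig_alg.add trig_alg_mult in auto)

lemma trig_alg_bounded:
  assumes "p \<in> trig_alg"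
  obtains B where "B > 0" "\<And>f. \<bar>p f\<bar> \<le> B"
proof -
  from assms have "\<exists>B. \<forall>f. \<bar>p f\<bar> \<le> B"
  proof (induction rule: trig_alg.induct)
    case (wave I w lam)
    have "\<bar>Re (w * cis (lin I lam f))\<bar> \<le> norm w" for f
      using abs_Re_le_cmod[of "w * cis (lin I lam f)"] by (simp add: norm_mult)
    thus ?case by blast
  next
    case (add p q)
    then obtain B C where "\<And>f. \<bar>p f\<bar> \<le> B" "\<And>f. \<bar>q f\<bar> \<le> C" by blast
    hence "\<bar>p f + q f\<bar> \<le> B + C" for f by (meson abs_triangle_ineq add_mono order_trans)
    thus ?case by blast
  qed
  then obtain B where B: "\<And>f. \<bar>p f\<bar> \<le> B" by blast
  have "\<bar>B\<bar> + 1 > 0" "\<bar>p f\<bar> \<le> \<bar>B\<bar> + 1" for f using B[of f] by linarith+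
  thus ?thesis using that by blast
qed

lemma trig_alg_continuous: "p \<in> trig_alg \<Longrightarrow> continuous_on S p"
proof (induction rule: trig_alg.induct)
  case (wave I w lam)
  have "continuous_on S (\<lambda>f. lin I lam f)"
    unfolding lin_def
    by (intro continuous_intros continuous_on_subset[OF continuous_on_product_coordinates subset_UNIV])
  thus ?case by (intro continuous_intros)
qed (intro continuous_intros)

text \<open>At a point where \<open>f\<close> and \<open>g\<close> differ, \<open>mu\<close> is
  scaled so that the two phases differ by exactly 1, which is not a multiple of 2 pi. One of the
  real and imaginary parts of the waves must then differ, the amplitude \<open>- \<i>\<close>
  selecting the imaginary part.\<close>

lemma trig_alg_separates:
  assumes "f \<noteq> g"
  shows "\<exists>p\<in>trig_alg. p f \<noteq> p g"
proof -
  obtain t where "f t \<noteq> g t" using assms by blast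
  define mu where "mu = inverse (f t - g t)"
  have "lin {t} (\<lambda>_. mu) f - lin {t} (\<lambda>_. mu) g = Re (mu * (f t - g t))"
    by (simp add: lin_def algebra_simps)
  also have "\<dots> = 1" using \<open>f t \<noteq> g t\<close> by (simp add: mu_def)
  finally have l: "lin {t} (\<lambda>_. mu) f = 1 + lin {t} (\<lambda>_. mu) g" by simp
  have "cis (lin {t} (\<lambda>_. mu) f) \<noteq> cis (lin {t} (\<lambda>_. mu) g)"
  proof
    assume "cis (lin {t} (\<lambda>_. mu) f) = cis (lin {t} (\<lambda>_. mu) g)"
    hence "cis 1 * cis (lin {t} (\<lambda>_. mu) g) = cis (lin {t} (\<lambda>_. mu) g)" by (simp add: l cis_mult)
    hence "Im (cis 1) = 0" by simp
    moreover have "sin (1::real) > 0" by (rule sin_gt_zero) (use pi_gt3 in auto)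
    ultimately show False by simp
  qed
  hence "Re (1 * cis (lin {t} (\<lambda>_. mu) f)) \<noteq> Re (1 * cis (lin {t} (\<lambda>_. mu) g)) \<or>
         Re (- \<i> * cis (lin {t} (\<lambda>_. mu) f)) \<noteq> Re (- \<i> * cis (lin {t} (\<lambda>_. mu) g))"
    by (auto simp: complex_eq_iff)
  thus ?thesis
    by (elim disjE) (erule bexI[rotated, OF trig_alg.wave] bexI[OF _ trig_alg.wave]; simp)+
qed

text \<open>Tychonoff's theorem for a product of closed discs.\<close>

lemma compact_poly_disc: "compact {c :: nat \<Rightarrow> complex. \<forall>k. norm (c k) \<le> A k}"
proof -
  have "compactin (product_topology (\<lambda>_. euclidean) UNIV) (PiE UNIV (\<lambda>k. cball (0::complex) (A k)))"
    by (subst compactin_PiE) auto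
  moreover have "PiE UNIV (\<lambda>k. cball (0::complex) (A k)) = {c. \<forall>k. norm (c k) \<le> A k}" by auto
  ultimately show ?thesis by (simp add: euclidean_product_topology)
qed

text \<open>
  The compact set is parametrized by its Taylor coefficients: sequences form a metric space, whereas
  the product topology on \<open>complex \<Rightarrow> complex\<close> is not an instance of \<open>t2_space\<close>.
\<close>

lemma trig_alg_approx:
  fixes F :: "(complex \<Rightarrow> complex) \<Rightarrow> real"
  assumes A: "\<And>R. R \<ge> 0 \<Longrightarrow> summable (\<lambda>k. A k * R ^ k)"
    and F: "continuous_map entire_topology euclidean F" and e: "e > 0"
  shows "\<exists>p\<in>trig_alg. \<forall>f\<in>entire_functions. (\<forall>k. norm (coef f k) \<le> A k) \<longrightarrow> \<bar>F f - p f\<bar> < e"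
proof -
  define K where "K = {c :: nat \<Rightarrow> complex. \<forall>k. norm (c k) \<le> A k}"
  define \<Phi> where "\<Phi> = (\<lambda>c::nat \<Rightarrow> complex. \<lambda>t. \<Sum>k. c k * t ^ k)"
  have K: "compact K" unfolding K_def by (rule compact_poly_disc)
  have ent: "\<Phi> c \<in> entire_functions" if "c \<in> K" for c
  proof -
    have s: "summable (\<lambda>k. c k * z ^ k)" for z
      using that by (intro powser_tail_bound(1)[OF A[of "norm z"]]) (auto simp: K_def)
    have "\<Phi> c holomorphic_on ball 0 r" for r
      using s by (intro power_series_holomorphic[of _ _ c]) (auto simp: \<Phi>_def summable_sums)
    hence "\<Phi> c field_differentiable at z" for z
      by (rule holomorphic_on_imp_differentiable_at[of _ "ball 0 (norm z + 1)"]) auto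
    thus ?thesis by (auto simp: entire_functions_def holomorphic_on_def field_differentiable_at_within)
  qed
  \<comment> \<open>On \<open>K\<close> coordinatewise convergence of coefficients already gives
    locally uniform convergence: the common majorant \<open>A\<close> controls both tails by d/3
    each, and finitely many coefficients account for the last third.\<close>
  have unif: "\<exists>N. \<forall>n\<ge>N. \<forall>z\<in>cball 0 R. dist (\<Phi> (cs n) z) (\<Phi> c z) < d"
    if cs: "\<And>n. cs n \<in> K" "c \<in> K" "cs \<longlonglongrightarrow> c" and d: "d > 0" and R: "R \<ge> 0" for cs c d R
  proof -
    obtain m where "norm (\<Sum>k. A (k + m) * R ^ (k + m)) < d / 3"
      using suminf_exist_split[of "d / 3", OF _ A[OF R]] d by auto
    hence m: "(\<Sum>k. A (k + m) * R ^ (k + m)) < d / 3" by simp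
    have "(\<lambda>n. \<Sum>k<m. norm (cs n k - c k) * R ^ k) \<longlonglongrightarrow> (\<Sum>k<m. norm (c k - c k) * R ^ k)"
      by (intro tendsto_intros
            continuous_on_tendsto_compose[OF continuous_on_product_coordinates cs(3)]) auto
    hence "\<forall>\<^sub>F n in sequentially. (\<Sum>k<m. norm (cs n k - c k) * R ^ k) < d / 3"
      using d by (intro order_tendstoD) auto
    then obtain N where N: "\<And>n. n \<ge> N \<Longrightarrow> (\<Sum>k<m. norm (cs n k - c k) * R ^ k) < d / 3"
      by (auto simp: eventually_sequentially)
    have "dist (\<Phi> (cs n) z) (\<Phi> c z) < d" if n: "n \<ge> N" and z: "norm z \<le> R" for n z
    proof -
      have "norm (\<Phi> (cs n) z - (\<Sum>k<m. cs n k * z ^ k)) \<le> (\<Sum>k. A (k + m) * R ^ (k + m))"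
           "norm (\<Phi> c z - (\<Sum>k<m. c k * z ^ k)) \<le> (\<Sum>k. A (k + m) * R ^ (k + m))"
        unfolding \<Phi>_def using cs(1)[of n] cs(2) z by (intro powser_tail_bound(2) A[OF R]; simp add: K_def)+
      moreover have "norm ((\<Sum>k<m. cs n k * z ^ k) - (\<Sum>k<m. c k * z ^ k)) \<le> (\<Sum>k<m. norm (cs n k - c k) * R ^ k)"
        unfolding sum_subtractf[symmetric] left_diff_distrib[symmetric]
        by (intro sum_norm_le, unfold norm_mult norm_power, intro mult_mono power_mono z) auto
      ultimately show ?thesis using m N[OF n] unfolding dist_norm by norm
    qed
    thus ?thesis by (intro exI[of _ N]) auto
  qed
  have cont: "continuous_on K \<Phi>"
  proof (rule continuous_on_coordinatewise_then_product, unfold continuous_on_sequentially, safe)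
    fix z cs c assume cs: "c \<in> K" "\<forall>n. cs n \<in> K" "cs \<longlonglongrightarrow> c"
    show "((\<lambda>x. \<Phi> x z) \<circ> cs) \<longlonglongrightarrow> \<Phi> c z"
      unfolding lim_sequentially o_def using unif[of cs c _ "norm z"] cs by fastforce
  qed
  have "continuous_on K (\<lambda>c. F (\<Phi> c))"
  proof (unfold continuous_on_sequentially, safe)
    fix cs c assume cs: "c \<in> K" "\<forall>n. cs n \<in> K" "cs \<longlonglongrightarrow> c"
    show "((\<lambda>c. F (\<Phi> c)) \<circ> cs) \<longlonglongrightarrow> F (\<Phi> c)"
      unfolding lim_sequentially o_def
    proof (intro allI impI)
      fix r :: real assume "r > 0"
      then obtain L d where L: "compact L" "d > 0"
        "\<And>g. g \<in> entire_functions \<Longrightarrow> (\<And>z. z \<in> L \<Longrightarrow> dist (g z) (\<Phi> c z) < d) \<Longrightarrow> dist (F g) (F (\<Phi> c)) < r"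
        using continuous_map_entireD[OF F ent[OF cs(1)]] by blast
      obtain b where b: "b > 0" "\<And>z. z \<in> L \<Longrightarrow> norm z \<le> b" using compact_imp_bounded[OF L(1)] by (auto simp: bounded_pos)
      obtain N where "\<forall>n\<ge>N. \<forall>z\<in>cball 0 b. dist (\<Phi> (cs n) z) (\<Phi> c z) < d"
        using unif[of cs c d b] cs L(2) b(1) by auto
      hence "\<forall>n\<ge>N. dist (F (\<Phi> (cs n))) (F (\<Phi> c)) < r"
        using b(2) by (intro allI impI L(3) ent cs(2)[rule_format]) auto
      thus "\<exists>N. \<forall>n\<ge>N. dist (F (\<Phi> (cs n))) (F (\<Phi> c)) < r" by blast
    qed
  qed
  note FPhi = this
  have inj: "c = c'" if "c \<in> K" "c' \<in> K" "\<Phi> c = \<Phi> c'" for c c'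
  proof (rule ccontr)
    assume "c \<noteq> c'"
    hence ex: "\<exists>k. c k - c' k \<noteq> 0" by auto
    define m where "m = (LEAST k. c k - c' k \<noteq> 0)"
    have m: "c m - c' m \<noteq> 0" unfolding m_def by (rule LeastI_ex[OF ex])
    have m': "c k = c' k" if "k < m" for k using not_less_Least[of k "\<lambda>k. c k - c' k \<noteq> 0"] that by (auto simp: m_def)
    have s: "summable (\<lambda>k. c k * z ^ k)" "summable (\<lambda>k. c' k * z ^ k)" for z
      using that(1,2) by (auto intro!: powser_tail_bound(1)[OF A[of "norm z"]] simp: K_def)
    have sums0: "(\<lambda>k. (c k - c' k) * (z - 0) ^ k) sums 0" for z
      using sums_diff[OF summable_sums[OF s(1)[of z]] summable_sums[OF s(2)[of z]]] that(3)
      by (simp add: \<Phi>_def fun_eq_iff left_diff_distrib)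
    show False
    \<comment> \<open>Coefficient 0 is read off at the origin. For \<open>m > 0\<close> the
      isolation of zeros applies, which presupposes a nonzero coefficient of positive index.\<close>
    proof (cases "m = 0")
      case True
      have "c 0 - c' 0 = 0"
        using sums0[of 0] by simp
      thus False using m True by simp
    next
      case False
      show False
      proof (rule powser_0_nonzero[of 1 0 "\<lambda>k. c k - c' k" "\<lambda>_. 0" m])
        fix s :: real assume "0 < s" "\<And>z::complex. z \<in> cball 0 s - {0} \<Longrightarrow> (0::complex) \<noteq> 0"
        from this(2)[of "of_real s"] this(1) show False by auto
      qed (use sums0 m False in auto)
    qed
  qed
  \<comment> \<open>The algebra is pulled back to the coefficient space, where Stone-Weierstrass is
    applied; injectivity of \<open>\<Phi>\<close> on \<open>K\<close> turns separation of functions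
    into separation of coefficient sequences.\<close>
  interpret function_ring_on "(\<lambda>p c. p (\<Phi> c)) ` trig_alg" K
  proof
    show "continuous_on K g" if "g \<in> (\<lambda>p c. p (\<Phi> c)) ` trig_alg" for g
      using that continuous_on_compose2[OF trig_alg_continuous cont] by auto
    show "\<exists>g\<in>(\<lambda>p c. p (\<Phi> c)) ` trig_alg. g c \<noteq> g c'" if cc: "c \<in> K" "c' \<in> K" "c \<noteq> c'" for c c'
    proof -
      obtain p where "p \<in> trig_alg" "p (\<Phi> c) \<noteq> p (\<Phi> c')"
        using trig_alg_separates[of "\<Phi> c" "\<Phi> c'"] inj[OF cc(1,2)] cc(3) by metis
      thus ?thesis by (intro bexI[OF _ imageI]) auto
    qed
    show "(\<lambda>_. r) \<in> (\<lambda>p c. p (\<Phi> c)) ` trig_alg" for r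
      using trig_alg_const[of r] by (rule rev_image_eqI) simp
    fix g h assume "g \<in> (\<lambda>p c. p (\<Phi> c)) ` trig_alg" "h \<in> (\<lambda>p c. p (\<Phi> c)) ` trig_alg"
    then obtain p q where pq: "p \<in> trig_alg" "q \<in> trig_alg" and gh: "g = (\<lambda>c. p (\<Phi> c))" "h = (\<lambda>c. q (\<Phi> c))"
      by auto
    show "(\<lambda>c. g c + h c) \<in> (\<lambda>p c. p (\<Phi> c)) ` trig_alg"
      using trig_alg.add[OF pq] by (rule rev_image_eqI) (simp add: gh)
    show "(\<lambda>c. g c * h c) \<in> (\<lambda>p c. p (\<Phi> c)) ` trig_alg"
      using trig_alg_mult[OF pq] by (rule rev_image_eqI) (simp add: gh)
  qed (rule K)
  obtain p where p: "p \<in> trig_alg" "\<forall>c\<in>K. \<bar>F (\<Phi> c) - p (\<Phi> c)\<bar> < e"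
    using Stone_Weierstrass_basic[OF FPhi e] by blast
  have "f \<in> \<Phi> ` K" if "f \<in> entire_functions" "\<forall>k. norm (coef f k) \<le> A k" for f
  proof -
    have "f = \<Phi> (coef f)" using coef_sums[OF that(1)] by (auto simp: \<Phi>_def sums_iff)
    thus ?thesis using that(2) by (auto simp: K_def)
  qed
  thus ?thesis using p by blast
qed

text \<open>
  \<open>C m\<close> bounds first moments on the circle of radius \<open>Suc m\<close>; Markov's inequality loses the factor
  \<open>2 ^ Suc k / e\<close>, and the summand \<open>1 / fact k\<close> only keeps the bound positive.
\<close>

definition tight_bound :: "(nat \<Rightarrow> real) \<Rightarrow> real \<Rightarrow> nat \<Rightarrow> real" where
  "tight_bound C e k = 2 ^ Suc k / e * ((INF m. C m / real (Suc m) ^ k) + 1 / fact k)"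

context
  fixes C :: "nat \<Rightarrow> real" and e :: real
  assumes C: "\<And>m. C m \<ge> 0" and e: "e > 0"
begin

lemma tight_bound_INF_le: "(INF m. C m / real (Suc m) ^ k) \<le> C m / real (Suc m) ^ k"
  by (rule cINF_lower) (auto intro!: bdd_belowI[of _ 0] divide_nonneg_nonneg C)

lemma tight_bound_pos: "tight_bound C e k > 0"
proof -
  have "(INF m. C m / real (Suc m) ^ k) \<ge> 0"
    by (rule cINF_greatest) (auto intro!: divide_nonneg_nonneg C)
  hence "(INF m. C m / real (Suc m) ^ k) + 1 / fact k > 0" by (rule add_nonneg_pos) simp
  thus ?thesis unfolding tight_bound_def using e by (intro mult_pos_pos) auto
qed

text \<open>The infimum over all radii lets the bound decay faster than any geometric sequence,
  because for a given \<open>R\<close> a sufficiently large circle can be chosen.\<close>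

lemma tight_bound_summable:
  assumes R: "R \<ge> 0"
  shows "summable (\<lambda>k. tight_bound C e k * R ^ k)"
proof -
  \<comment> \<open>One factor 2 absorbs the \<open>2 ^ Suc k\<close> of the bound, the other leaves
    a geometric series of ratio 1/2.\<close>
  obtain m :: nat where m: "4 * R \<le> real m" using real_arch_simple by blast
  let ?g = "\<lambda>k. 2 / e * (C m * (1 / 2) ^ k) + 2 / e * ((2 * R) ^ k / fact k)"
  have g: "summable ?g"
  proof (intro summable_add summable_mult)
    show "summable (\<lambda>k. (1 / 2 :: real) ^ k)" by (rule summable_geometric) simp
    show "summable (\<lambda>k. (2 * R) ^ k / fact k)"
      using summable_exp[of "2 * R"] by (simp add: divide_inverse mult.commute[of "inverse _"])
  qed
  have bd: "norm (tight_bound C e k * R ^ k) \<le> ?g k" for k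
  proof -
    have "(2 * R) ^ k * (INF m. C m / real (Suc m) ^ k) \<le> (2 * R) ^ k * (C m / real (Suc m) ^ k)"
      using R by (intro mult_left_mono tight_bound_INF_le) auto
    also have "\<dots> = C m * (2 * R / real (Suc m)) ^ k" by (simp add: power_divide)
    also have "\<dots> \<le> C m * (1 / 2) ^ k"
      using m R C by (intro mult_left_mono power_mono) (auto simp: field_simps)
    finally have "2 / e * ((2 * R) ^ k * (INF m. C m / real (Suc m) ^ k)) \<le> 2 / e * (C m * (1 / 2) ^ k)"
      using e by (intro mult_left_mono) auto
    moreover have "tight_bound C e k * R ^ k =
        2 / e * ((2 * R) ^ k * (INF m. C m / real (Suc m) ^ k)) + 2 / e * ((2 * R) ^ k / fact k)"
      by (simp add: tight_bound_def power_mult_distrib distrib_left add_divide_distrib mult_ac)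
    moreover have "tight_bound C e k * R ^ k \<ge> 0"
      using tight_bound_pos[of k] R by simp
    ultimately show ?thesis by simp
  qed
  show ?thesis by (rule summable_comparison_test'[OF g, of 0]) (use bd in auto)
qed

text \<open>Markov's inequality, optimized over all circles, gives the k-th coefficient an
  exceptional probability of at most e / 2^(k+1); these sum to e.\<close>

lemma tight_bound_prob:
  assumes "prob_space M"
    and ent: "\<And>\<omega>. \<omega> \<in> space M \<Longrightarrow> X \<omega> \<in> entire_functions"
    and meas: "\<And>t. (\<lambda>\<omega>. X \<omega> t) \<in> borel_measurable M"
    and bound: "\<And>m t. norm t = real (Suc m) \<Longrightarrow> (\<integral>\<^sup>+\<omega>. norm (X \<omega> t) \<partial>M) \<le> ennreal (C m)"
  shows "{\<omega>\<in>space M. \<exists>k. norm (coef (X \<omega>) k) > tight_bound C e k} \<in> sets M"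
    and "measure M {\<omega>\<in>space M. \<exists>k. norm (coef (X \<omega>) k) > tight_bound C e k} \<le> e"
proof -
  interpret prob_space M by fact
  let ?A = "tight_bound C e"
  have m1[measurable]: "(\<lambda>\<omega>. coef (X \<omega>) k) \<in> borel_measurable M" for k
    by (rule measurable_continuous_map_compose[OF measurable_entireI[OF ent meas] continuous_map_coef])
  show s: "{\<omega>\<in>space M. \<exists>k. norm (coef (X \<omega>) k) > ?A k} \<in> sets M" by measurable
  have each: "emeasure M {\<omega>\<in>space M. norm (coef (X \<omega>) k) > ?A k} \<le> ennreal (e * (1 / 2) ^ Suc k)" for k
  proof -
    let ?I = "INF m. C m / real (Suc m) ^ k"
    have I: "(\<integral>\<^sup>+\<omega>. norm (coef (X \<omega>) k) \<partial>M) \<le> ennreal (C m / real (Suc m) ^ k)" for m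
      by (rule coef_moment_bound[OF assms(1) _ ent meas bound]) auto
    hence "(\<integral>\<^sup>+\<omega>. norm (coef (X \<omega>) k) \<partial>M) < \<infinity>" using le_less_trans[OF I[of 0]] by simp
    then obtain r where r: "(\<integral>\<^sup>+\<omega>. norm (coef (X \<omega>) k) \<partial>M) = ennreal r" "r \<ge> 0"
      by (cases "\<integral>\<^sup>+\<omega>. norm (coef (X \<omega>) k) \<partial>M") auto
    have "r \<le> ?I"
      using I r C by (intro cINF_greatest) (auto simp: ennreal_le_iff divide_nonneg_nonneg)
    also have "\<dots> \<le> ?I + 1 / fact k" by simp
    also have "\<dots> = ?A k * (e * (1 / 2) ^ Suc k)"
      using e by (simp add: tight_bound_def power_one_over field_simps)
    finally have r2: "r / ?A k \<le> e * (1 / 2) ^ Suc k"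
      using tight_bound_pos[of k] by (simp add: field_simps)
    have "{\<omega>\<in>space M. norm (coef (X \<omega>) k) > ?A k} \<subseteq>
          {\<omega>\<in>space M. 1 \<le> ennreal (1 / ?A k) * ennreal (norm (coef (X \<omega>) k))}"
      using tight_bound_pos[of k] by (auto simp: ennreal_mult'[symmetric] ennreal_1[symmetric] field_simps simp del: ennreal_1)
    hence "emeasure M {\<omega>\<in>space M. norm (coef (X \<omega>) k) > ?A k} \<le>
        emeasure M {\<omega>\<in>space M. 1 \<le> ennreal (1 / ?A k) * ennreal (norm (coef (X \<omega>) k))}"
      by (rule emeasure_mono) measurable
    also have "\<dots> \<le> ennreal (1 / ?A k) * (\<integral>\<^sup>+\<omega>\<in>space M. norm (coef (X \<omega>) k) \<partial>M)"
      by (rule nn_integral_Markov_inequality) auto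
    also have "(\<integral>\<^sup>+\<omega>\<in>space M. norm (coef (X \<omega>) k) \<partial>M) = ennreal r"
      using r(1) by (simp add: nn_set_integral_space)
    also have "ennreal (1 / ?A k) * ennreal r = ennreal (r / ?A k)"
      using r(2) by (simp add: ennreal_mult''[symmetric])
    also have "\<dots> \<le> ennreal (e * (1 / 2) ^ Suc k)" using r2 by (rule ennreal_leI)
    finally show ?thesis .
  qed
  have "emeasure M {\<omega>\<in>space M. \<exists>k. norm (coef (X \<omega>) k) > ?A k} =
        emeasure M (\<Union>k. {\<omega>\<in>space M. norm (coef (X \<omega>) k) > ?A k})"
    by (rule arg_cong[where f = "emeasure M"]) auto
  also have "\<dots> \<le> (\<Sum>k. emeasure M {\<omega>\<in>space M. norm (coef (X \<omega>) k) > ?A k})"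
    by (rule emeasure_subadditive_countably) auto
  also have "\<dots> \<le> (\<Sum>k. ennreal (e * (1 / 2) ^ Suc k))"
    using each by (intro suminf_le) auto
  also have "\<dots> = ennreal e"
    using sums_mult[OF power_half_series, of e] e by (intro suminf_ennreal_eq) auto
  finally show "measure M {\<omega>\<in>space M. \<exists>k. norm (coef (X \<omega>) k) > ?A k} \<le> e"
    using e by (simp add: emeasure_eq_measure)
qed

end

section \<open>From characteristic functions and moment bounds to weak convergence\<close>

lemma (in prob_space) integral_diff_le_off_event:
  fixes f g :: "'a \<Rightarrow> real"
  assumes [measurable]: "f \<in> borel_measurable M" "g \<in> borel_measurable M" "A \<in> events"
    and f: "\<And>x. x \<in> space M \<Longrightarrow> \<bar>f x\<bar> \<le> B" and g: "\<And>x. x \<in> space M \<Longrightarrow> \<bar>g x\<bar> \<le> B"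
    and off: "\<And>x. x \<in> space M - A \<Longrightarrow> \<bar>f x - g x\<bar> \<le> d"
    and A: "prob A \<le> e" and "d \<ge> 0" "B \<ge> 0"
  shows "\<bar>expectation f - expectation g\<bar> \<le> d + 2 * B * e"
proof -
  have int: "integrable M f" "integrable M g"
    using f g by (auto intro!: integrable_const_bound[of _ B])
  have "\<bar>expectation f - expectation g\<bar> \<le> expectation (\<lambda>x. \<bar>f x - g x\<bar>)"
    using int by (simp flip: Bochner_Integration.integral_diff)
  also have "\<dots> \<le> expectation (\<lambda>x. d + 2 * B * indicator A x)"
  proof (rule integral_mono)
    fix x assume x: "x \<in> space M"
    show "\<bar>f x - g x\<bar> \<le> d + 2 * B * indicator A x"
      using f[OF x] g[OF x] off[of x] x assms(8) by (cases "x \<in> A") (auto simp: abs_le_iff)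
  qed (use int in \<open>auto intro!: Bochner_Integration.integrable_add integrable_mult_right
         integrable_real_indicator simp: emeasure_eq_measure\<close>)
  also have "\<dots> = d + 2 * B * prob A"
    by (subst Bochner_Integration.integral_add)
       (auto simp: prob_space emeasure_eq_measure intro!: integrable_mult_right integrable_real_indicator)
  also have "\<dots> \<le> d + 2 * B * e" using A assms(9) by (intro add_left_mono mult_left_mono) auto
  finally show ?thesis .
qed

lemma trig_alg_measurable:
  assumes "p \<in> trig_alg" and [measurable]: "\<And>t. (\<lambda>\<omega>. X \<omega> t) \<in> borel_measurable M"
  shows "(\<lambda>\<omega>. p (X \<omega>)) \<in> borel_measurable M"
  using assms(1)
proof (induction rule: trig_alg.induct)
  case (wave I w lam)
  have [measurable]: "(\<lambda>\<omega>. lin I lam (X \<omega>)) \<in> borel_measurable M"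
    unfolding lin_def by measurable
  show ?case by (simp add: cis.simps) measurable
qed measurable

lemma trig_alg_tendsto:
  fixes X :: "nat \<Rightarrow> 'a \<Rightarrow> complex \<Rightarrow> complex" and Y :: "'b \<Rightarrow> complex \<Rightarrow> complex"
  assumes M: "\<And>n. prob_space (M n)" and P: "prob_space P"
    and X: "\<And>n t. (\<lambda>\<omega>. X n \<omega> t) \<in> borel_measurable (M n)" and Y: "\<And>t. (\<lambda>\<omega>. Y \<omega> t) \<in> borel_measurable P"
    and cf: "\<And>I lam. finite I \<Longrightarrow>
      (\<lambda>n. \<integral>\<omega>. cis (lin I lam (X n \<omega>)) \<partial>M n) \<longlonglongrightarrow> (\<integral>\<omega>. cis (lin I lam (Y \<omega>)) \<partial>P)"
    and p: "p \<in> trig_alg"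
  shows "(\<lambda>n. \<integral>\<omega>. p (X n \<omega>) \<partial>M n) \<longlonglongrightarrow> (\<integral>\<omega>. p (Y \<omega>) \<partial>P)"
proof -
  have intg: "integrable Q (\<lambda>\<omega>. q (Z \<omega>))"
    if Q: "prob_space Q" "q \<in> trig_alg" "\<And>t. (\<lambda>\<omega>. Z \<omega> t) \<in> borel_measurable Q"
    for Q :: "'c measure" and Z q
  proof -
    interpret prob_space Q by fact
    obtain B where "\<And>f. \<bar>q f\<bar> \<le> B" using trig_alg_bounded[OF Q(2)] by blast
    thus ?thesis using trig_alg_measurable[OF Q(2,3)] by (intro integrable_const_bound[of _ B]) auto
  qed
  have wv: "(\<integral>\<omega>. Re (w * cis (lin I lam (Z \<omega>))) \<partial>Q) = Re (w * (\<integral>\<omega>. cis (lin I lam (Z \<omega>)) \<partial>Q))"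
    if "prob_space Q" "finite I" "\<And>t. (\<lambda>\<omega>. Z \<omega> t) \<in> borel_measurable Q" for Q :: "'c measure" and I Z w lam
  proof -
    interpret prob_space Q by fact
    have [measurable]: "(\<lambda>\<omega>. lin I lam (Z \<omega>)) \<in> borel_measurable Q"
      unfolding lin_def using that(3) by measurable
    have "integrable Q (\<lambda>\<omega>. cis (lin I lam (Z \<omega>)))"
      unfolding cis_conv_exp by (rule integrable_const_bound[of _ 1]) auto
    hence "integrable Q (\<lambda>\<omega>. w * cis (lin I lam (Z \<omega>)))" by (rule integrable_mult_right)
    thus ?thesis by (subst integral_Re) (simp_all only: integral_mult_right_zero)
  qed
  show ?thesis using p
  proof (induction rule: trig_alg.induct)
    case (wave I w lam)
    show ?case
      unfolding wv[OF M wave X] wv[OF P wave Y] by (intro tendsto_intros cf wave)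
  next
    case (add p q)
    thus ?case
      by (subst (1 2) Bochner_Integration.integral_add) (auto intro!: tendsto_add intg M P X Y)
  qed
qed

text \<open>The moment bounds on circles confine all laws to one compact set up to probability
  \<open>e\<close>; there a functional is close to an element of \<open>trig_alg\<close>, whose
  expectations converge with the characteristic functions. The index \<open>start\<close> allows the
  moment bounds to fail initially.\<close>

theorem weakly_converges_entireI:
  fixes X :: "nat \<Rightarrow> 'a \<Rightarrow> complex \<Rightarrow> complex" and Y :: "'b \<Rightarrow> complex \<Rightarrow> complex"
  assumes M: "\<And>n. prob_space (M n)" and P: "prob_space P"
    and Xe: "\<And>n \<omega>. \<omega> \<in> space (M n) \<Longrightarrow> X n \<omega> \<in> entire_functions"
    and Ye: "\<And>\<omega>. \<omega> \<in> space P \<Longrightarrow> Y \<omega> \<in> entire_functions"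
    and X: "\<And>n t. (\<lambda>\<omega>. X n \<omega> t) \<in> borel_measurable (M n)" and Y: "\<And>t. (\<lambda>\<omega>. Y \<omega> t) \<in> borel_measurable P"
    and cf: "\<And>I lam. finite I \<Longrightarrow>
      (\<lambda>n. \<integral>\<omega>. cis (lin I lam (X n \<omega>)) \<partial>M n) \<longlonglongrightarrow> (\<integral>\<omega>. cis (lin I lam (Y \<omega>)) \<partial>P)"
    and XC: "\<And>R. R > 0 \<Longrightarrow> \<exists>C. \<forall>n\<ge>start. \<forall>t. norm t = R \<longrightarrow> (\<integral>\<^sup>+\<omega>. norm (X n \<omega> t) \<partial>M n) \<le> ennreal C"
    and YC: "\<And>R. R > 0 \<Longrightarrow> \<exists>C. \<forall>t. norm t = R \<longrightarrow> (\<integral>\<^sup>+\<omega>. norm (Y \<omega> t) \<partial>P) \<le> ennreal C"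
  shows "weakly_converges entire_topology M X P Y"
  unfolding weakly_converges_def
proof (intro conjI allI impI)
  show Xm: "X n \<in> M n \<rightarrow>\<^sub>M borel_sets_of entire_topology" for n
    by (rule measurable_entireI[OF Xe X])
  show Ym: "Y \<in> P \<rightarrow>\<^sub>M borel_sets_of entire_topology"
    by (rule measurable_entireI[OF Ye Y])
  fix F :: "(complex \<Rightarrow> complex) \<Rightarrow> real"
  assume F: "continuous_map entire_topology euclideanreal F" and "bounded (F ` topspace entire_topology)"
  then obtain B where B: "B > 0" "\<And>f. f \<in> entire_functions \<Longrightarrow> \<bar>F f\<bar> \<le> B"
    by (auto simp: bounded_pos topspace_entire_topology)
  have "\<exists>C\<ge>0. (\<forall>n\<ge>start. \<forall>t. norm t = real (Suc m) \<longrightarrow> (\<integral>\<^sup>+\<omega>. norm (X n \<omega> t) \<partial>M n) \<le> ennreal C) \<and>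
          (\<forall>t. norm t = real (Suc m) \<longrightarrow> (\<integral>\<^sup>+\<omega>. norm (Y \<omega> t) \<partial>P) \<le> ennreal C)" for m
  proof -
    obtain C1 C2 where C: "\<forall>n\<ge>start. \<forall>t. norm t = real (Suc m) \<longrightarrow> (\<integral>\<^sup>+\<omega>. norm (X n \<omega> t) \<partial>M n) \<le> ennreal C1"
      "\<forall>t. norm t = real (Suc m) \<longrightarrow> (\<integral>\<^sup>+\<omega>. norm (Y \<omega> t) \<partial>P) \<le> ennreal C2"
      using XC[of "real (Suc m)"] YC[of "real (Suc m)"] by auto
    have "ennreal C1 \<le> ennreal (max 0 (max C1 C2))" "ennreal C2 \<le> ennreal (max 0 (max C1 C2))"
      by (auto intro!: ennreal_leI)
    thus ?thesis using C order_trans by (intro exI[of _ "max 0 (max C1 C2)"]) (simp, blast)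
  qed
  then obtain C where C: "\<And>m. C m \<ge> 0"
    "\<And>m n t. n \<ge> start \<Longrightarrow> norm t = real (Suc m) \<Longrightarrow> (\<integral>\<^sup>+\<omega>. norm (X n \<omega> t) \<partial>M n) \<le> ennreal (C m)"
    "\<And>m t. norm t = real (Suc m) \<Longrightarrow> (\<integral>\<^sup>+\<omega>. norm (Y \<omega> t) \<partial>P) \<le> ennreal (C m)" by metis
  have main: "\<exists>N. \<forall>n\<ge>N. \<bar>(\<integral>\<omega>. F (X n \<omega>) \<partial>M n) - (\<integral>\<omega>. F (Y \<omega>) \<partial>P)\<bar> < r" if r: "r > 0" for r
  proof -
    \<comment> \<open>The total error is at most 2 D + e with D = e + 2 (B + 1) e, that is (7 + 4 B)
      e. The bound \<open>e \<le> 1\<close> keeps the approximant below B + 1.\<close>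
    define e where "e = min 1 (r / (7 + 4 * B))"
    have e: "e > 0" "e \<le> 1" using r B(1) by (auto simp: e_def)
    let ?A = "tight_bound C e"
    obtain p where p: "p \<in> trig_alg"
      "\<And>f. f \<in> entire_functions \<Longrightarrow> (\<forall>k. norm (coef f k) \<le> ?A k) \<Longrightarrow> \<bar>F f - p f\<bar> < e / 2"
      using trig_alg_approx[OF tight_bound_summable[of C e] F, of "e / 2"] C(1) e(1) by auto
    obtain L where L: "L > 0" "\<And>f. \<bar>p f\<bar> \<le> L" using trig_alg_bounded[OF p(1)] by blast
    \<comment> \<open>Composing with a polynomial close to a truncation keeps the approximant bounded by about \<open>B\<close>
        off the compact set as well.\<close>
    have "continuous_on {-L..L} (\<lambda>x. max (-B) (min B x))" by (intro continuous_intros)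
    then obtain q where q: "real_polynomial_function q" "\<And>x. x \<in> {-L..L} \<Longrightarrow> \<bar>max (-B) (min B x) - q x\<bar> < e / 2"
      using Stone_Weierstrass_real_polynomial_function[of "{-L..L}" "\<lambda>x. max (-B) (min B x)" "e / 2"] e by auto
    define s where "s = (\<lambda>f. q (p f))"
    have s: "s \<in> trig_alg" unfolding s_def by (rule trig_alg_polynomial[OF q(1) p(1)])
    have sq: "\<bar>max (-B) (min B (p f)) - s f\<bar> < e / 2" for f
      using q(2)[of "p f"] L(2)[of f] by (auto simp: s_def abs_le_iff)
    have sB: "\<bar>s f\<bar> \<le> B + 1" for f
    proof -
      have "\<bar>max (-B) (min B (p f))\<bar> \<le> B" using B(1) by auto
      thus ?thesis using sq[of f] e(2) by linarith
    qed
    have Fs: "\<bar>F f - s f\<bar> \<le> e" if "f \<in> entire_functions" "\<forall>k. norm (coef f k) \<le> ?A k" for f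
    proof -
      \<comment> \<open>Clamping to [-B, B] is a contraction that fixes the value
        \<open>F f\<close>.\<close>
      have "\<bar>F f - max (-B) (min B (p f))\<bar> \<le> \<bar>F f - p f\<bar>" using B(2)[OF that(1)] by auto
      thus ?thesis using p(2)[OF that] sq[of f] by linarith
    qed
    define D where "D = e + 2 * (B + 1) * e"
    have dev: "\<bar>(\<integral>\<omega>. F (Z \<omega>) \<partial>Q) - (\<integral>\<omega>. s (Z \<omega>) \<partial>Q)\<bar> \<le> D"
      if Q: "prob_space Q" and ent: "\<And>\<omega>. \<omega> \<in> space Q \<Longrightarrow> Z \<omega> \<in> entire_functions"
        and meas: "\<And>t. (\<lambda>\<omega>. Z \<omega> t) \<in> borel_measurable Q"
        and bd: "\<And>m t. norm t = real (Suc m) \<Longrightarrow> (\<integral>\<^sup>+\<omega>. norm (Z \<omega> t) \<partial>Q) \<le> ennreal (C m)"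
      for Q :: "'c measure" and Z
    proof -
      interpret prob_space Q by fact
      note tb = tight_bound_prob[OF C(1) e(1) Q ent meas bd]
      show ?thesis
        unfolding D_def
      proof (rule integral_diff_le_off_event[OF _ _ tb(1) _ _ _ tb(2)])
        show "(\<lambda>\<omega>. F (Z \<omega>)) \<in> borel_measurable Q"
          by (rule measurable_continuous_map_compose[OF measurable_entireI[OF ent meas] F])
        show "(\<lambda>\<omega>. s (Z \<omega>)) \<in> borel_measurable Q" by (rule trig_alg_measurable[OF s meas])
        show "\<bar>F (Z \<omega>)\<bar> \<le> B + 1" if "\<omega> \<in> space Q" for \<omega> using B(2)[OF ent[OF that]] by simp
        show "\<bar>F (Z \<omega>) - s (Z \<omega>)\<bar> \<le> e"
          if "\<omega> \<in> space Q - {\<omega> \<in> space Q. \<exists>k. tight_bound C e k < cmod (coef (Z \<omega>) k)}" for \<omega>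
          using that by (intro Fs ent) (auto simp: not_less)
      qed (use sB e B in auto)
    qed
    have "(\<lambda>n. \<integral>\<omega>. s (X n \<omega>) \<partial>M n) \<longlonglongrightarrow> (\<integral>\<omega>. s (Y \<omega>) \<partial>P)"
      by (rule trig_alg_tendsto[OF M P X Y cf s])
    then obtain N where N: "\<And>n. n \<ge> N \<Longrightarrow> \<bar>(\<integral>\<omega>. s (X n \<omega>) \<partial>M n) - (\<integral>\<omega>. s (Y \<omega>) \<partial>P)\<bar> < e / 2"
      using e(1) unfolding lim_sequentially dist_real_def by (metis half_gt_zero)
    have "\<bar>(\<integral>\<omega>. F (X n \<omega>) \<partial>M n) - (\<integral>\<omega>. F (Y \<omega>) \<partial>P)\<bar> < r" if n: "n \<ge> max N start" for n
    proof -
      have "\<bar>(\<integral>\<omega>. F (X n \<omega>) \<partial>M n) - (\<integral>\<omega>. s (X n \<omega>) \<partial>M n)\<bar> \<le> D"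
        by (rule dev[OF M Xe X C(2)]) (use n in auto)
      moreover have "\<bar>(\<integral>\<omega>. F (Y \<omega>) \<partial>P) - (\<integral>\<omega>. s (Y \<omega>) \<partial>P)\<bar> \<le> D"
        by (rule dev[OF P Ye Y C(3)]) auto
      moreover have "\<bar>(\<integral>\<omega>. s (X n \<omega>) \<partial>M n) - (\<integral>\<omega>. s (Y \<omega>) \<partial>P)\<bar> < e / 2" using N n by simp
      ultimately have "\<bar>(\<integral>\<omega>. F (X n \<omega>) \<partial>M n) - (\<integral>\<omega>. F (Y \<omega>) \<partial>P)\<bar> < 2 * D + e / 2"
        by linarith
      also have "\<dots> \<le> 2 * D + e" using e by simp
      also have "\<dots> \<le> e * (7 + 4 * B)" by (simp add: D_def algebra_simps)
      also have "\<dots> \<le> r" 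
      proof -
        have "e \<le> r / (7 + 4 * B)" by (simp add: e_def)
        thus ?thesis using B(1) by (simp add: pos_le_divide_eq)
      qed
      finally show ?thesis .
    qed
    thus ?thesis by blast
  qed
  thus "(\<lambda>n. \<integral>\<omega>. F (X n \<omega>) \<partial>M n) \<longlonglongrightarrow> (\<integral>\<omega>. F (Y \<omega>) \<partial>P)"
    unfolding lim_sequentially dist_real_def by blast
qed

section \<open>Gaussian tilting and a central limit theorem for triangular arrays\<close>

lemma std_normal_density_shift:
  "exp (u * x - u\<^sup>2 / 2) * std_normal_density x = std_normal_density (x - u)"
  by (simp add: std_normal_density_def exp_add[symmetric] power2_eq_square field_simps)

text \<open>The Cameron-Martin formula on the real line: an exponential weight translates the
  Gaussian.\<close>

lemma std_normal_shift:
  fixes f :: "real \<Rightarrow> 'b :: {banach, second_countable_topology}"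
  assumes [measurable]: "f \<in> borel_measurable borel"
  shows std_normal_shift_integrable: "integrable std_normal_distribution (\<lambda>x. exp (u * x - u\<^sup>2 / 2) *\<^sub>R f x)
           \<longleftrightarrow> integrable std_normal_distribution (\<lambda>x. f (x + u))"
    and std_normal_shift_integral: "(\<integral>x. exp (u * x - u\<^sup>2 / 2) *\<^sub>R f x \<partial>std_normal_distribution)
           = (\<integral>x. f (x + u) \<partial>std_normal_distribution)"
proof -
  have eq: "std_normal_density x *\<^sub>R exp (u * x - u\<^sup>2 / 2) *\<^sub>R f x = std_normal_density (x - u) *\<^sub>R f x" for x
    by (subst std_normal_density_shift[symmetric]) (simp add: mult.commute)
  show "integrable std_normal_distribution (\<lambda>x. exp (u * x - u\<^sup>2 / 2) *\<^sub>R f x)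
           \<longleftrightarrow> integrable std_normal_distribution (\<lambda>x. f (x + u))"
    using lborel_integrable_real_affine_iff[of 1 "\<lambda>x. std_normal_density (x - u) *\<^sub>R f x" u]
    by (simp add: integrable_density eq add.commute del: scaleR_scaleR)
  show "(\<integral>x. exp (u * x - u\<^sup>2 / 2) *\<^sub>R f x \<partial>std_normal_distribution)
           = (\<integral>x. f (x + u) \<partial>std_normal_distribution)"
    using lborel_integral_real_affine[of 1 "\<lambda>x. std_normal_density (x - u) *\<^sub>R f x" u]
    by (simp add: integral_density eq add.commute del: scaleR_scaleR)
qed

text \<open>The real part of \<open>z\<close> is removed by the Gaussian shift and the imaginary
  part is the known characteristic function, so no analytic continuation is required.\<close>

lemma has_bochner_integral_std_normal_exp:
  fixes z :: complex
  shows "has_bochner_integral std_normal_distribution (\<lambda>x. exp (z * of_real x)) (exp (z\<^sup>2 / 2))"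
proof -
  interpret real_distribution std_normal_distribution by (rule real_dist_normal_dist)
  define u v where "u = Re z" and "v = Im z"
  have z: "z = Complex u v" by (simp add: u_def v_def)
  define f where "f = (\<lambda>x. exp (u\<^sup>2 / 2) *\<^sub>R iexp (v * x))"
  have [measurable]: "f \<in> borel_measurable borel" unfolding f_def by measurable
  have eq: "exp (u * x - u\<^sup>2 / 2) *\<^sub>R f x = exp (z * of_real x)" for x
  proof -
    have "exp (u * x - u\<^sup>2 / 2) *\<^sub>R f x = exp (of_real (u * x - u\<^sup>2 / 2) + of_real (u\<^sup>2 / 2) + \<i> * of_real (v * x))"
      by (simp only: f_def scaleR_conv_of_real exp_add exp_of_real mult.assoc)
    also have "of_real (u * x - u\<^sup>2 / 2) + of_real (u\<^sup>2 / 2) + \<i> * of_real (v * x) = z * of_real x"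
      by (simp add: z Complex_eq algebra_simps)
    finally show ?thesis .
  qed
  have f2: "f (x + u) = exp (u\<^sup>2 / 2) *\<^sub>R iexp (v * u) * iexp (v * x)" for x
    by (simp add: f_def algebra_simps exp_add)
  have int: "integrable std_normal_distribution (\<lambda>x. iexp (v * x))" by (rule integrable_iexp) auto
  have "integrable std_normal_distribution (\<lambda>x. f (x + u))"
    unfolding f2 by (intro integrable_mult_right int)
  hence 1: "integrable std_normal_distribution (\<lambda>x. exp (z * of_real x))"
    using std_normal_shift_integrable[of f u] by (simp add: eq)
  have "(\<integral>x. exp (z * of_real x) \<partial>std_normal_distribution) = (\<integral>x. f (x + u) \<partial>std_normal_distribution)"
    using std_normal_shift_integral[of f u] by (simp add: eq)
  also have "\<dots> = exp (u\<^sup>2 / 2) *\<^sub>R iexp (v * u) * char std_normal_distribution v"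
    unfolding f2 char_def by simp
  also have "\<dots> = exp (z\<^sup>2 / 2)"
    by (simp add: char_std_normal_distribution scaleR_conv_of_real of_real_exp[symmetric] exp_add[symmetric] z 
         Complex_eq power2_eq_square algebra_simps add_divide_distrib diff_divide_distrib flip: exp_of_real)
  finally show ?thesis using 1 by (simp add: has_bochner_integral_iff)
qed

text \<open>Numbers of modulus at most 1 satisfy |x^N - y^N| \<le> N |x - y|, which reduces the
  claim to the constant sequence \<open>l\<close>. The second conclusion makes the same comparison
  available to users of the lemma.\<close>

lemma tendsto_power_exp:
  fixes x :: "nat \<Rightarrow> real"
  assumes N: "filterlim N at_top sequentially" and x: "x \<longlonglongrightarrow> l" and nonneg: "\<And>n. x n \<ge> 0"
  shows "(\<lambda>n. (1 - x n / real (N n)) ^ N n) \<longlonglongrightarrow> exp (- l)"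
    and "\<forall>\<^sub>F n in sequentially. \<bar>1 - x n / real (N n)\<bar> \<le> 1"
proof -
  have Nr: "filterlim (\<lambda>n. real (N n)) at_top sequentially"
    by (rule filterlim_compose[OF filterlim_real_sequentially N])
  have small: "\<forall>\<^sub>F n in sequentially. \<bar>1 - y n / real (N n)\<bar> \<le> 1 \<and> N n > 0"
    if "y \<longlonglongrightarrow> l" "\<And>n. y n \<ge> 0" for y
  proof -
    have "\<forall>\<^sub>F n in sequentially. y n < l + 1" using that(1) by (rule order_tendstoD) simp
    moreover have "\<forall>\<^sub>F n in sequentially. real (N n) \<ge> max 1 (l + 1)"
      using Nr unfolding filterlim_at_top by blast
    ultimately show ?thesis
    proof eventually_elim
      case (elim n)
      hence "y n / real (N n) \<le> 1" "0 \<le> y n / real (N n)" using that(2)[of n] by auto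
      thus ?case using elim by auto
    qed
  qed
  show "\<forall>\<^sub>F n in sequentially. \<bar>1 - x n / real (N n)\<bar> \<le> 1"
    using small[OF x nonneg] by eventually_elim simp
  have l: "l \<ge> 0" by (rule LIMSEQ_le_const[OF x]) (use nonneg in auto)
  have "(\<lambda>n. (1 - x n / real (N n)) ^ N n - (1 - l / real (N n)) ^ N n) \<longlonglongrightarrow> 0"
  proof (rule Lim_null_comparison)
    show "\<forall>\<^sub>F n in sequentially. norm ((1 - x n / real (N n)) ^ N n - (1 - l / real (N n)) ^ N n) \<le> \<bar>x n - l\<bar>"
      using small[OF x nonneg] small[OF tendsto_const l]
    proof eventually_elim
      case (elim n)
      have "norm ((1 - x n / real (N n)) ^ N n - (1 - l / real (N n)) ^ N n) \<le>
            N n * norm ((1 - x n / real (N n)) - (1 - l / real (N n)))"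
        using elim by (intro norm_power_diff) auto
      also have "(1 - x n / real (N n)) - (1 - l / real (N n)) = (l - x n) / real (N n)"
        by (simp add: diff_divide_distrib)
      finally show ?case using elim by (simp add: abs_minus_commute)
    qed
    show "(\<lambda>n. \<bar>x n - l\<bar>) \<longlonglongrightarrow> 0" using x by (simp add: tendsto_rabs_zero_iff LIM_zero)
  qed
  moreover have "(\<lambda>n. (1 - l / real (N n)) ^ N n) \<longlonglongrightarrow> exp (- l)"
    using filterlim_compose[OF tendsto_exp_limit_sequentially[of "- l"] N] by simp
  ultimately have "(\<lambda>n. (1 - x n / real (N n)) ^ N n - (1 - l / real (N n)) ^ N n + (1 - l / real (N n)) ^ N n)
      \<longlonglongrightarrow> 0 + exp (- l)" by (rule tendsto_add)
  thus "(\<lambda>n. (1 - x n / real (N n)) ^ N n) \<longlonglongrightarrow> exp (- l)" by simp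
qed

text \<open>The N-th power of one characteristic function is compared with (1 - s2 / (2 N))^N. The
  Lindeberg condition is smoothed into a minimum and uses no moment beyond the second; the summand 1
  next to |g| absorbs the centring, as the means are eventually smaller than 1.\<close>

lemma triangular_array_clt:
  fixes g :: "nat \<Rightarrow> real \<Rightarrow> real" and X :: "nat \<Rightarrow> 'i \<Rightarrow> 'a \<Rightarrow> real" and A :: "nat \<Rightarrow> 'i set"
  assumes M: "\<And>n. prob_space (M n)" and D: "real_distribution D"
    and indep: "\<And>n. prob_space.indep_vars (M n) (\<lambda>_. borel) (X n) (A n)"
    and dist: "\<And>n i. i \<in> A n \<Longrightarrow> distr (M n) borel (X n i) = D"
    and g[measurable]: "\<And>n. g n \<in> borel_measurable borel"
    and g2: "\<And>n. integrable D (\<lambda>x. (g n x)\<^sup>2)"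
    and mean: "(\<lambda>n. \<integral>x. g n x \<partial>D) \<longlonglongrightarrow> 0"
    and var: "(\<lambda>n. \<integral>x. (g n x)\<^sup>2 \<partial>D) \<longlonglongrightarrow> v"
    and lind: "(\<lambda>n. \<integral>x. (g n x)\<^sup>2 * min 1 ((\<bar>g n x\<bar> + 1) / sqrt (card (A n))) \<partial>D) \<longlonglongrightarrow> 0"
    and card: "filterlim (\<lambda>n. card (A n)) at_top sequentially"
  shows "(\<lambda>n. \<integral>\<omega>. cis ((\<Sum>i\<in>A n. g n (X n i \<omega>) - (\<integral>x. g n x \<partial>D)) / sqrt (card (A n))) \<partial>M n)
           \<longlonglongrightarrow> exp (- v / 2)"
proof -
  interpret D: real_distribution D by fact
  define m where "m n = (\<integral>x. g n x \<partial>D)" for n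
  define h where "h n x = g n x - m n" for n x
  define N where "N n = card (A n)" for n
  define s2 where "s2 n = (\<integral>x. (h n x)\<^sup>2 \<partial>D)" for n
  have [measurable]: "h n \<in> borel_measurable borel" for n unfolding h_def by measurable
  have g1: "integrable D (g n)" for n
    by (rule D.square_integrable_imp_integrable[OF _ g2]) simp
  have h1: "integrable D (h n)" and h0: "(\<integral>x. h n x \<partial>D) = 0" for n
    using g1[of n] D.prob_space by (auto simp: h_def[abs_def] m_def)
  have h2: "integrable D (\<lambda>x. (h n x)\<^sup>2)" for n
    unfolding h_def power2_diff using g1 g2 by auto
  have s2: "s2 n = (\<integral>x. (g n x)\<^sup>2 \<partial>D) - (m n)\<^sup>2" for n
    unfolding s2_def h_def m_def by (rule D.variance_eq[OF g1 g2])
  have s2_lim: "s2 \<longlonglongrightarrow> v"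
    using tendsto_diff[OF var tendsto_power[OF mean, of 2]] by (simp add: ext[of s2, OF s2] m_def)
  have s2_pos: "s2 n \<ge> 0" for n unfolding s2_def by simp
  define \<phi> where "\<phi> n = char (distr D borel (h n)) (1 / sqrt (N n))" for n
  have cf: "(\<integral>\<omega>. cis ((\<Sum>i\<in>A n. g n (X n i \<omega>) - (\<integral>x. g n x \<partial>D)) / sqrt (card (A n))) \<partial>M n) = \<phi> n ^ N n"
    (is "?L = _") for n
  proof -
    interpret prob_space "M n" by (rule M)
    have rv[measurable]: "X n i \<in> borel_measurable (M n)" if "i \<in> A n" for i
      using indep[of n] that by (auto simp: indep_vars_def)
    have "?L = char (distr (M n) borel (\<lambda>\<omega>. \<Sum>i\<in>A n. h n (X n i \<omega>))) (1 / sqrt (N n))"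
      unfolding char_def by (subst integral_distr) (auto simp: cis_conv_exp h_def m_def N_def mult.commute divide_inverse)
    also have "\<dots> = (\<Prod>i\<in>A n. char (distr (M n) borel (\<lambda>\<omega>. h n (X n i \<omega>))) (1 / sqrt (N n)))"
      using indep_vars_compose2[OF indep, of "\<lambda>_. h n" "\<lambda>_. borel"] by (intro char_distr_sum) simp
    also have "\<dots> = (\<Prod>i\<in>A n. \<phi> n)"
    proof (rule prod.cong[OF refl])
      fix i assume i: "i \<in> A n"
      have "distr (M n) borel (\<lambda>\<omega>. h n (X n i \<omega>)) = distr (distr (M n) borel (X n i)) borel (h n)"
        using rv[OF i] by (subst distr_distr) (auto simp: o_def)
      thus "char (distr (M n) borel (\<lambda>\<omega>. h n (X n i \<omega>))) (1 / sqrt (N n)) = \<phi> n"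
        by (simp add: dist[OF i] \<phi>_def)
    qed
    finally show ?thesis by (simp add: N_def)
  qed
  have half: "(\<lambda>n. s2 n / 2) \<longlonglongrightarrow> v / 2"
    by (intro tendsto_divide s2_lim tendsto_const) simp
  have lim: "(\<lambda>n. (1 - (s2 n / 2) / real (N n)) ^ N n) \<longlonglongrightarrow> exp (- (v / 2))"
    and small: "\<forall>\<^sub>F n in sequentially. \<bar>1 - (s2 n / 2) / real (N n)\<bar> \<le> 1"
    using tendsto_power_exp[OF card half] s2_pos by (auto simp: N_def)
  define L where "L n = (\<integral>x. (g n x)\<^sup>2 * min 1 ((\<bar>g n x\<bar> + 1) / sqrt (N n)) \<partial>D)" for n
  have "(\<lambda>n. \<phi> n ^ N n - of_real (1 - (s2 n / 2) / real (N n)) ^ N n) \<longlonglongrightarrow> 0"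
  proof (rule Lim_null_comparison)
    have "(\<lambda>n. 2 * L n + 2 * (m n)\<^sup>2) \<longlonglongrightarrow> 2 * 0 + 2 * 0\<^sup>2"
      unfolding L_def N_def m_def by (intro tendsto_intros lind mean)
    thus "(\<lambda>n. 2 * L n + 2 * (m n)\<^sup>2) \<longlonglongrightarrow> 0" by simp
    have "\<forall>\<^sub>F n in sequentially. \<bar>m n\<bar> < 1"
      using tendsto_rabs_zero[OF mean] unfolding m_def by (rule order_tendstoD) simp
    moreover have "\<forall>\<^sub>F n in sequentially. N n \<ge> 1"
      using card unfolding filterlim_at_top N_def by blast
    ultimately show "\<forall>\<^sub>F n in sequentially. norm (\<phi> n ^ N n - of_real (1 - (s2 n / 2) / real (N n)) ^ N n) \<le> 2 * L n + 2 * (m n)\<^sup>2"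
      using small
    proof eventually_elim
      case (elim n)
      define t where "t = 1 / sqrt (N n)"
      have t: "t > 0" "t\<^sup>2 = 1 / N n" using elim by (auto simp: t_def power_divide)
      have gint: "integrable D (\<lambda>x. (g n x)\<^sup>2 * min 1 ((\<bar>g n x\<bar> + 1) * t))"
        using t(1) by (intro Bochner_Integration.integrable_bound[OF g2[of n]]) (auto simp: abs_mult mult_left_le)
      interpret Dh: real_distribution "distr D borel (h n)" by (rule D.real_distribution_distr) simp
      have "norm (\<phi> n ^ N n - of_real (1 - (s2 n / 2) / real (N n)) ^ N n) \<le>
            N n * norm (\<phi> n - of_real (1 - (s2 n / 2) / real (N n)))"
        using elim Dh.cmod_char_le_1 by (intro norm_power_diff) (auto simp: \<phi>_def simp del: of_real_diff)
      \<comment> \<open>Second-order expansion of a characteristic function at t = 1 / sqrt N, with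
        the remainder bounded by the smaller of a quadratic and a cubic term. The factor t^2 later
        cancels the N in front.\<close>
      also have "norm (\<phi> n - of_real (1 - (s2 n / 2) / real (N n))) \<le>
            t\<^sup>2 / 6 * (\<integral>x. min (6 * (h n x)\<^sup>2) (\<bar>t\<bar> * \<bar>h n x\<bar> ^ 3) \<partial>D)"
        using D.char_approx3'[OF _ h1 h2 h0 _ refl, of n "s2 n" t] t(2)
        by (simp add: h0 s2_def[symmetric] \<phi>_def t_def[symmetric] mult.commute)
      also have "\<dots> \<le> t\<^sup>2 / 6 * (\<integral>x. 6 * (2 * ((g n x)\<^sup>2 * min 1 ((\<bar>g n x\<bar> + 1) * t)) + 2 * (m n)\<^sup>2) \<partial>D)"
      proof (intro mult_left_mono integral_mono)
        show "integrable D (\<lambda>x. min (6 * (h n x)\<^sup>2) (\<bar>t\<bar> * \<bar>h n x\<bar> ^ 3))"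
          by (rule Bochner_Integration.integrable_bound[OF integrable_mult_right[OF h2, of 6]]) (auto simp: min_def)
        show "integrable D (\<lambda>x. 6 * (2 * ((g n x)\<^sup>2 * min 1 ((\<bar>g n x\<bar> + 1) * t)) + 2 * (m n)\<^sup>2))" using gint by auto
        fix x
        \<comment> \<open>The cubic term is enlarged so that 6 h^2 factors out of the
          minimum.\<close>
        have "min (6 * (h n x)\<^sup>2) (\<bar>t\<bar> * \<bar>h n x\<bar> ^ 3) \<le> min (6 * (h n x)\<^sup>2) (6 * (\<bar>t\<bar> * \<bar>h n x\<bar> ^ 3))"
          by (intro min.mono) auto
        also have "\<dots> = 6 * ((h n x)\<^sup>2 * min 1 (\<bar>h n x\<bar> * t))"
        proof -
          have "\<bar>t\<bar> * \<bar>h n x\<bar> ^ 3 = (h n x)\<^sup>2 * (\<bar>h n x\<bar> * t)"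
            using t(1) by (simp add: power3_eq_cube power2_eq_square abs_mult_self_eq)
          thus ?thesis by (simp add: min_mult_distrib_left)
        qed
        also have "\<dots> \<le> 6 * (2 * ((g n x)\<^sup>2 * min 1 ((\<bar>g n x\<bar> + 1) * t)) + 2 * (m n)\<^sup>2)"
        proof -
          define \<mu> where "\<mu> = min 1 ((\<bar>g n x\<bar> + 1) * t)"
          have \<mu>: "0 \<le> \<mu>" "\<mu> \<le> 1" using t(1) by (auto simp: \<mu>_def)
          have "\<bar>h n x\<bar> * t \<le> (\<bar>g n x\<bar> + 1) * t"
            using t(1) elim by (intro mult_right_mono) (auto simp: h_def)
          hence "(h n x)\<^sup>2 * min 1 (\<bar>h n x\<bar> * t) \<le> (h n x)\<^sup>2 * \<mu>"
            unfolding \<mu>_def by (intro mult_left_mono) auto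
          also have "\<dots> \<le> (2 * (g n x)\<^sup>2 + 2 * (m n)\<^sup>2) * \<mu>"
          proof (intro mult_right_mono \<mu>(1))
            have "0 \<le> (g n x + m n)\<^sup>2" by simp
            thus "(h n x)\<^sup>2 \<le> 2 * (g n x)\<^sup>2 + 2 * (m n)\<^sup>2"
              unfolding h_def power2_sum power2_diff by simp
          qed
          also have "\<dots> = 2 * ((g n x)\<^sup>2 * \<mu>) + 2 * ((m n)\<^sup>2 * \<mu>)" by (simp add: algebra_simps)
          also have "\<dots> \<le> 2 * ((g n x)\<^sup>2 * \<mu>) + 2 * (m n)\<^sup>2"
            using \<mu> by (simp add: mult_left_le)
          finally show ?thesis unfolding \<mu>_def by simp
        qed
        finally show "min (6 * (h n x)\<^sup>2) (\<bar>t\<bar> * \<bar>h n x\<bar> ^ 3) \<le>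
          6 * (2 * ((g n x)\<^sup>2 * min 1 ((\<bar>g n x\<bar> + 1) * t)) + 2 * (m n)\<^sup>2)" .
      qed simp
      also have "\<dots> = t\<^sup>2 * (2 * L n + 2 * (m n)\<^sup>2)"
      proof -
        define k where "k = (\<lambda>x. (g n x)\<^sup>2 * min 1 ((\<bar>g n x\<bar> + 1) * t))"
        have k: "integrable D k" "L n = (\<integral>x. k x \<partial>D)"
          using gint by (simp_all add: k_def L_def t_def)
        have "(\<integral>x. 6 * (2 * k x + 2 * (m n)\<^sup>2) \<partial>D) = 6 * (2 * L n + 2 * (m n)\<^sup>2)"
          using k D.prob_space by simp
        thus ?thesis unfolding k_def by simp
      qed
      finally show ?case using elim t by (simp add: mult_left_mono)
    qed
  qed
  from tendsto_add[OF this tendsto_of_real[OF lim, where 'a = complex]]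
  show ?thesis unfolding cf by simp
qed

text \<open>
  With \<open>b = sqrt (a\<^sub>1 n)\<close> and \<open>s t = sqrt a\<^sub>1 * t\<close> the exponent \<open>(\<beta> b + s t) x\<close> is the one of the partition
  function at \<open>\<beta> + t / sqrt n\<close>, and \<open>(Re \<beta> * b + s t)\<^sup>2\<close> is the exponent of the normalization.
\<close>

definition tilt_sum :: "complex set \<Rightarrow> (complex \<Rightarrow> complex) \<Rightarrow> (complex \<Rightarrow> complex) \<Rightarrow> complex \<Rightarrow> real \<Rightarrow> real \<Rightarrow> complex" where
  "tilt_sum I lam s \<beta> b x =
     (\<Sum>t\<in>I. lam t * exp ((\<beta> * of_real b + s t) * of_real x - (of_real (Re \<beta> * b) + s t)\<^sup>2))"

text \<open>The second absolute moment of \<open>\<Sum>t\<in>I. lam t * X (s t)\<close> for the plane Gaussian analytic function \<open>X\<close>.\<close>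

definition gaf_var :: "complex set \<Rightarrow> (complex \<Rightarrow> complex) \<Rightarrow> (complex \<Rightarrow> complex) \<Rightarrow> complex" where
  "gaf_var I lam s = (\<Sum>t\<in>I. \<Sum>u\<in>I. lam t * cnj (lam u) * exp (s t * cnj (s u) - (s t)\<^sup>2 / 2 - (cnj (s u))\<^sup>2 / 2))"

section \<open>Exact Gaussian moments of tilted sums and their central limit theorem\<close>

lemma has_bochner_integral_std_normal_exp_linear:
  fixes z c k :: complex
  shows "has_bochner_integral std_normal_distribution (\<lambda>x. k * exp (z * of_real x - c)) (k * exp (z\<^sup>2 / 2 - c))"
proof -
  have "has_bochner_integral std_normal_distribution (\<lambda>x. k * exp (- c) * exp (z * of_real x)) (k * exp (- c) * exp (z\<^sup>2 / 2))"
    by (intro has_bochner_integral_mult_right has_bochner_integral_std_normal_exp)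
  thus ?thesis by (simp only: mult.assoc exp_add[symmetric]) simp
qed

lemma has_bochner_integral_tilt_sum:
  fixes lam s :: "complex \<Rightarrow> complex" and \<beta> :: complex
  shows "has_bochner_integral std_normal_distribution (tilt_sum I lam s \<beta> b)
     (\<Sum>t\<in>I. lam t * exp ((\<beta> * b + s t)\<^sup>2 / 2 - (Re \<beta> * b + s t)\<^sup>2))"
  unfolding tilt_sum_def by (intro has_bochner_integral_sum has_bochner_integral_std_normal_exp_linear)

lemma has_bochner_integral_tilt_sum_square:
  fixes lam s :: "complex \<Rightarrow> complex" and \<beta> :: complex
  shows "has_bochner_integral std_normal_distribution (\<lambda>x. (tilt_sum I lam s \<beta> b x)\<^sup>2)
     (\<Sum>t\<in>I. \<Sum>u\<in>I. lam t * lam u *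
        exp ((2 * \<beta> * b + s t + s u)\<^sup>2 / 2 - ((Re \<beta> * b + s t)\<^sup>2 + (Re \<beta> * b + s u)\<^sup>2)))"
proof -
  have "(tilt_sum I lam s \<beta> b x)\<^sup>2 = (\<Sum>t\<in>I. \<Sum>u\<in>I. lam t * lam u *
     exp ((2 * \<beta> * b + s t + s u) * x - ((Re \<beta> * b + s t)\<^sup>2 + (Re \<beta> * b + s u)\<^sup>2)))" for x
    unfolding tilt_sum_def power2_eq_square[of "sum _ _"] sum_product
  proof (intro sum.cong refl)
    fix t u
    have "(\<beta> * b + s t) * x - (Re \<beta> * b + s t)\<^sup>2 + ((\<beta> * b + s u) * x - (Re \<beta> * b + s u)\<^sup>2) =
      (2 * \<beta> * b + s t + s u) * x - ((Re \<beta> * b + s t)\<^sup>2 + (Re \<beta> * b + s u)\<^sup>2)"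
      by (simp add: algebra_simps)
    from arg_cong[OF this, of exp]
    show "lam t * exp ((\<beta> * b + s t) * x - (Re \<beta> * b + s t)\<^sup>2) * (lam u * exp ((\<beta> * b + s u) * x - (Re \<beta> * b + s u)\<^sup>2)) =
      lam t * lam u * exp ((2 * \<beta> * b + s t + s u) * x - ((Re \<beta> * b + s t)\<^sup>2 + (Re \<beta> * b + s u)\<^sup>2))"
      by (simp only: exp_add mult_ac of_real_mult)
  qed
  thus ?thesis by (simp only:) (intro has_bochner_integral_sum has_bochner_integral_std_normal_exp_linear)
qed

text \<open>The reason for the normalization: with A = Re \<beta> * b + s t and B = Re \<beta> * b +
  cnj (s u) the exponent is (A + B)^2 / 2 - A^2 - B^2 = - (A - B)^2 / 2, from which Re \<beta> * b
  drops out. The second moment is therefore exact for every \<open>b\<close>.\<close>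

lemma has_bochner_integral_tilt_sum_norm:
  fixes lam s :: "complex \<Rightarrow> complex" and \<beta> :: complex
  shows "has_bochner_integral std_normal_distribution (\<lambda>x. tilt_sum I lam s \<beta> b x * cnj (tilt_sum I lam s \<beta> b x))
     (gaf_var I lam s)"
proof -
  have "tilt_sum I lam s \<beta> b x * cnj (tilt_sum I lam s \<beta> b x) = (\<Sum>t\<in>I. \<Sum>u\<in>I. lam t * cnj (lam u) *
     exp ((2 * Re \<beta> * b + s t + cnj (s u)) * x - ((Re \<beta> * b + s t)\<^sup>2 + (Re \<beta> * b + cnj (s u))\<^sup>2)))" (is "?l = ?r") for x
  proof -
    have "(\<beta> * b + s t) * x - (Re \<beta> * b + s t)\<^sup>2 + ((cnj \<beta> * b + cnj (s u)) * x - (Re \<beta> * b + cnj (s u))\<^sup>2) =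
      (2 * Re \<beta> * b + s t + cnj (s u)) * x - ((Re \<beta> * b + s t)\<^sup>2 + (Re \<beta> * b + cnj (s u))\<^sup>2)" for t u
    proof -
      \<comment> \<open>Eliminating \<open>cnj \<beta>\<close> turns the identity into a polynomial
        one.\<close>
      have "cnj \<beta> = of_real (2 * Re \<beta>) - \<beta>" by (simp add: complex_eq_iff)
      thus ?thesis by (simp only:) (simp add: algebra_simps)
    qed
    hence e: "exp ((\<beta> * b + s t) * x - (Re \<beta> * b + s t)\<^sup>2) * exp ((cnj \<beta> * b + cnj (s u)) * x - (Re \<beta> * b + cnj (s u))\<^sup>2)
       = exp ((2 * Re \<beta> * b + s t + cnj (s u)) * x - ((Re \<beta> * b + s t)\<^sup>2 + (Re \<beta> * b + cnj (s u))\<^sup>2))" for t u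
      by (simp only: exp_add[symmetric])
    show ?thesis
      unfolding tilt_sum_def cnj_sum sum_product complex_cnj_mult exp_cnj complex_cnj_diff complex_cnj_add complex_cnj_power complex_cnj_complex_of_real
    proof (intro sum.cong refl)
      fix t u
      show "lam t * exp ((\<beta> * b + s t) * x - (Re \<beta> * b + s t)\<^sup>2) *
          (cnj (lam u) * exp ((cnj \<beta> * b + cnj (s u)) * x - (Re \<beta> * b + cnj (s u))\<^sup>2)) =
        lam t * cnj (lam u) * exp ((2 * Re \<beta> * b + s t + cnj (s u)) * x - ((Re \<beta> * b + s t)\<^sup>2 + (Re \<beta> * b + cnj (s u))\<^sup>2))"
        by (subst e[symmetric]) (simp only: mult_ac of_real_mult)
    qed
  qed
  moreover have "(2 * Re \<beta> * b + s t + cnj (s u))\<^sup>2 / 2 - ((Re \<beta> * b + s t)\<^sup>2 + (Re \<beta> * b + cnj (s u))\<^sup>2)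
     = s t * cnj (s u) - (s t)\<^sup>2 / 2 - (cnj (s u))\<^sup>2 / 2" for t u
    by (simp add: power2_eq_square field_simps)
  moreover have "has_bochner_integral std_normal_distribution (\<lambda>x. \<Sum>t\<in>I. \<Sum>u\<in>I. lam t * cnj (lam u) *
     exp ((2 * Re \<beta> * b + s t + cnj (s u)) * x - ((Re \<beta> * b + s t)\<^sup>2 + (Re \<beta> * b + cnj (s u))\<^sup>2)))
     (\<Sum>t\<in>I. \<Sum>u\<in>I. lam t * cnj (lam u) *
      exp ((2 * Re \<beta> * b + s t + cnj (s u))\<^sup>2 / 2 - ((Re \<beta> * b + s t)\<^sup>2 + (Re \<beta> * b + cnj (s u))\<^sup>2)))"
    by (intro has_bochner_integral_sum has_bochner_integral_std_normal_exp_linear)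
  ultimately show ?thesis by (simp add: gaf_var_def)
qed

lemma exp_quadratic_tendsto_0:
  fixes A B C :: complex and b :: "nat \<Rightarrow> real"
  assumes "Re A < 0" and b: "filterlim b at_top sequentially"
  shows "(\<lambda>n. exp (A * of_real (b n) ^ 2 + B * of_real (b n) + C)) \<longlonglongrightarrow> 0"
proof -
  have "filterlim (\<lambda>n. - Re B + (- Re A) * b n) at_top sequentially"
    using assms(1) by (intro filterlim_tendsto_add_at_top[OF tendsto_const]
        filterlim_tendsto_pos_mult_at_top[OF tendsto_const _ b]) simp
  hence "filterlim (\<lambda>n. (- Re B + (- Re A) * b n) * b n) at_top sequentially"
    by (rule filterlim_at_top_mult_at_top[OF _ b])
  hence "filterlim (\<lambda>n. - Re C + (- Re B + (- Re A) * b n) * b n) at_top sequentially"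
    by (rule filterlim_tendsto_add_at_top[OF tendsto_const])
  hence "filterlim (\<lambda>n. - (- Re C + (- Re B + (- Re A) * b n) * b n)) at_bot sequentially"
    by (simp add: filterlim_uminus_at_bot)
  hence "(\<lambda>n. exp (- (- Re C + (- Re B + (- Re A) * b n) * b n))) \<longlonglongrightarrow> 0"
    by (rule filterlim_compose[OF exp_at_bot])
  moreover have "norm (exp (A * of_real (b n) ^ 2 + B * of_real (b n) + C)) =
     exp (- (- Re C + (- Re B + (- Re A) * b n) * b n))" for n
    by (simp add: power2_eq_square algebra_simps)
  ultimately show ?thesis by (subst tendsto_norm_zero_iff[symmetric]) simp
qed

text \<open>At an argument shifted by 2 Re \<beta> * b the cross terms 2 Re \<beta> * b * s t
  cancel, so everything that depends on \<beta> and \<open>b\<close> leaves the sum as one common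
  factor.\<close>

lemma tilt_sum_shift:
  fixes lam s :: "complex \<Rightarrow> complex" and \<beta> :: complex
  shows "norm (tilt_sum I lam s \<beta> b (y + 2 * Re \<beta> * b)) =
     exp (Re \<beta> * b * y + (Re \<beta> * b)\<^sup>2) * norm (\<Sum>t\<in>I. lam t * exp (s t * y - (s t)\<^sup>2))"
proof -
  have "tilt_sum I lam s \<beta> b (y + 2 * Re \<beta> * b) =
     exp (\<beta> * b * (y + 2 * Re \<beta> * b) - (Re \<beta> * b)\<^sup>2) * (\<Sum>t\<in>I. lam t * exp (s t * y - (s t)\<^sup>2))"
    unfolding tilt_sum_def sum_distrib_left
  proof (rule sum.cong[OF refl])
    fix t
    have "(\<beta> * b + s t) * complex_of_real (y + 2 * Re \<beta> * b) - (Re \<beta> * b + s t)\<^sup>2 =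
       (\<beta> * b * (y + 2 * Re \<beta> * b) - (Re \<beta> * b)\<^sup>2) + (s t * y - (s t)\<^sup>2)"
      by (simp add: power2_eq_square algebra_simps)
    thus "lam t * exp ((\<beta> * b + s t) * complex_of_real (y + 2 * Re \<beta> * b) - (Re \<beta> * b + s t)\<^sup>2) =
       exp (\<beta> * b * (y + 2 * Re \<beta> * b) - (Re \<beta> * b)\<^sup>2) * (lam t * exp (s t * y - (s t)\<^sup>2))"
      by (simp only: exp_add mult_ac)
  qed
  thus ?thesis by (simp add: norm_mult power2_eq_square algebra_simps)
qed

lemma tilt_sum_measurable [measurable]: "tilt_sum I lam s \<beta> b \<in> borel_measurable borel"
  unfolding tilt_sum_def by measurable

lemma integrable_tilt_sum_norm2: "integrable std_normal_distribution (\<lambda>x. (norm (tilt_sum I lam s \<beta> b x))\<^sup>2)"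
proof -
  have "integrable std_normal_distribution (\<lambda>x. Re (tilt_sum I lam s \<beta> b x * cnj (tilt_sum I lam s \<beta> b x)))"
    using has_bochner_integral_tilt_sum_norm by (intro integrable_Re) (auto simp: has_bochner_integral_iff)
  thus ?thesis by (simp only: complex_norm_square[symmetric] Re_complex_of_real)
qed

text \<open>
  Shifting the Gaussian by \<open>2 * Re \<beta> * b n\<close> turns \<open>|tilt_sum|\<^sup>2\<close> into a function that does not depend
  on \<open>n\<close>, which dominates.  No moments beyond the second are needed.
\<close>

lemma tilt_sum_lindeberg:
  fixes b c :: "nat \<Rightarrow> real" and lam s :: "complex \<Rightarrow> complex" and \<beta> :: complex
  assumes c: "c \<longlonglongrightarrow> 0" "\<And>n. c n \<ge> 0"
    and bc: "\<And>y. (\<lambda>n. exp (Re \<beta> * b n * y + (Re \<beta> * b n)\<^sup>2) * c n) \<longlonglongrightarrow> 0"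
  shows "(\<lambda>n. \<integral>x. (norm (tilt_sum I lam s \<beta> (b n) x))\<^sup>2 * min 1 ((norm (tilt_sum I lam s \<beta> (b n) x) + 1) * c n)
            \<partial>std_normal_distribution) \<longlonglongrightarrow> 0"
proof -
  define q where "q y = norm (\<Sum>t\<in>I. lam t * exp (s t * of_real y - (s t)\<^sup>2))" for y :: real
  \<comment> \<open>\<open>q\<close> is the modulus of the tilted sum at b = 0.\<close>
  have q_int: "integrable std_normal_distribution (\<lambda>y. (q y)\<^sup>2)"
    using integrable_tilt_sum_norm2[of I lam s \<beta> 0] by (simp add: q_def tilt_sum_def)
  have [measurable]: "q \<in> borel_measurable borel" unfolding q_def by measurable
  let ?G = "\<lambda>n. tilt_sum I lam s \<beta> (b n)"
  let ?k = "\<lambda>n y. (q y)\<^sup>2 * min 1 ((exp (Re \<beta> * b n * y + (Re \<beta> * b n)\<^sup>2) * q y + 1) * c n)"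
  have eq: "(\<integral>x. (norm (?G n x))\<^sup>2 * min 1 ((norm (?G n x) + 1) * c n) \<partial>std_normal_distribution)
     = (\<integral>y. ?k n y \<partial>std_normal_distribution)" for n
  proof -
    define u where "u = 2 * Re \<beta> * b n"
    define f where "f = (\<lambda>x. exp (- (u * x - u\<^sup>2 / 2)) * ((norm (?G n x))\<^sup>2 * min 1 ((norm (?G n x) + 1) * c n)))"
    have "(\<integral>x. (norm (?G n x))\<^sup>2 * min 1 ((norm (?G n x) + 1) * c n) \<partial>std_normal_distribution) =
          (\<integral>x. exp (u * x - u\<^sup>2 / 2) *\<^sub>R f x \<partial>std_normal_distribution)"
      by (rule Bochner_Integration.integral_cong[OF refl]) (simp add: f_def mult.assoc[symmetric] flip: exp_add)
    also have "\<dots> = (\<integral>x. f (x + u) \<partial>std_normal_distribution)"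
      by (rule std_normal_shift_integral) (simp add: f_def)
    also have "\<dots> = (\<integral>y. ?k n y \<partial>std_normal_distribution)"
    proof (rule Bochner_Integration.integral_cong[OF refl])
      fix y
      \<comment> \<open>The density of the shift cancels the squared common factor, which survives
        only inside the minimum.\<close>
      have "exp (- (u * (y + u) - u\<^sup>2 / 2)) * (exp (Re \<beta> * b n * y + (Re \<beta> * b n)\<^sup>2))\<^sup>2 = 1"
        by (simp add: u_def exp_add[symmetric] power2_eq_square algebra_simps)
      thus "f (y + u) = ?k n y"
        unfolding f_def u_def tilt_sum_shift q_def[symmetric] by (simp add: power_mult_distrib mult.assoc[symmetric])
    qed
    finally show ?thesis .
  qed
  have "(\<lambda>n. \<integral>y. ?k n y \<partial>std_normal_distribution) \<longlonglongrightarrow> (\<integral>y. 0 \<partial>std_normal_distribution)"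
  proof (rule integral_dominated_convergence[OF _ _ q_int])
    show "AE y in std_normal_distribution. (\<lambda>n. ?k n y) \<longlonglongrightarrow> 0"
    proof (rule AE_I2)
      fix y
      have "(\<lambda>n. (q y)\<^sup>2 * min 1 (exp (Re \<beta> * b n * y + (Re \<beta> * b n)\<^sup>2) * c n * q y + c n)) \<longlonglongrightarrow> (q y)\<^sup>2 * min 1 (0 * q y + 0)"
        by (intro tendsto_intros tendsto_min bc c)
      thus "(\<lambda>n. ?k n y) \<longlonglongrightarrow> 0" by (simp add: algebra_simps)
    qed
    show "AE y in std_normal_distribution. norm (?k n y) \<le> (q y)\<^sup>2" for n
    proof (rule AE_I2)
      fix y
      have "0 \<le> min 1 ((exp (Re \<beta> * b n * y + (Re \<beta> * b n)\<^sup>2) * q y + 1) * c n)"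
        using c(2)[of n] by (simp add: q_def)
      thus "norm (?k n y) \<le> (q y)\<^sup>2" by (simp add: mult_left_le)
    qed
  qed auto
  thus ?thesis unfolding eq by simp
qed

text \<open>Since (Re G)^2 = (|G|^2 + Re (G^2)) / 2 and the mean of G^2 tends to 0, the real parts
  have limiting variance \<open>gaf_var / 2\<close>, whence the 4 in the exponent. The condition
  \<open>bc\<close> says that the common factor of a shifted summand is negligible against sqrt
  N.\<close>

lemma tilt_sum_clt:
  fixes b :: "nat \<Rightarrow> real" and X :: "nat \<Rightarrow> 'i \<Rightarrow> 'a \<Rightarrow> real" and A :: "nat \<Rightarrow> 'i set"
    and lam s :: "complex \<Rightarrow> complex" and \<beta> :: complex
  assumes M: "\<And>n. prob_space (M n)"
    and indep: "\<And>n. prob_space.indep_vars (M n) (\<lambda>_. borel) (X n) (A n)"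
    and dist: "\<And>n i. i \<in> A n \<Longrightarrow> distr (M n) borel (X n i) = std_normal_distribution"
    and b: "filterlim b at_top sequentially" and \<beta>: "Im \<beta> \<noteq> 0"
    and card: "filterlim (\<lambda>n. card (A n)) at_top sequentially"
    and bc: "\<And>y. (\<lambda>n. exp (Re \<beta> * b n * y + (Re \<beta> * b n)\<^sup>2) / sqrt (card (A n))) \<longlonglongrightarrow> 0"
  shows "(\<lambda>n. \<integral>\<omega>. cis (Re ((\<Sum>i\<in>A n. tilt_sum I lam s \<beta> (b n) (X n i \<omega>) -
            (\<integral>x. tilt_sum I lam s \<beta> (b n) x \<partial>std_normal_distribution)) / sqrt (card (A n)))) \<partial>M n)
           \<longlonglongrightarrow> exp (- Re (gaf_var I lam s) / 4)"
proof -
  interpret D: real_distribution std_normal_distribution by (rule real_dist_normal_dist)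
  let ?D = std_normal_distribution
  let ?G = "\<lambda>n. tilt_sum I lam s \<beta> (b n)"
  define g where "g n x = Re (?G n x)" for n x
  have [measurable]: "g n \<in> borel_measurable borel" for n unfolding g_def by measurable
  have G1: "integrable ?D (?G n)" for n
    by (rule has_bochner_integral_tilt_sum[unfolded has_bochner_integral_iff, THEN conjunct1])
  have Gsq: "integrable ?D (\<lambda>x. (?G n x)\<^sup>2)" for n
    by (rule has_bochner_integral_tilt_sum_square[unfolded has_bochner_integral_iff, THEN conjunct1])
  note Gn2 = integrable_tilt_sum_norm2
  have Gn2_eq: "(\<integral>x. (norm (?G n x))\<^sup>2 \<partial>?D) = Re (gaf_var I lam s)" for n
  proof -
    have "Re (gaf_var I lam s) = (\<integral>x. Re (?G n x * cnj (?G n x)) \<partial>?D)"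
      using has_bochner_integral_tilt_sum_norm[of I lam s \<beta> "b n"]
      by (subst integral_Re) (auto simp: has_bochner_integral_iff)
    thus ?thesis by (simp only: complex_norm_square[symmetric] Re_complex_of_real)
  qed
  have g_sq: "(g n x)\<^sup>2 = ((norm (?G n x))\<^sup>2 + Re ((?G n x)\<^sup>2)) / 2" for n x
    unfolding g_def cmod_power2 by (simp add: power2_eq_square)
  have gm: "(\<integral>x. g n x \<partial>?D) = Re (\<integral>x. ?G n x \<partial>?D)" for n
    unfolding g_def by (rule integral_Re[OF G1])
  have lim1: "(\<lambda>n. \<integral>x. ?G n x \<partial>?D) \<longlonglongrightarrow> 0"
  proof -
    have "(\<integral>x. ?G n x \<partial>?D) = (\<Sum>t\<in>I. lam t * exp ((\<beta>\<^sup>2 / 2 - (Re \<beta>)\<^sup>2) * of_real (b n) ^ 2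
            + (s t * (\<beta> - 2 * Re \<beta>)) * of_real (b n) + (- (s t)\<^sup>2 / 2)))" for n
      unfolding has_bochner_integral_integral_eq[OF has_bochner_integral_tilt_sum]
      by (intro sum.cong refl arg_cong[where f = "\<lambda>z. _ * exp z"]) (simp add: power2_eq_square field_simps)
    \<comment> \<open>The value is - |\<beta>|^2 / 2: the mean is exponentially small compared with
      the standard deviation.\<close>
    moreover have "Re (\<beta>\<^sup>2 / 2 - (Re \<beta>)\<^sup>2) < 0"
    proof -
      have "Re (\<beta>\<^sup>2 / 2 - (Re \<beta>)\<^sup>2) = - ((Re \<beta>)\<^sup>2 + (Im \<beta>)\<^sup>2) / 2" by (simp add: power2_eq_square)
      also have "\<dots> < 0"
      proof -
        have "0 < (Re \<beta>)\<^sup>2 + (Im \<beta>)\<^sup>2" using \<beta> by (simp add: sum_power2_gt_zero_iff)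
        thus ?thesis by simp
      qed
      finally show ?thesis .
    qed
    ultimately have "(\<lambda>n. \<integral>x. ?G n x \<partial>?D) \<longlonglongrightarrow> (\<Sum>t\<in>I. lam t * 0)"
      by (simp only:) (intro tendsto_intros exp_quadratic_tendsto_0 b)
    thus ?thesis by simp
  qed
  have lim2: "(\<lambda>n. \<integral>x. (?G n x)\<^sup>2 \<partial>?D) \<longlonglongrightarrow> 0"
  proof -
    have "(\<integral>x. (?G n x)\<^sup>2 \<partial>?D) = (\<Sum>t\<in>I. \<Sum>u\<in>I. lam t * lam u * exp ((2 * \<beta>\<^sup>2 - 2 * (Re \<beta>)\<^sup>2) * of_real (b n) ^ 2
            + ((s t + s u) * 2 * (\<beta> - Re \<beta>)) * of_real (b n) + ((s t + s u)\<^sup>2 / 2 - (s t)\<^sup>2 - (s u)\<^sup>2)))" for n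
      unfolding has_bochner_integral_integral_eq[OF has_bochner_integral_tilt_sum_square]
      by (intro sum.cong refl arg_cong[where f = "\<lambda>z. _ * exp z"]) (simp add: power2_eq_square field_simps)
    \<comment> \<open>The value is - 2 (Im \<beta>)^2, which is negative precisely off the real
      axis.\<close>
    moreover have "Re (2 * \<beta>\<^sup>2 - 2 * (Re \<beta>)\<^sup>2) < 0"
      using \<beta> by (auto simp: power2_eq_square zero_less_mult_iff linorder_neq_iff)
    ultimately have "(\<lambda>n. \<integral>x. (?G n x)\<^sup>2 \<partial>?D) \<longlonglongrightarrow> (\<Sum>t\<in>I. \<Sum>u\<in>I. lam t * lam u * 0)"
      by (simp only:) (intro tendsto_intros exp_quadratic_tendsto_0 b)
    thus ?thesis by simp
  qed
  have c0: "(\<lambda>n. 1 / sqrt (card (A n))) \<longlonglongrightarrow> 0"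
    using filterlim_compose[OF filterlim_compose[OF sqrt_at_top filterlim_real_sequentially] card]
    by (intro tendsto_divide_0[OF tendsto_const] filterlim_at_top_imp_at_infinity) simp
  have "(\<lambda>n. \<integral>\<omega>. cis ((\<Sum>i\<in>A n. g n (X n i \<omega>) - (\<integral>x. g n x \<partial>?D)) / sqrt (card (A n))) \<partial>M n)
           \<longlonglongrightarrow> exp (- (Re (gaf_var I lam s) / 2) / 2)"
  proof (rule triangular_array_clt[OF M real_dist_normal_dist indep dist])
    show "integrable ?D (\<lambda>x. (g n x)\<^sup>2)" for n
      unfolding g_sq using Gn2 integrable_Re[OF Gsq] by (intro integrable_divide_zero Bochner_Integration.integrable_add) 
    show "(\<lambda>n. \<integral>x. g n x \<partial>?D) \<longlonglongrightarrow> 0"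
      unfolding gm using tendsto_Re[OF lim1] by simp
    have "(\<integral>x. (g n x)\<^sup>2 \<partial>?D) = (Re (gaf_var I lam s) + Re (\<integral>x. (?G n x)\<^sup>2 \<partial>?D)) / 2" for n
      unfolding g_sq integral_divide_zero
      by (subst Bochner_Integration.integral_add[OF Gn2 integrable_Re[OF Gsq]]) (simp only: Gn2_eq integral_Re[OF Gsq])
    moreover have "(\<lambda>n. (Re (gaf_var I lam s) + Re (\<integral>x. (?G n x)\<^sup>2 \<partial>?D)) / 2) \<longlonglongrightarrow> (Re (gaf_var I lam s) + Re 0) / 2"
      by (intro tendsto_intros lim2) simp
    ultimately show "(\<lambda>n. \<integral>x. (g n x)\<^sup>2 \<partial>?D) \<longlonglongrightarrow> Re (gaf_var I lam s) / 2"
      by (simp only: zero_complex.sel add_0_right)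
    show "(\<lambda>n. \<integral>x. (g n x)\<^sup>2 * min 1 ((\<bar>g n x\<bar> + 1) / sqrt (card (A n))) \<partial>?D) \<longlonglongrightarrow> 0"
    proof (rule tendsto_sandwich[OF _ _ tendsto_const])
      show "(\<lambda>n. \<integral>x. (norm (?G n x))\<^sup>2 * min 1 ((norm (?G n x) + 1) * (1 / sqrt (card (A n)))) \<partial>?D) \<longlonglongrightarrow> 0"
        using bc by (intro tilt_sum_lindeberg c0) auto
      show "\<forall>\<^sub>F n in sequentially. 0 \<le> (\<integral>x. (g n x)\<^sup>2 * min 1 ((\<bar>g n x\<bar> + 1) / sqrt (card (A n))) \<partial>?D)"
        by (intro always_eventually allI integral_nonneg) (auto intro!: mult_nonneg_nonneg divide_nonneg_nonneg)
      show "\<forall>\<^sub>F n in sequentially. (\<integral>x. (g n x)\<^sup>2 * min 1 ((\<bar>g n x\<bar> + 1) / sqrt (card (A n))) \<partial>?D) \<le>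
         (\<integral>x. (norm (?G n x))\<^sup>2 * min 1 ((norm (?G n x) + 1) * (1 / sqrt (card (A n)))) \<partial>?D)"
      proof (intro always_eventually allI integral_mono')
        fix n x
        have le: "\<bar>g n x\<bar> \<le> norm (?G n x)" unfolding g_def by (rule abs_Re_le_cmod)
        show "(g n x)\<^sup>2 * min 1 ((\<bar>g n x\<bar> + 1) / sqrt (card (A n))) \<le>
          (norm (?G n x))\<^sup>2 * min 1 ((norm (?G n x) + 1) * (1 / sqrt (card (A n))))"
        proof (rule mult_mono)
          show "(g n x)\<^sup>2 \<le> (norm (?G n x))\<^sup>2" using power_mono[OF le, of 2] by simp
          show "min 1 ((\<bar>g n x\<bar> + 1) / sqrt (card (A n))) \<le> min 1 ((norm (?G n x) + 1) * (1 / sqrt (card (A n))))"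
            using le by (intro min.mono) (auto intro!: divide_right_mono)
        qed auto
        show "0 \<le> (norm (?G n x))\<^sup>2 * min 1 ((norm (?G n x) + 1) * (1 / sqrt (card (A n))))" by auto
      next
        fix n
        show "integrable ?D (\<lambda>x. (norm (?G n x))\<^sup>2 * min 1 ((norm (?G n x) + 1) * (1 / sqrt (card (A n)))))"
          by (rule Bochner_Integration.integrable_bound[OF Gn2[of I lam s \<beta> "b n"]])
             (auto simp: abs_mult intro!: mult_left_le)
      qed
    qed
  qed (use card in auto)
  from this[unfolded gm] show ?thesis by (simp add: g_def)
qed

section \<open>Second moments along the tree\<close>

lemma grem_words_Suc:
  "grem_words N n (Suc m) = (\<lambda>(w, e). w @ [e]) ` (grem_words N n m \<times> {1..N n (Suc m)})"
proof (intro equalityI subsetI)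
  fix v assume v: "v \<in> grem_words N n (Suc m)"
  hence len: "length v = Suc m" and ran: "\<And>i. i \<in> {1..Suc m} \<Longrightarrow> v ! (i - 1) \<in> {1..N n i}"
    by (auto simp: grem_words_def)
  have "v = butlast v @ [last v]" using len by (cases v rule: rev_cases) auto
  moreover have "butlast v \<in> grem_words N n m"
    using len ran by (auto simp: grem_words_def nth_butlast)
  moreover have "last v \<in> {1..N n (Suc m)}"
    using ran[of "Suc m"] len last_conv_nth[of v] by (cases "v = []") auto
  ultimately show "v \<in> (\<lambda>(w, e). w @ [e]) ` (grem_words N n m \<times> {1..N n (Suc m)})"
    by (intro image_eqI[of _ _ "(butlast v, last v)"]) auto
next
  fix v assume "v \<in> (\<lambda>(w, e). w @ [e]) ` (grem_words N n m \<times> {1..N n (Suc m)})"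
  then obtain w e where v: "v = w @ [e]" "w \<in> grem_words N n m" "e \<in> {1..N n (Suc m)}" by auto
  have "v ! (i - 1) \<in> {1..N n i}" if i: "i \<in> {1..Suc m}" for i
    using i v by (cases "i = Suc m") (auto simp: grem_words_def nth_append)
  thus "v \<in> grem_words N n (Suc m)" using v by (auto simp: grem_words_def)
qed

lemma grem_words_0: "grem_words N n 0 = {[]}"
  by (auto simp: grem_words_def)

lemma inj_append_singleton: "inj_on (\<lambda>(w, e). w @ [e]) A"
  by (auto simp: inj_on_def)

lemma finite_grem_words: "finite (grem_words N n m)"
  by (induction m) (auto simp: grem_words_0 grem_words_Suc)

lemma card_grem_words: "card (grem_words N n m) = (\<Prod>j=1..m. N n j)"
  by (induction m) (simp_all add: grem_words_0 grem_words_Suc card_image[OF inj_append_singleton]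
      card_cartesian_product)

lemma take_grem_words: "w \<in> grem_words N n m \<Longrightarrow> j \<le> m \<Longrightarrow> take j w \<in> grem_words N n j"
  by (auto simp: grem_words_def)

lemma sum_grem_words_Suc:
  "(\<Sum>v\<in>grem_words N n (Suc m). f v) = (\<Sum>w\<in>grem_words N n m. \<Sum>e\<in>{1..N n (Suc m)}. f (w @ [e]))"
  unfolding grem_words_Suc sum.cartesian_product
  by (subst sum.reindex[OF inj_append_singleton]) (simp add: case_prod_beta')

section \<open>Complex exponential martingales along the branches\<close>

lemma (in prob_space) has_bochner_integral_const: "has_bochner_integral M (\<lambda>_. c) c"
  for c :: "'c :: {banach, second_countable_topology}"
  by (simp add: has_bochner_integral_iff prob_space)

lemma cnj_measurable [measurable]: "cnj \<in> borel_measurable borel"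
  by (intro borel_measurable_continuous_onI continuous_intros)

text \<open>The Wick exponential, of mean 1 for every complex \<beta>. Products of such factors
  along a branch form a martingale in the level.\<close>

definition exp_mart :: "complex \<Rightarrow> real \<Rightarrow> real \<Rightarrow> complex" where
  "exp_mart \<beta> r x = exp (\<beta> * of_real r * of_real x - \<beta>\<^sup>2 * of_real r ^ 2 / 2)"

lemma exp_mart_measurable [measurable]: "exp_mart \<beta> r \<in> borel_measurable borel"
  unfolding exp_mart_def by measurable

lemma has_bochner_integral_exp_mart:
  "has_bochner_integral std_normal_distribution (exp_mart \<beta> r) 1"
proof -
  have "has_bochner_integral std_normal_distribution
     (\<lambda>x. 1 * exp ((\<beta> * of_real r) * of_real x - \<beta>\<^sup>2 * of_real r ^ 2 / 2)) (1 * exp ((\<beta> * of_real r)\<^sup>2 / 2 - \<beta>\<^sup>2 * of_real r ^ 2 / 2))"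
    by (rule has_bochner_integral_std_normal_exp_linear)
  thus ?thesis by (simp add: exp_mart_def[abs_def] power_mult_distrib)
qed

text \<open>The squared modulus is a real exponential of slope 2 Re \<beta> * r with constant ((Re
  \<beta>)^2 - (Im \<beta>)^2) r^2, and half the squared slope minus the constant is |\<beta>|^2
  r^2.\<close>

lemma has_bochner_integral_exp_mart_norm2:
  "has_bochner_integral std_normal_distribution (\<lambda>x. (norm (exp_mart \<beta> r x))\<^sup>2) (exp ((norm \<beta>)\<^sup>2 * r\<^sup>2))"
proof -
  let ?z = "2 * Re \<beta> * r" and ?c = "((Re \<beta>)\<^sup>2 - (Im \<beta>)\<^sup>2) * r\<^sup>2"
  have "has_bochner_integral std_normal_distribution
     (\<lambda>x. Re (1 * exp (of_real ?z * of_real x - of_real ?c))) (Re (1 * exp ((of_real ?z)\<^sup>2 / 2 - of_real ?c)))"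
    by (intro has_bochner_integral_Re has_bochner_integral_std_normal_exp_linear)
  also have "Re (1 * exp ((of_real ?z)\<^sup>2 / 2 - of_real ?c)) = Re (of_real (exp (?z\<^sup>2 / 2 - ?c)))"
    by (simp only: exp_of_real[symmetric] of_real_diff of_real_divide of_real_power of_real_numeral mult_1)
  also have "\<dots> = exp ((norm \<beta>)\<^sup>2 * r\<^sup>2)"
    unfolding cmod_power2 by (simp add: power2_eq_square algebra_simps)
  also have "(\<lambda>x. Re (1 * exp (of_real ?z * of_real x - of_real ?c))) = (\<lambda>x. (norm (exp_mart \<beta> r x))\<^sup>2)"
  proof
    fix x
    have "Re (1 * exp (of_real ?z * of_real x - of_real ?c)) = Re (of_real (exp (?z * x - ?c)))"
      by (simp only: exp_of_real[symmetric] of_real_diff of_real_mult mult_1)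
    also have "\<dots> = exp (?z * x - ?c)" by simp
    also have "\<dots> = (norm (exp_mart \<beta> r x))\<^sup>2"
    proof -
      have "(norm (exp_mart \<beta> r x))\<^sup>2 = exp (2 * Re (\<beta> * of_real r * of_real x - \<beta>\<^sup>2 * of_real r ^ 2 / 2))"
        by (simp only: exp_mart_def norm_exp_eq_Re exp_double)
      also have "2 * Re (\<beta> * of_real r * of_real x - \<beta>\<^sup>2 * of_real r ^ 2 / 2) = ?z * x - ?c"
        by (simp add: power2_eq_square field_simps)
      finally show ?thesis ..
    qed
    finally show "Re (1 * exp (of_real ?z * of_real x - of_real ?c)) = (norm (exp_mart \<beta> r x))\<^sup>2" .
  qed
  finally show ?thesis .
qed

lemma has_bochner_integral_exp_mart_minus_1_norm2:
  "has_bochner_integral std_normal_distribution (\<lambda>x. (norm (exp_mart \<beta> r x - 1))\<^sup>2) (exp ((norm \<beta>)\<^sup>2 * r\<^sup>2) - 1)"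
proof -
  interpret D: real_distribution std_normal_distribution by (rule real_dist_normal_dist)
  have "has_bochner_integral std_normal_distribution
    (\<lambda>x. (norm (exp_mart \<beta> r x))\<^sup>2 - 2 * Re (exp_mart \<beta> r x) + 1) (exp ((norm \<beta>)\<^sup>2 * r\<^sup>2) - 2 * Re 1 + 1)"
    by (intro has_bochner_integral_add has_bochner_integral_diff has_bochner_integral_mult_right has_bochner_integral_Re
          has_bochner_integral_exp_mart has_bochner_integral_exp_mart_norm2 D.has_bochner_integral_const)
  moreover have "(norm (exp_mart \<beta> r x))\<^sup>2 - 2 * Re (exp_mart \<beta> r x) + 1 = (norm (exp_mart \<beta> r x - 1))\<^sup>2" for x
    unfolding cmod_power2 by (simp add: power2_eq_square algebra_simps)
  ultimately show ?thesis by simp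
qed

text \<open>A single fixed \<open>n\<close>. Positivity of the branching numbers is guaranteed only
  for large \<open>n\<close>; the other cases are treated outside the locale.\<close>

locale grem_setup = prob_space M for M :: "'a measure" +
  fixes d :: nat and a :: "nat \<Rightarrow> real" and N :: "nat \<Rightarrow> nat \<Rightarrow> nat" and n :: nat and \<xi> :: "nat list \<Rightarrow> 'a \<Rightarrow> real"
  assumes indep: "indep_vars (\<lambda>_. borel) \<xi> (\<Union>j\<in>{1..d}. grem_words N n j)"
    and normal: "\<And>j w. j \<in> {1..d} \<Longrightarrow> w \<in> grem_words N n j \<Longrightarrow> distributed M lborel (\<xi> w) std_normal_density"
    and a_pos: "\<And>j. j \<in> {1..d} \<Longrightarrow> a j > 0"
    and N_pos: "\<And>j. j \<in> {1..d} \<Longrightarrow> N n j > 0"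
begin

definition nodes :: "nat list set" where "nodes = (\<Union>j\<in>{1..d}. grem_words N n j)"

lemma finite_nodes: "finite nodes"
  by (simp add: nodes_def finite_grem_words)

lemma take_in_nodes: "w \<in> grem_words N n m \<Longrightarrow> j \<in> {1..m} \<Longrightarrow> m \<le> d \<Longrightarrow> take j w \<in> nodes"
  unfolding nodes_def using take_grem_words[of w N n m j] by force

lemma \<xi>_law: "v \<in> nodes \<Longrightarrow> distr M borel (\<xi> v) = std_normal_distribution"
  using normal by (auto simp: nodes_def distributed_def cong: distr_cong)

lemma \<xi>_measurable [measurable]: "v \<in> nodes \<Longrightarrow> \<xi> v \<in> borel_measurable M"
  using indep by (auto simp: indep_vars_def nodes_def)

lemma \<xi>_integral:
  fixes f :: "real \<Rightarrow> 'c :: {banach, second_countable_topology}"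
  assumes "v \<in> nodes" "has_bochner_integral std_normal_distribution f x"
  shows "has_bochner_integral M (\<lambda>\<omega>. f (\<xi> v \<omega>)) x"
proof -
  have "f \<in> borel_measurable borel" using assms(2) by (auto simp: has_bochner_integral_iff dest: borel_measurable_integrable)
  thus ?thesis
    using assms \<xi>_law[OF assms(1)] integrable_distr_eq[OF \<xi>_measurable[OF assms(1)], of f] integral_distr[OF \<xi>_measurable[OF assms(1)], of f]
    by (auto simp: has_bochner_integral_iff)
qed

text \<open>One factor per node of the whole tree, most of them equal to 1: products belonging to
  different branches then share an index set, and independence is applied in a single form.\<close>

lemma prod_nodes_integral:
  fixes f :: "nat list \<Rightarrow> real \<Rightarrow> complex"
  assumes "\<And>v. v \<in> nodes \<Longrightarrow> has_bochner_integral std_normal_distribution (f v) (m v)"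
  shows "has_bochner_integral M (\<lambda>\<omega>. \<Prod>v\<in>nodes. f v (\<xi> v \<omega>)) (\<Prod>v\<in>nodes. m v)"
proof -
  have f: "f v \<in> borel_measurable borel" if "v \<in> nodes" for v
    using assms[OF that] by (auto simp: has_bochner_integral_iff dest: borel_measurable_integrable)
  have ind: "indep_vars (\<lambda>_. borel) (\<lambda>v \<omega>. f v (\<xi> v \<omega>)) nodes"
    using indep_vars_compose2[OF indep[folded nodes_def], of f "\<lambda>_. borel"] f by blast
  have int: "integrable M (\<lambda>\<omega>. f v (\<xi> v \<omega>))" "(\<integral>\<omega>. f v (\<xi> v \<omega>) \<partial>M) = m v" if "v \<in> nodes" for v
    using \<xi>_integral[OF that assms[OF that]] by (auto simp: has_bochner_integral_iff)
  show ?thesis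
    unfolding has_bochner_integral_iff
    using indep_vars_integrable[OF finite_nodes ind int(1)] indep_vars_lebesgue_integral[OF finite_nodes ind int(1)] int(2)
    by simp
qed

definition scale :: "nat \<Rightarrow> real" where "scale j = sqrt (real n * a j)"

definition weight :: "nat \<Rightarrow> complex \<Rightarrow> nat list \<Rightarrow> 'a \<Rightarrow> complex" where
  "weight m \<beta> w \<omega> = (\<Prod>j=1..m. exp_mart \<beta> (scale j) (\<xi> (take j w) \<omega>))"

definition increment :: "nat \<Rightarrow> complex \<Rightarrow> nat list \<Rightarrow> 'a \<Rightarrow> complex" where
  "increment m \<beta> v \<omega> = weight m \<beta> v \<omega> * (exp_mart \<beta> (scale (Suc m)) (\<xi> v \<omega>) - 1)"

text \<open>Rewrites an increment as a product over all nodes; the factor is 1 off the branch of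
  \<open>v\<close>, and the level of a prefix is recovered as its length.\<close>

definition node_factor :: "nat \<Rightarrow> complex \<Rightarrow> nat list \<Rightarrow> nat list \<Rightarrow> real \<Rightarrow> complex" where
  "node_factor m \<beta> v x y = (if x = v then exp_mart \<beta> (scale (Suc m)) y - 1
     else if x \<in> (\<lambda>j. take j v) ` {1..m} then exp_mart \<beta> (scale (length x)) y else 1)"

text \<open>Prefixes of different lengths are different nodes, so the product collapses to the
  branch of \<open>v\<close>. The last node is split off because it carries the centred
  factor.\<close>

lemma prod_prefixes:
  fixes g :: "nat list \<Rightarrow> 'c :: comm_monoid_mult"
  assumes v: "v \<in> grem_words N n (Suc m)" and m: "Suc m \<le> d"
    and g: "\<And>x. x \<in> nodes \<Longrightarrow> x \<notin> (\<lambda>j. take j v) ` {1..Suc m} \<Longrightarrow> g x = 1"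
  shows "(\<Prod>x\<in>nodes. g x) = (\<Prod>j=1..m. g (take j v)) * g v"
proof -
  have len: "length v = Suc m" using v by (simp add: grem_words_def)
  have "(\<Prod>x\<in>nodes. g x) = (\<Prod>x\<in>(\<lambda>j. take j v) ` {1..Suc m}. g x)"
    using take_in_nodes[OF v _ m] g by (intro prod.mono_neutral_right finite_nodes) auto
  also have "inj_on (\<lambda>j. take j v) {1..Suc m}"
    using len by (intro inj_onI) (metis atLeastAtMost_iff length_take min.absorb2)
  hence "(\<Prod>x\<in>(\<lambda>j. take j v) ` {1..Suc m}. g x) = (\<Prod>j=1..Suc m. g (take j v))"
    by (subst prod.reindex) auto
  also have "\<dots> = (\<Prod>j=1..m. g (take j v)) * g v" using len by simp
  finally show ?thesis .
qed

lemma node_factor_prefix: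
  assumes "v \<in> grem_words N n (Suc m)" "j \<in> {1..m}"
  shows "node_factor m \<beta> v (take j v) = exp_mart \<beta> (scale j)"
proof -
  have "length (take j v) = j" "take j v \<noteq> v" using assms by (auto simp: grem_words_def)
  thus ?thesis using assms(2) by (auto simp: node_factor_def fun_eq_iff)
qed

lemma increment_eq_prod:
  assumes v: "v \<in> grem_words N n (Suc m)" and m: "Suc m \<le> d"
  shows "increment m \<beta> v \<omega> = (\<Prod>x\<in>nodes. node_factor m \<beta> v x (\<xi> x \<omega>))"
proof -
  have len: "length v = Suc m" using v by (simp add: grem_words_def)
  have "node_factor m \<beta> v x (\<xi> x \<omega>) = 1" if "x \<notin> (\<lambda>j. take j v) ` {1..Suc m}" for x
  proof -
    have "x \<noteq> v" using that len by (metis atLeastAtMost_iff image_eqI le_add1 order_refl plus_1_eq_Suc take_all)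
    moreover have "x \<notin> (\<lambda>j. take j v) ` {1..m}" using that by auto
    ultimately show ?thesis by (simp add: node_factor_def)
  qed
  hence "(\<Prod>x\<in>nodes. node_factor m \<beta> v x (\<xi> x \<omega>)) =
     (\<Prod>j=1..m. node_factor m \<beta> v (take j v) (\<xi> (take j v) \<omega>)) * node_factor m \<beta> v v (\<xi> v \<omega>)"
    by (rule prod_prefixes[OF v m, of "\<lambda>x. node_factor m \<beta> v x (\<xi> x \<omega>)"])
  also have "\<dots> = increment m \<beta> v \<omega>"
    using node_factor_prefix[OF v] by (simp add: increment_def weight_def node_factor_def[of m \<beta> v v])
  finally show ?thesis ..
qed

lemma node_factor_square_integrable:
  "node_factor m \<beta> v x \<in> borel_measurable borel"
  "integrable std_normal_distribution (\<lambda>y. (norm (node_factor m \<beta> v x y))\<^sup>2)"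
proof -
  interpret D: real_distribution std_normal_distribution by (rule real_dist_normal_dist)
  show "node_factor m \<beta> v x \<in> borel_measurable borel" unfolding node_factor_def[abs_def] by measurable
  show "integrable std_normal_distribution (\<lambda>y. (norm (node_factor m \<beta> v x y))\<^sup>2)"
    using has_bochner_integral_exp_mart_norm2 has_bochner_integral_exp_mart_minus_1_norm2
    by (cases "x = v"; cases "x \<in> (\<lambda>j. take j v) ` {1..m}")
       (simp_all add: node_factor_def has_bochner_integral_iff)
qed

lemma node_factor_mult_integrable:
  "integrable std_normal_distribution (\<lambda>y. node_factor m \<beta> v x y * cnj (node_factor m \<beta> v' x y))"
proof (rule Bochner_Integration.integrable_bound)
  note [measurable] = node_factor_square_integrable(1)
  show "integrable std_normal_distribution (\<lambda>y. (norm (node_factor m \<beta> v x y))\<^sup>2 + (norm (node_factor m \<beta> v' x y))\<^sup>2)"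
    by (intro Bochner_Integration.integrable_add node_factor_square_integrable)
  show "(\<lambda>y. node_factor m \<beta> v x y * cnj (node_factor m \<beta> v' x y)) \<in> borel_measurable std_normal_distribution"
    by measurable
  show "AE y in std_normal_distribution. norm (node_factor m \<beta> v x y * cnj (node_factor m \<beta> v' x y))
      \<le> norm ((norm (node_factor m \<beta> v x y))\<^sup>2 + (norm (node_factor m \<beta> v' x y))\<^sup>2)"
  proof (rule AE_I2)
    fix y
    have "0 \<le> (norm (node_factor m \<beta> v x y) - norm (node_factor m \<beta> v' x y))\<^sup>2" by simp
    moreover have "0 \<le> norm (node_factor m \<beta> v x y) * norm (node_factor m \<beta> v' x y)" by simp
    ultimately have "norm (node_factor m \<beta> v x y) * norm (node_factor m \<beta> v' x y)
        \<le> (norm (node_factor m \<beta> v x y))\<^sup>2 + (norm (node_factor m \<beta> v' x y))\<^sup>2"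
      unfolding power2_diff by linarith
    thus "norm (node_factor m \<beta> v x y * cnj (node_factor m \<beta> v' x y))
      \<le> norm ((norm (node_factor m \<beta> v x y))\<^sup>2 + (norm (node_factor m \<beta> v' x y))\<^sup>2)"
      by (simp add: norm_mult)
  qed
qed

lemma word_in_nodes: "v \<in> grem_words N n (Suc m) \<Longrightarrow> Suc m \<le> d \<Longrightarrow> v \<in> nodes"
  by (auto simp: nodes_def)

lemma has_bochner_integral_node_factor_self:
  "has_bochner_integral std_normal_distribution (node_factor m \<beta> v v) 0"
proof -
  interpret D: real_distribution std_normal_distribution by (rule real_dist_normal_dist)
  have "has_bochner_integral std_normal_distribution (\<lambda>x. exp_mart \<beta> (scale (Suc m)) x - 1) (1 - 1)"
    by (intro has_bochner_integral_diff has_bochner_integral_exp_mart D.has_bochner_integral_const)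
  thus ?thesis by (simp add: node_factor_def[abs_def])
qed

text \<open>By independence the mean is a product of node means, and the one at \<open>v\<close> is
  zero.\<close>

lemma increment_mean:
  assumes v: "v \<in> grem_words N n (Suc m)" and m: "Suc m \<le> d"
  shows "has_bochner_integral M (increment m \<beta> v) 0"
proof -
  have "has_bochner_integral std_normal_distribution (node_factor m \<beta> v x) (\<integral>y. node_factor m \<beta> v x y \<partial>std_normal_distribution)" for x
  proof -
    interpret D: real_distribution std_normal_distribution by (rule real_dist_normal_dist)
    show ?thesis
      using D.square_integrable_imp_integrable[OF _ node_factor_square_integrable(2)] node_factor_square_integrable(1)
      by (simp add: has_bochner_integral_iff integrable_norm_iff)
  qed
  hence "has_bochner_integral M (\<lambda>\<omega>. \<Prod>x\<in>nodes. node_factor m \<beta> v x (\<xi> x \<omega>))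
           (\<Prod>x\<in>nodes. \<integral>y. node_factor m \<beta> v x y \<partial>std_normal_distribution)"
    by (intro prod_nodes_integral)
  also have "(\<Prod>x\<in>nodes. \<integral>y. node_factor m \<beta> v x y \<partial>std_normal_distribution) = 0"
    using has_bochner_integral_node_factor_self[of m \<beta> v] word_in_nodes[OF v m] finite_nodes
    by (intro prod_zero) (auto simp: has_bochner_integral_iff)
  also have "(\<lambda>\<omega>. \<Prod>x\<in>nodes. node_factor m \<beta> v x (\<xi> x \<omega>)) = increment m \<beta> v"
    using increment_eq_prod[OF v m] by (simp add: fun_eq_iff)
  finally show ?thesis .
qed

text \<open>If \<open>v \<noteq> v'\<close>, the factor at node \<open>v\<close> is centred and occurs in the increment of \<open>v\<close> only.\<close>

lemma increment_cov:
  assumes v: "v \<in> grem_words N n (Suc m)" and v': "v' \<in> grem_words N n (Suc m)" and m: "Suc m \<le> d"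
  shows "has_bochner_integral M (\<lambda>\<omega>. increment m \<beta> v \<omega> * cnj (increment m \<beta> v' \<omega>))
    (if v = v' then of_real ((\<Prod>j=1..m. exp ((norm \<beta>)\<^sup>2 * (scale j)\<^sup>2)) * (exp ((norm \<beta>)\<^sup>2 * (scale (Suc m))\<^sup>2) - 1)) else 0)"
proof -
  let ?D = std_normal_distribution
  define c where "c x = (\<integral>y. node_factor m \<beta> v x y * cnj (node_factor m \<beta> v' x y) \<partial>?D)" for x
  have "has_bochner_integral ?D (\<lambda>y. node_factor m \<beta> v x y * cnj (node_factor m \<beta> v' x y)) (c x)" for x
    using node_factor_mult_integrable by (simp add: has_bochner_integral_iff c_def)
  hence "has_bochner_integral M (\<lambda>\<omega>. \<Prod>x\<in>nodes. node_factor m \<beta> v x (\<xi> x \<omega>) * cnj (node_factor m \<beta> v' x (\<xi> x \<omega>)))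
           (\<Prod>x\<in>nodes. c x)"
    by (rule prod_nodes_integral)
  also have "(\<lambda>\<omega>. \<Prod>x\<in>nodes. node_factor m \<beta> v x (\<xi> x \<omega>) * cnj (node_factor m \<beta> v' x (\<xi> x \<omega>))) =
     (\<lambda>\<omega>. increment m \<beta> v \<omega> * cnj (increment m \<beta> v' \<omega>))"
    by (simp add: increment_eq_prod[OF v m] increment_eq_prod[OF v' m] prod.distrib cnj_prod)
  also have "(\<Prod>x\<in>nodes. c x) =
    (if v = v' then of_real ((\<Prod>j=1..m. exp ((norm \<beta>)\<^sup>2 * (scale j)\<^sup>2)) * (exp ((norm \<beta>)\<^sup>2 * (scale (Suc m))\<^sup>2) - 1)) else 0)"
  proof (cases "v = v'")
    case False
    have len: "length v = Suc m" "length v' = Suc m" using v v' by (auto simp: grem_words_def)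
    \<comment> \<open>The prefixes in question have length at most m, whereas \<open>v\<close> has
      length m + 1.\<close>
    hence "v \<notin> (\<lambda>j. take j v') ` {1..m}" by auto
    hence "node_factor m \<beta> v' v y = 1" for y using False by (simp add: node_factor_def)
    hence "c v = 0" using has_bochner_integral_node_factor_self[of m \<beta> v]
      by (simp add: c_def has_bochner_integral_iff)
    thus ?thesis using word_in_nodes[OF v m] finite_nodes False by (auto intro!: prod_zero)
  next
    case True
    have c2: "c x = of_real (\<integral>y. (norm (node_factor m \<beta> v x y))\<^sup>2 \<partial>?D)" for x
      unfolding c_def True by (simp only: complex_norm_square[symmetric] integral_complex_of_real)
    have len: "length v = Suc m" using v by (auto simp: grem_words_def)
    have "c x = 1" if "x \<notin> (\<lambda>j. take j v) ` {1..Suc m}" for x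
    proof -
      have "x \<noteq> v" using that len by (metis atLeastAtMost_iff image_eqI le_add1 order_refl plus_1_eq_Suc take_all)
      moreover have "x \<notin> (\<lambda>j. take j v) ` {1..m}" using that by auto
      ultimately show ?thesis
        using real_distribution.axioms(1)[OF real_dist_normal_dist, THEN prob_space.prob_space]
        by (simp add: c2 node_factor_def)
    qed
    hence "(\<Prod>x\<in>nodes. c x) = (\<Prod>j=1..m. c (take j v)) * c v"
      by (rule prod_prefixes[OF v m, of c])
    moreover have "c (take j v) = of_real (exp ((norm \<beta>)\<^sup>2 * (scale j)\<^sup>2))" if "j \<in> {1..m}" for j
      using has_bochner_integral_exp_mart_norm2[of \<beta> "scale j"]
      by (simp add: c2 node_factor_prefix[OF v that] has_bochner_integral_iff)
    moreover have "c v = of_real (exp ((norm \<beta>)\<^sup>2 * (scale (Suc m))\<^sup>2) - 1)"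
      using has_bochner_integral_exp_mart_minus_1_norm2[of \<beta> "scale (Suc m)"]
      by (simp add: c2 node_factor_def has_bochner_integral_iff)
    ultimately show ?thesis using True by simp
  qed
  finally show ?thesis .
qed

definition level_diff :: "nat \<Rightarrow> complex \<Rightarrow> 'a \<Rightarrow> complex" where
  "level_diff m \<beta> \<omega> = (\<Sum>v\<in>grem_words N n (Suc m). increment m \<beta> v \<omega>) / of_nat (\<Prod>j=1..Suc m. N n j)"

lemma level_diff_mean:
  assumes "Suc m \<le> d"
  shows "has_bochner_integral M (level_diff m \<beta>) 0"
proof -
  have "has_bochner_integral M (\<lambda>\<omega>. (\<Sum>v\<in>grem_words N n (Suc m). increment m \<beta> v \<omega>) / of_nat (\<Prod>j=1..Suc m. N n j))
     ((\<Sum>v\<in>grem_words N n (Suc m). 0) / of_nat (\<Prod>j=1..Suc m. N n j))"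
    using assms by (intro has_bochner_integral_divide_zero has_bochner_integral_sum increment_mean)
  thus ?thesis by (simp add: level_diff_def[abs_def])
qed

text \<open>Orthogonality leaves only the diagonal, so a number p of equal terms is divided by p^2.
  The -1 in the variance of the last factor is dropped to obtain a clean product over
  levels.\<close>

lemma level_diff_second_moment:
  assumes m: "Suc m \<le> d"
  shows "integrable M (\<lambda>\<omega>. (norm (level_diff m \<beta> \<omega>))\<^sup>2)"
    and "(\<integral>\<omega>. (norm (level_diff m \<beta> \<omega>))\<^sup>2 \<partial>M) \<le> (\<Prod>j=1..Suc m. exp ((norm \<beta>)\<^sup>2 * (scale j)\<^sup>2) / real (N n j))"
proof -
  let ?W = "grem_words N n (Suc m)"
  define K where "K = (\<Prod>j=1..m. exp ((norm \<beta>)\<^sup>2 * (scale j)\<^sup>2)) * (exp ((norm \<beta>)\<^sup>2 * (scale (Suc m))\<^sup>2) - 1)"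
  define p where "p = real (\<Prod>j=1..Suc m. N n j)"
  have p: "p > 0" unfolding p_def of_nat_0_less_iff using N_pos m by (intro prod_pos) auto
  have "has_bochner_integral M (\<lambda>\<omega>. \<Sum>v\<in>?W. \<Sum>v'\<in>?W. increment m \<beta> v \<omega> * cnj (increment m \<beta> v' \<omega>))
     (\<Sum>v\<in>?W. \<Sum>v'\<in>?W. if v = v' then of_real K else 0)"
    unfolding K_def by (intro has_bochner_integral_sum increment_cov m)
  also have "(\<Sum>v\<in>?W. \<Sum>v'\<in>?W. if v = v' then of_real K else 0) = complex_of_real (p * K)"
    using finite_grem_words[of N n "Suc m"] by (simp add: p_def card_grem_words)
  also have "(\<lambda>\<omega>. \<Sum>v\<in>?W. \<Sum>v'\<in>?W. increment m \<beta> v \<omega> * cnj (increment m \<beta> v' \<omega>)) =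
     (\<lambda>\<omega>. complex_of_real ((norm (\<Sum>v\<in>?W. increment m \<beta> v \<omega>))\<^sup>2))"
    unfolding complex_norm_square cnj_sum sum_product ..
  finally have "has_bochner_integral M (\<lambda>\<omega>. Re (complex_of_real ((norm (\<Sum>v\<in>?W. increment m \<beta> v \<omega>))\<^sup>2))) (Re (complex_of_real (p * K)))"
    by (rule has_bochner_integral_Re)
  hence "has_bochner_integral M (\<lambda>\<omega>. (norm (\<Sum>v\<in>?W. increment m \<beta> v \<omega>))\<^sup>2 / p\<^sup>2) ((p * K) / p\<^sup>2)"
    by (intro has_bochner_integral_divide_zero) simp
  also have "(\<lambda>\<omega>. (norm (\<Sum>v\<in>?W. increment m \<beta> v \<omega>))\<^sup>2 / p\<^sup>2) = (\<lambda>\<omega>. (norm (level_diff m \<beta> \<omega>))\<^sup>2)"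
    using p by (simp only: level_diff_def norm_divide power_divide p_def norm_of_nat)
  also have "(p * K) / p\<^sup>2 = K / p" using p by (simp add: power2_eq_square)
  finally have *: "has_bochner_integral M (\<lambda>\<omega>. (norm (level_diff m \<beta> \<omega>))\<^sup>2) (K / p)" .
  show "integrable M (\<lambda>\<omega>. (norm (level_diff m \<beta> \<omega>))\<^sup>2)" using * by (simp add: has_bochner_integral_iff)
  have "K \<le> (\<Prod>j=1..m. exp ((norm \<beta>)\<^sup>2 * (scale j)\<^sup>2)) * exp ((norm \<beta>)\<^sup>2 * (scale (Suc m))\<^sup>2)"
    unfolding K_def by (intro mult_left_mono prod_nonneg) auto
  hence "K / p \<le> (\<Prod>j=1..Suc m. exp ((norm \<beta>)\<^sup>2 * (scale j)\<^sup>2)) / p" using p by (intro divide_right_mono) auto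
  also have "\<dots> = (\<Prod>j=1..Suc m. exp ((norm \<beta>)\<^sup>2 * (scale j)\<^sup>2) / real (N n j))"
    by (simp only: prod_dividef p_def of_nat_prod)
  finally show "(\<integral>\<omega>. (norm (level_diff m \<beta> \<omega>))\<^sup>2 \<partial>M) \<le> (\<Prod>j=1..Suc m. exp ((norm \<beta>)\<^sup>2 * (scale j)\<^sup>2) / real (N n j))"
    using * by (simp add: has_bochner_integral_iff)
qed

lemma weight_snoc: "length w = m \<Longrightarrow> weight m \<beta> (w @ [e]) \<omega> = weight m \<beta> w \<omega>"
  by (simp add: weight_def)

text \<open>A telescoping sum over levels: a weight of depth \<open>m\<close> ignores letter
  \<open>m + 1\<close>, so averaging it over longer words changes nothing, and adding the next
  factor contributes exactly \<open>level_diff m\<close>.\<close>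

lemma weight_sum:
  assumes "m \<le> d"
  shows "(\<Sum>w\<in>grem_words N n m. weight m \<beta> w \<omega>) / of_nat (\<Prod>j=1..m. N n j) = 1 + (\<Sum>k<m. level_diff k \<beta> \<omega>)"
  using assms
proof (induction m)
  case 0
  show ?case by (simp add: grem_words_0 weight_def)
next
  case (Suc m)
  let ?p = "of_nat (\<Prod>j=1..m. N n j) :: complex" and ?q = "of_nat (N n (Suc m)) :: complex"
  have q: "?q \<noteq> 0" using N_pos[of "Suc m"] Suc.prems by simp
  have "(\<Sum>v\<in>grem_words N n (Suc m). weight m \<beta> v \<omega>) = ?q * (\<Sum>w\<in>grem_words N n m. weight m \<beta> w \<omega>)"
  proof -
    have "(\<Sum>v\<in>grem_words N n (Suc m). weight m \<beta> v \<omega>) = (\<Sum>w\<in>grem_words N n m. \<Sum>e\<in>{1..N n (Suc m)}. weight m \<beta> w \<omega>)"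
      unfolding sum_grem_words_Suc by (intro sum.cong refl weight_snoc) (simp add: grem_words_def)
    thus ?thesis by (simp add: sum_distrib_left)
  qed
  hence 1: "(\<Sum>v\<in>grem_words N n (Suc m). weight m \<beta> v \<omega>) / of_nat (\<Prod>j=1..Suc m. N n j) =
     (\<Sum>w\<in>grem_words N n m. weight m \<beta> w \<omega>) / ?p"
    using q by simp
  have "weight (Suc m) \<beta> v \<omega> = weight m \<beta> v \<omega> + increment m \<beta> v \<omega>" if "v \<in> grem_words N n (Suc m)" for v
    using that by (simp add: weight_def increment_def grem_words_def algebra_simps)
  hence "(\<Sum>v\<in>grem_words N n (Suc m). weight (Suc m) \<beta> v \<omega>) =
     (\<Sum>v\<in>grem_words N n (Suc m). weight m \<beta> v \<omega>) + (\<Sum>v\<in>grem_words N n (Suc m). increment m \<beta> v \<omega>)"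
    by (simp add: sum.distrib)
  thus ?case using Suc 1 by (simp add: add_divide_distrib level_diff_def del: prod.cl_ivl_Suc)
qed

lemma grem_Z_eq:
  "grem_Z d a N \<xi> n \<beta> \<omega> =
     (\<Prod>j=1..d. of_nat (N n j) * exp (\<beta>\<^sup>2 * of_real (a j) * of_nat n / 2)) * (1 + (\<Sum>k<d. level_diff k \<beta> \<omega>))"
proof -
  have sc: "(of_real (scale j))\<^sup>2 = complex_of_real (a j) * of_nat n" if "j \<in> {1..d}" for j
  proof -
    have "(scale j)\<^sup>2 = a j * real n" using a_pos[OF that] by (simp add: scale_def mult.commute)
    hence "complex_of_real ((scale j)\<^sup>2) = of_real (a j * real n)" by (rule arg_cong)
    thus ?thesis by simp
  qed
  have "exp (\<beta> * of_real (sqrt (real n)) * of_real (grem_X d a \<xi> \<epsilon> \<omega>)) =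
     (\<Prod>j=1..d. exp (\<beta>\<^sup>2 * of_real (a j) * of_nat n / 2)) * weight d \<beta> \<epsilon> \<omega>" for \<epsilon>
  proof -
    have "exp (\<beta> * of_real (sqrt (real n)) * of_real (grem_X d a \<xi> \<epsilon> \<omega>)) =
      exp (\<Sum>j=1..d. \<beta> * of_real (scale j) * of_real (\<xi> (take j \<epsilon>) \<omega>))"
      by (simp add: grem_X_def scale_def real_sqrt_mult sum_distrib_left mult_ac)
    also have "\<dots> = (\<Prod>j=1..d. exp (\<beta> * of_real (scale j) * of_real (\<xi> (take j \<epsilon>) \<omega>)))"
      by (simp add: exp_sum)
    also have "\<dots> = (\<Prod>j=1..d. exp (\<beta>\<^sup>2 * of_real (a j) * of_nat n / 2) * exp_mart \<beta> (scale j) (\<xi> (take j \<epsilon>) \<omega>))"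
      by (intro prod.cong refl) (simp add: exp_mart_def sc exp_add[symmetric] mult.assoc)
    finally show ?thesis by (simp add: weight_def prod.distrib)
  qed
  hence "grem_Z d a N \<xi> n \<beta> \<omega> = (\<Prod>j=1..d. exp (\<beta>\<^sup>2 * of_real (a j) * of_nat n / 2)) * (\<Sum>w\<in>grem_words N n d. weight d \<beta> w \<omega>)"
    by (simp add: grem_Z_def sum_distrib_left)
  also have "(\<Sum>w\<in>grem_words N n d. weight d \<beta> w \<omega>) = of_nat (\<Prod>j=1..d. N n j) * (1 + (\<Sum>k<d. level_diff k \<beta> \<omega>))"
  proof -
    have "(of_nat (\<Prod>j=1..d. N n j) :: complex) \<noteq> 0" using N_pos by (subst of_nat_eq_0_iff) (auto simp: prod_zero_iff)
    thus ?thesis using weight_sum[of d \<beta> \<omega>] by (simp add: field_simps)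
  qed
  finally show ?thesis by (simp add: prod.distrib mult_ac)
qed

lemma grem_Z_mean:
  "(\<integral>\<omega>. grem_Z d a N \<xi> n \<beta> \<omega> \<partial>M) = (\<Prod>j=1..d. of_nat (N n j) * exp (\<beta>\<^sup>2 * of_real (a j) * of_nat n / 2))"
proof -
  have "has_bochner_integral M (\<lambda>\<omega>. 1 + (\<Sum>k<d. level_diff k \<beta> \<omega>)) (1 + (\<Sum>k<d. 0))"
    by (intro has_bochner_integral_add has_bochner_integral_sum level_diff_mean has_bochner_integral_const) auto
  thus ?thesis unfolding grem_Z_eq by (simp add: has_bochner_integral_iff)
qed

lemma level_diff_0:
  "level_diff 0 \<beta> \<omega> = (\<Sum>e=1..N n 1. exp_mart \<beta> (scale 1) (\<xi> [e] \<omega>) - 1) / of_nat (N n 1)"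
  unfolding level_diff_def sum_grem_words_Suc by (simp add: grem_words_0 increment_def weight_def)

end

section \<open>The normalized fluctuation and the reduction to its first level\<close>

lemma norm_cis_diff_le: "norm (cis x - cis y) \<le> \<bar>x - y\<bar>"
proof -
  have "cis x - cis y = cis y * (cis (x - y) - 1)"
    by (simp add: right_diff_distrib cis_mult)
  moreover have "norm (cis (x - y) - 1) \<le> \<bar>x - y\<bar>"
    using iexp_approx1[of "x - y" 0] by (simp add: cis_conv_exp)
  ultimately show ?thesis by (simp add: norm_mult)
qed

text \<open>Nonnegativity of the variance of the norm.\<close>

lemma (in prob_space) expectation_le_sqrt_second_moment:
  fixes f :: "'a \<Rightarrow> 'c :: {banach, second_countable_topology}"
  assumes "f \<in> borel_measurable M" "integrable M (\<lambda>x. (norm (f x))\<^sup>2)"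
  shows "integrable M f" and "expectation (\<lambda>x. norm (f x)) \<le> sqrt (expectation (\<lambda>x. (norm (f x))\<^sup>2))"
proof -
  have int: "integrable M (\<lambda>x. norm (f x))"
    by (rule square_integrable_imp_integrable[OF measurable_compose[OF assms(1) borel_measurable_norm] assms(2)])
  thus "integrable M f" using assms(1) by (simp add: integrable_norm_iff)
  have "0 \<le> variance (\<lambda>x. norm (f x))" by simp
  also have "\<dots> = expectation (\<lambda>x. (norm (f x))\<^sup>2) - (expectation (\<lambda>x. norm (f x)))\<^sup>2"
    by (rule variance_eq[OF int assms(2)])
  finally show "expectation (\<lambda>x. norm (f x)) \<le> sqrt (expectation (\<lambda>x. (norm (f x))\<^sup>2))"
    by (intro real_le_rsqrt) simp
qed

text \<open>The random function of the theorem for one \<open>n\<close>. It is defined outside the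
  locale because it is also needed when a branching number vanishes.\<close>

definition fluct ::
  "nat \<Rightarrow> (nat \<Rightarrow> real) \<Rightarrow> (nat \<Rightarrow> nat \<Rightarrow> nat) \<Rightarrow> nat \<Rightarrow> 'a measure \<Rightarrow> (nat list \<Rightarrow> 'a \<Rightarrow> real) \<Rightarrow> complex \<Rightarrow> 'a \<Rightarrow> complex \<Rightarrow> complex"
where
  "fluct d a N n M \<xi> \<beta>s \<omega> t =
     (grem_Z d a N \<xi> n (\<beta>s + t / of_real (sqrt (real n))) \<omega>
        - (\<integral>\<omega>'. grem_Z d a N \<xi> n (\<beta>s + t / of_real (sqrt (real n))) \<omega>' \<partial>M)) /
      (of_real (sqrt (real (N n 1))) *
       exp (of_real (a 1) * (of_real (Re \<beta>s) + t / of_real (sqrt (real n))) ^ 2 * of_nat n) *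
       exp (grem_c d a N n (\<beta>s + t / of_real (sqrt (real n)))))"

text \<open>The exponential in front bounds what the normalization leaves of level 1; the product,
  with |\<beta>| sqrt n replaced by its maximum over |t| \<le> R, is empty for
  \<open>m = 0\<close>.\<close>

definition fluct_bound :: "(nat \<Rightarrow> real) \<Rightarrow> (nat \<Rightarrow> nat \<Rightarrow> nat) \<Rightarrow> nat \<Rightarrow> nat \<Rightarrow> complex \<Rightarrow> real \<Rightarrow> real" where
  "fluct_bound a N n m \<beta>s R =
     exp (2 * a 1 * R\<^sup>2) * (\<Prod>j=2..Suc m. exp (a j * (norm \<beta>s * sqrt n + R)\<^sup>2) / N n j)"

context grem_setup
begin

text \<open>The mean of the partition function divided by the normalization. Levels 2 to d cancel
  against \<open>exp (grem_c ...)\<close>, so only level 1 is visible.\<close>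

definition fluct_scale :: "complex \<Rightarrow> complex \<Rightarrow> complex" where
  "fluct_scale \<beta>s t = of_real (sqrt (N n 1)) * exp (of_real (a 1) * (\<beta>s + t / of_real (sqrt n))\<^sup>2 * of_nat n / 2
      - of_real (a 1) * (of_real (Re \<beta>s) + t / of_real (sqrt n))\<^sup>2 * of_nat n)"

definition fluct_term :: "nat \<Rightarrow> complex \<Rightarrow> complex \<Rightarrow> 'a \<Rightarrow> complex" where
  "fluct_term m \<beta>s t \<omega> = fluct_scale \<beta>s t * level_diff m (\<beta>s + t / of_real (sqrt n)) \<omega>"

lemma exp_grem_c:
  "exp (grem_c d a N n \<beta>) = (\<Prod>j=2..d. of_nat (N n j) * exp (\<beta>\<^sup>2 * of_real (a j) * of_nat n / 2))"
proof -
  have "exp (complex_of_real (ln (real (N n j)))) = of_nat (N n j)" if "j \<in> {2..d}" for j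
    using N_pos[of j] that by (simp add: exp_of_real)
  thus ?thesis unfolding grem_c_def
    by (subst exp_sum) (auto simp: exp_add mult_ac intro!: prod.cong)
qed

lemma fluct_eq:
  assumes d: "d \<ge> 1"
  shows "fluct d a N n M \<xi> \<beta>s \<omega> t = (\<Sum>m<d. fluct_term m \<beta>s t \<omega>)"
proof -
  let ?\<beta> = "\<beta>s + t / of_real (sqrt (real n))"
  let ?A = "exp (of_real (a 1) * (of_real (Re \<beta>s) + t / of_real (sqrt (real n))) ^ 2 * of_nat n)"
  let ?B = "exp (?\<beta>\<^sup>2 * of_real (a 1) * of_nat n / 2)"
  let ?p = "\<Prod>j=2..d. of_nat (N n j) * exp (?\<beta>\<^sup>2 * of_real (a j) * of_nat n / 2) :: complex"
  have p: "?p \<noteq> 0" using N_pos by (auto simp: prod_zero_iff)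
  have N1: "of_nat (N n 1) = complex_of_real (sqrt (N n 1)) * of_real (sqrt (N n 1))"
    "complex_of_real (sqrt (N n 1)) \<noteq> 0"
    using N_pos[of 1] d by (auto simp flip: of_real_mult)
  have split: "(\<Prod>j=1..d. of_nat (N n j) * exp (?\<beta>\<^sup>2 * of_real (a j) * of_nat n / 2)) = of_nat (N n 1) * ?B * ?p"
    using d by (simp add: prod.atLeast_Suc_atMost numeral_2_eq_2)
  have "fluct d a N n M \<xi> \<beta>s \<omega> t = (of_nat (N n 1) * ?B * ?p) * (\<Sum>m<d. level_diff m ?\<beta> \<omega>) / (of_real (sqrt (N n 1)) * ?A * ?p)"
    unfolding fluct_def grem_Z_mean exp_grem_c grem_Z_eq split by (simp add: algebra_simps)
  also have "\<dots> = of_real (sqrt (N n 1)) * (?B / ?A) * (\<Sum>m<d. level_diff m ?\<beta> \<omega>)"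
  proof -
    have "q * q * B * p * L / (q * A * p) = q * (B / A) * L" if "p \<noteq> 0" "q \<noteq> 0" for q B A p L :: complex
      using that by simp
    from this[OF p N1(2)] show ?thesis unfolding N1(1) .
  qed
  also have "of_real (sqrt (N n 1)) * (?B / ?A) = fluct_scale \<beta>s t"
    by (simp add: fluct_scale_def exp_diff mult_ac)
  finally show ?thesis by (simp add: fluct_term_def sum_distrib_left)
qed

text \<open>With x + i y = \<beta>s + h the point Re \<beta>s + h has the same real part x, and Re
  ((x + i y)^2) - 2 (x^2 - (Im h)^2) = 2 (Im h)^2 - (x^2 + y^2).\<close>

lemma norm_fluct_scale:
  assumes n: "n > 0"
  shows "(norm (fluct_scale \<beta>s t))\<^sup>2 = N n 1 * exp (a 1 * (2 * (Im t)\<^sup>2 - (norm (\<beta>s + t / of_real (sqrt n)))\<^sup>2 * n))"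
proof -
  define h where "h = t / of_real (sqrt n)"
  have sn: "sqrt (real n) > 0" using n by simp
  have h: "(Im h)\<^sup>2 * n = (Im t)\<^sup>2"
    using n by (simp add: h_def power_divide)
  have "(norm (fluct_scale \<beta>s t))\<^sup>2 = N n 1 * exp (2 * Re (of_real (a 1) * (\<beta>s + h)\<^sup>2 * of_nat n / 2
      - of_real (a 1) * (of_real (Re \<beta>s) + h)\<^sup>2 * of_nat n))"
    by (simp only: fluct_scale_def h_def[symmetric] norm_mult power_mult_distrib norm_exp_eq_Re exp_double) simp
  also have "2 * Re (of_real (a 1) * (\<beta>s + h)\<^sup>2 * of_nat n / 2
      - of_real (a 1) * (of_real (Re \<beta>s) + h)\<^sup>2 * of_nat n) = a 1 * (2 * ((Im h)\<^sup>2 * n) - (norm (\<beta>s + h))\<^sup>2 * n)"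
    unfolding cmod_power2 by (simp add: power2_eq_square field_simps)
  finally show ?thesis unfolding h by (simp only: h_def)
qed

text \<open>The level 1 factor exp (a_1 |\<beta>|^2 n) / N_1 of the level difference cancels against
  the squared scale and leaves exp (2 a_1 (Im t)^2), independent of \<open>n\<close>.\<close>

lemma fluct_term_second_moment:
  assumes n: "n > 0" and m: "m < d" and R: "norm t \<le> R"
  shows "integrable M (\<lambda>\<omega>. (norm (fluct_term m \<beta>s t \<omega>))\<^sup>2)"
    and "expectation (\<lambda>\<omega>. (norm (fluct_term m \<beta>s t \<omega>))\<^sup>2) \<le> fluct_bound a N n m \<beta>s R"
proof -
  let ?\<beta> = "\<beta>s + t / of_real (sqrt n)"
  have R0: "R \<ge> 0" using R norm_ge_zero order_trans by blast
  have m': "Suc m \<le> d" using m by simp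
  have a1: "a 1 > 0" and N1: "N n 1 > 0" using a_pos[of 1] N_pos[of 1] m by auto
  have sc: "(scale j)\<^sup>2 = a j * n" if "j \<in> {1..d}" for j
    using a_pos[OF that] by (simp add: scale_def mult.commute)
  have eq: "(norm (fluct_term m \<beta>s t \<omega>))\<^sup>2 = (norm (fluct_scale \<beta>s t))\<^sup>2 * (norm (level_diff m ?\<beta> \<omega>))\<^sup>2" for \<omega>
    by (simp add: fluct_term_def norm_mult power_mult_distrib)
  show "integrable M (\<lambda>\<omega>. (norm (fluct_term m \<beta>s t \<omega>))\<^sup>2)"
    unfolding eq by (intro integrable_mult_right level_diff_second_moment m')
  let ?f = "\<lambda>j. exp ((norm ?\<beta>)\<^sup>2 * (scale j)\<^sup>2) / real (N n j)"
  have "expectation (\<lambda>\<omega>. (norm (fluct_term m \<beta>s t \<omega>))\<^sup>2) \<le> (norm (fluct_scale \<beta>s t))\<^sup>2 * (\<Prod>j=1..Suc m. ?f j)"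
    unfolding eq integral_mult_right_zero by (intro mult_left_mono level_diff_second_moment m') simp
  also have "(\<Prod>j=1..Suc m. ?f j) = ?f 1 * (\<Prod>j=2..Suc m. ?f j)"
    by (subst prod.atLeast_Suc_atMost) (simp_all add: numeral_2_eq_2)
  also have "(norm (fluct_scale \<beta>s t))\<^sup>2 * (?f 1 * (\<Prod>j=2..Suc m. ?f j)) = exp (2 * a 1 * (Im t)\<^sup>2) * (\<Prod>j=2..Suc m. ?f j)"
  proof -
    have "(norm (fluct_scale \<beta>s t))\<^sup>2 * ?f 1 = exp (a 1 * (2 * (Im t)\<^sup>2 - (norm ?\<beta>)\<^sup>2 * n)) * exp ((norm ?\<beta>)\<^sup>2 * (a 1 * n))"
      using N1 sc[of 1] m by (simp add: norm_fluct_scale[OF n])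
    also have "\<dots> = exp (2 * a 1 * (Im t)\<^sup>2)" by (simp add: exp_add[symmetric] algebra_simps)
    finally show ?thesis by (simp only: mult.assoc[symmetric])
  qed
  also have "\<dots> \<le> fluct_bound a N n m \<beta>s R"
    unfolding fluct_bound_def
  proof (intro mult_mono prod_mono conjI)
    have "\<bar>Im t\<bar> \<le> R" using abs_Im_le_cmod[of t] R by linarith
    hence "(Im t)\<^sup>2 \<le> R\<^sup>2" by (metis abs_le_square_iff abs_of_nonneg R0)
    thus "exp (2 * a 1 * (Im t)\<^sup>2) \<le> exp (2 * a 1 * R\<^sup>2)" using a1 by simp
    fix j assume j: "j \<in> {2..Suc m}"
    hence jd: "j \<in> {1..d}" using m by auto
    have "norm ?\<beta> * sqrt n \<le> norm \<beta>s * sqrt n + R"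
    proof -
      have "norm ?\<beta> \<le> norm \<beta>s + norm (t / of_real (sqrt n))" by (rule norm_triangle_ineq)
      hence "norm ?\<beta> * sqrt n \<le> (norm \<beta>s + norm t / sqrt n) * sqrt n"
        by (intro mult_right_mono) (simp_all add: norm_divide)
      also have "\<dots> = norm \<beta>s * sqrt n + norm t" using n by (simp add: algebra_simps)
      finally show ?thesis using R by simp
    qed
    hence "(norm ?\<beta> * sqrt n)\<^sup>2 \<le> (norm \<beta>s * sqrt n + R)\<^sup>2" by (intro power_mono) auto
    hence "(norm ?\<beta>)\<^sup>2 * (scale j)\<^sup>2 \<le> a j * (norm \<beta>s * sqrt n + R)\<^sup>2"
      using a_pos[OF jd] unfolding sc[OF jd] by (simp add: power_mult_distrib mult.left_commute)
    thus "?f j \<le> exp (a j * (norm \<beta>s * sqrt n + R)\<^sup>2) / N n j" by (intro divide_right_mono) auto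
  qed (auto intro!: prod_nonneg simp del: prod.cl_ivl_Suc)
  finally show "expectation (\<lambda>\<omega>. (norm (fluct_term m \<beta>s t \<omega>))\<^sup>2) \<le> fluct_bound a N n m \<beta>s R" .
qed

lemma fluct_term_measurable: "m < d \<Longrightarrow> fluct_term m \<beta>s t \<in> borel_measurable M"
  unfolding fluct_term_def[abs_def]
  using level_diff_mean[of m "\<beta>s + t / of_real (sqrt n)"]
  by (intro borel_measurable_times borel_measurable_const) (auto simp: has_bochner_integral_iff dest: borel_measurable_integrable)

lemma fluct_term_moment:
  assumes "n > 0" "m < d" "norm t \<le> R"
  shows "integrable M (fluct_term m \<beta>s t)"
    and "expectation (\<lambda>\<omega>. norm (fluct_term m \<beta>s t \<omega>)) \<le> sqrt (fluct_bound a N n m \<beta>s R)"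
proof -
  note * = expectation_le_sqrt_second_moment[OF fluct_term_measurable[OF assms(2)] fluct_term_second_moment(1)[OF assms]]
  show "integrable M (fluct_term m \<beta>s t)" by (rule *(1))
  show "expectation (\<lambda>\<omega>. norm (fluct_term m \<beta>s t \<omega>)) \<le> sqrt (fluct_bound a N n m \<beta>s R)"
    by (rule order_trans[OF *(2) real_sqrt_le_mono[OF fluct_term_second_moment(2)[OF assms]]])
qed

lemma fluct_moment:
  assumes n: "n > 0" and d: "d \<ge> 1" and R: "norm t \<le> R"
  shows "(\<integral>\<^sup>+\<omega>. norm (fluct d a N n M \<xi> \<beta>s \<omega> t) \<partial>M) \<le> ennreal (\<Sum>m<d. sqrt (fluct_bound a N n m \<beta>s R))"
proof -
  have int: "integrable M (\<lambda>\<omega>. \<Sum>m<d. norm (fluct_term m \<beta>s t \<omega>))"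
    using fluct_term_moment(1)[OF n _ R] by (intro Bochner_Integration.integrable_sum integrable_norm) auto
  have "(\<integral>\<^sup>+\<omega>. norm (fluct d a N n M \<xi> \<beta>s \<omega> t) \<partial>M) \<le> (\<integral>\<^sup>+\<omega>. ennreal (\<Sum>m<d. norm (fluct_term m \<beta>s t \<omega>)) \<partial>M)"
    unfolding fluct_eq[OF d] by (intro nn_integral_mono ennreal_leI norm_sum)
  also have "\<dots> = ennreal (expectation (\<lambda>\<omega>. \<Sum>m<d. norm (fluct_term m \<beta>s t \<omega>)))"
    by (intro nn_integral_eq_integral int) (auto intro!: sum_nonneg)
  also have "\<dots> \<le> ennreal (\<Sum>m<d. sqrt (fluct_bound a N n m \<beta>s R))"
    using fluct_term_moment[OF n _ R]
    by (subst Bochner_Integration.integral_sum) (auto intro!: ennreal_leI sum_mono)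
  finally show ?thesis .
qed

text \<open>Identifies the leading term with a centred and normalized tilted sum, for b = sqrt (a_1
  n) and s t = sqrt a_1 * t, in the form the central limit theorem expects.\<close>

lemma fluct_term_0:
  assumes n: "n > 0" and d: "d \<ge> 1"
  shows "(\<Sum>t\<in>I. lam t * fluct_term 0 \<beta>s t \<omega>) =
    (\<Sum>e=1..N n 1. tilt_sum I lam (\<lambda>t. of_real (sqrt (a 1)) * t) \<beta>s (sqrt (n * a 1)) (\<xi> [e] \<omega>)
       - (\<integral>x. tilt_sum I lam (\<lambda>t. of_real (sqrt (a 1)) * t) \<beta>s (sqrt (n * a 1)) x \<partial>std_normal_distribution)) / sqrt (N n 1)"
proof -
  let ?b = "complex_of_real (sqrt (n * a 1))" and ?s = "\<lambda>t. complex_of_real (sqrt (a 1)) * t"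
  have a1: "a 1 > 0" and N1: "N n 1 > 0" using a_pos[of 1] N_pos[of 1] d by auto
  have N1': "of_nat (N n 1) = complex_of_real (sqrt (N n 1)) * of_real (sqrt (N n 1))"
    by (simp flip: of_real_mult)
  have bs: "(x + t / of_real (sqrt n)) * ?b = x * ?b + ?s t" for t x :: complex
    using n by (simp add: real_sqrt_mult field_simps)
  have b2: "?b\<^sup>2 = of_real (a 1) * of_nat n"
    using a1 by (simp flip: of_real_power)
  have sq: "of_real (a 1) * (x + t / of_real (sqrt n))\<^sup>2 * of_nat n = (x * ?b + ?s t)\<^sup>2" for x t :: complex
    unfolding bs[symmetric] power_mult_distrib b2 by simp
  \<comment> \<open>The mean of one tilted exponential. Multiplying a mean-one exponential by it
    undoes the centring exponent, and the 1 subtracted in the level difference becomes the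
    subtracted mean.\<close>
  define E where "E t = exp ((\<beta>s * ?b + ?s t)\<^sup>2 / 2 - (of_real (Re \<beta>s * sqrt (n * a 1)) + ?s t)\<^sup>2)" for t
  have fs: "fluct_scale \<beta>s t = of_real (sqrt (N n 1)) * E t" for t
    unfolding fluct_scale_def sq E_def of_real_mult ..
  have em: "E t * exp_mart (\<beta>s + t / of_real (sqrt n)) (scale 1) x =
      exp ((\<beta>s * ?b + ?s t) * of_real x - (of_real (Re \<beta>s * sqrt (n * a 1)) + ?s t)\<^sup>2)" for t x
    unfolding E_def exp_mart_def exp_add[symmetric] scale_def bs power_mult_distrib[symmetric] by (simp add: algebra_simps)
  have int: "(\<integral>x. tilt_sum I lam ?s \<beta>s (sqrt (n * a 1)) x \<partial>std_normal_distribution) = (\<Sum>t\<in>I. lam t * E t)"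
    using has_bochner_integral_tilt_sum[of I lam ?s \<beta>s "sqrt (n * a 1)"]
    by (simp add: has_bochner_integral_iff E_def)
  have "lam t * fluct_term 0 \<beta>s t \<omega> = (\<Sum>e=1..N n 1. lam t * (E t * exp_mart (\<beta>s + t / of_real (sqrt n)) (scale 1) (\<xi> [e] \<omega>)) - lam t * E t) / sqrt (N n 1)" for t
    unfolding fluct_term_def level_diff_0 fs N1' using N1
    by (simp add: sum_distrib_left sum_divide_distrib[symmetric] field_simps sum_subtractf)
  hence "(\<Sum>t\<in>I. lam t * fluct_term 0 \<beta>s t \<omega>) =
     (\<Sum>e=1..N n 1. (\<Sum>t\<in>I. lam t * (E t * exp_mart (\<beta>s + t / of_real (sqrt n)) (scale 1) (\<xi> [e] \<omega>))) - (\<Sum>t\<in>I. lam t * E t)) / sqrt (N n 1)"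
    by (simp add: sum_divide_distrib[symmetric] sum_subtractf[symmetric] sum.swap[of _ I])
  thus ?thesis unfolding int em unfolding tilt_sum_def by simp
qed

text \<open>The map \<open>cis\<close> is 1-Lipschitz, so discarding the terms m \<ge> 1 costs at
  most their first absolute moments.\<close>

lemma fluct_char_approx:
  assumes n: "n > 0" and d: "d \<ge> 1" and I: "finite I"
  shows "norm (expectation (\<lambda>\<omega>. cis (lin I lam (fluct d a N n M \<xi> \<beta>s \<omega>)))
      - expectation (\<lambda>\<omega>. cis (Re (\<Sum>t\<in>I. lam t * fluct_term 0 \<beta>s t \<omega>))))
     \<le> (\<Sum>t\<in>I. norm (lam t) * (\<Sum>m=1..<d. sqrt (fluct_bound a N n m \<beta>s (norm t))))"
proof -
  let ?x = "\<lambda>\<omega>. lin I lam (fluct d a N n M \<xi> \<beta>s \<omega>)" and ?y = "\<lambda>\<omega>. Re (\<Sum>t\<in>I. lam t * fluct_term 0 \<beta>s t \<omega>)"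
  have [measurable]: "fluct_term m \<beta>s t \<in> borel_measurable M" if "m < d" for m t
    by (rule fluct_term_measurable[OF that])
  have mx[measurable]: "?x \<in> borel_measurable M"
    unfolding lin_def fluct_eq[OF d] by measurable
  have my[measurable]: "?y \<in> borel_measurable M"
  proof -
    have "0 < d" using d by simp
    note [measurable] = fluct_term_measurable[OF this]
    show ?thesis by measurable
  qed
  have int: "integrable M (\<lambda>\<omega>. \<Sum>t\<in>I. norm (lam t) * (\<Sum>m=1..<d. norm (fluct_term m \<beta>s t \<omega>)))"
    using fluct_term_moment(1)[OF n _ order_refl]
    by (intro Bochner_Integration.integrable_sum integrable_mult_right integrable_norm) auto
  have "integrable M (\<lambda>\<omega>. cis (f \<omega>))" if [measurable]: "f \<in> borel_measurable M" for f
    unfolding cis_conv_exp by (rule integrable_const_bound[of _ 1]) auto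
  note ix = this[OF mx] and iy = this[OF my]
  have "norm (expectation (\<lambda>\<omega>. cis (?x \<omega>)) - expectation (\<lambda>\<omega>. cis (?y \<omega>))) = norm (expectation (\<lambda>\<omega>. cis (?x \<omega>) - cis (?y \<omega>)))"
    by (subst Bochner_Integration.integral_diff[OF ix iy]) simp
  also have "\<dots> \<le> expectation (\<lambda>\<omega>. norm (cis (?x \<omega>) - cis (?y \<omega>)))"
    by (rule integral_norm_bound)
  also have "\<dots> \<le> expectation (\<lambda>\<omega>. \<Sum>t\<in>I. norm (lam t) * (\<Sum>m=1..<d. norm (fluct_term m \<beta>s t \<omega>)))"
  proof (rule integral_mono[OF integrable_norm[OF Bochner_Integration.integrable_diff[OF ix iy]] int])
    fix \<omega>
    have split: "fluct d a N n M \<xi> \<beta>s \<omega> t = fluct_term 0 \<beta>s t \<omega> + (\<Sum>m=1..<d. fluct_term m \<beta>s t \<omega>)" for t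
      unfolding fluct_eq[OF d] using d by (subst lessThan_atLeast0, subst sum.atLeast_Suc_lessThan) auto
    have eq: "?x \<omega> - ?y \<omega> = Re (\<Sum>t\<in>I. lam t * (\<Sum>m=1..<d. fluct_term m \<beta>s t \<omega>))"
      unfolding lin_def split by (simp add: distrib_left sum.distrib)
    have "norm (cis (?x \<omega>) - cis (?y \<omega>)) \<le> \<bar>Re (\<Sum>t\<in>I. lam t * (\<Sum>m=1..<d. fluct_term m \<beta>s t \<omega>))\<bar>"
      unfolding eq[symmetric] by (rule norm_cis_diff_le)
    also have "\<dots> \<le> norm (\<Sum>t\<in>I. lam t * (\<Sum>m=1..<d. fluct_term m \<beta>s t \<omega>))" by (rule abs_Re_le_cmod)
    also have "\<dots> \<le> (\<Sum>t\<in>I. norm (lam t) * (\<Sum>m=1..<d. norm (fluct_term m \<beta>s t \<omega>)))"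
      by (intro sum_norm_le) (simp add: norm_mult mult_left_mono norm_sum)
    finally show "norm (cis (?x \<omega>) - cis (?y \<omega>)) \<le> (\<Sum>t\<in>I. norm (lam t) * (\<Sum>m=1..<d. norm (fluct_term m \<beta>s t \<omega>)))" .
  qed
  also have "\<dots> = (\<Sum>t\<in>I. norm (lam t) * (\<Sum>m=1..<d. expectation (\<lambda>\<omega>. norm (fluct_term m \<beta>s t \<omega>))))"
    using fluct_term_moment(1)[OF n _ order_refl]
    by (subst Bochner_Integration.integral_sum)
       (auto intro!: sum.cong Bochner_Integration.integral_sum integrable_mult_right Bochner_Integration.integrable_sum integrable_norm)
  also have "\<dots> \<le> (\<Sum>t\<in>I. norm (lam t) * (\<Sum>m=1..<d. sqrt (fluct_bound a N n m \<beta>s (norm t))))"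
    using fluct_term_moment(2)[OF n _ order_refl] by (intro sum_mono mult_left_mono) auto
  finally show ?thesis .
qed

lemma fluct_char_tilt:
  assumes n: "n > 0" and d: "d \<ge> 1" and I: "finite I"
  shows "norm (expectation (\<lambda>\<omega>. cis (lin I lam (fluct d a N n M \<xi> \<beta>s \<omega>)))
      - expectation (\<lambda>\<omega>. cis (Re ((\<Sum>v\<in>grem_words N n 1.
          tilt_sum I lam (\<lambda>t. of_real (sqrt (a 1)) * t) \<beta>s (sqrt (n * a 1)) (\<xi> v \<omega>)
       - (\<integral>x. tilt_sum I lam (\<lambda>t. of_real (sqrt (a 1)) * t) \<beta>s (sqrt (n * a 1)) x \<partial>std_normal_distribution))
          / sqrt (card (grem_words N n 1))))))
     \<le> (\<Sum>t\<in>I. norm (lam t) * (\<Sum>m=1..<d. sqrt (fluct_bound a N n m \<beta>s (norm t))))"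
proof -
  have "(\<Sum>v\<in>grem_words N n 1. f v) = (\<Sum>e=1..N n 1. f [e])" for f :: "nat list \<Rightarrow> complex"
    using sum_grem_words_Suc[of f N n 0] by (simp add: grem_words_0)
  moreover have "card (grem_words N n 1) = N n 1" by (simp add: card_grem_words)
  ultimately show ?thesis
    using fluct_char_approx[OF n d I, of lam \<beta>s] unfolding fluct_term_0[OF n d] by (simp only:)
qed

lemma grem_Z_measurable: "(\<lambda>\<omega>. grem_Z d a N \<xi> n \<beta> \<omega>) \<in> borel_measurable M"
proof -
  have [measurable]: "(\<lambda>\<omega>. grem_X d a \<xi> \<epsilon> \<omega>) \<in> borel_measurable M" if "\<epsilon> \<in> grem_words N n d" for \<epsilon>
    unfolding grem_X_def using take_in_nodes[OF that _ order_refl]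
    by (intro borel_measurable_sum borel_measurable_times borel_measurable_const \<xi>_measurable) auto
  show ?thesis unfolding grem_Z_def by measurable
qed

lemma fluct_measurable: "(\<lambda>\<omega>. fluct d a N n M \<xi> \<beta>s \<omega> t) \<in> borel_measurable M"
  unfolding fluct_def using grem_Z_measurable by measurable

text \<open>The expectation is replaced by its closed form, so that no differentiation under the
  integral occurs; a finite sum of exponentials over a nowhere vanishing entire function
  remains.\<close>

lemma fluct_entire:
  assumes d: "d \<ge> 1"
  shows "fluct d a N n M \<xi> \<beta>s \<omega> \<in> entire_functions"
proof -
  have N1: "complex_of_real (sqrt (N n 1)) \<noteq> 0" using N_pos[of 1] d by simp
  have h: "(\<lambda>t. t / complex_of_real (sqrt n)) holomorphic_on UNIV"
    unfolding divide_inverse by (intro holomorphic_intros)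
  have "(\<lambda>t. fluct d a N n M \<xi> \<beta>s \<omega> t) holomorphic_on UNIV"
    unfolding fluct_def grem_Z_mean unfolding grem_Z_def grem_c_def
    using N1 by (intro holomorphic_intros h) auto
  thus ?thesis by (simp add: entire_functions_def)
qed

end

section \<open>The plane Gaussian analytic function\<close>

lemma summable_power_div_sqrt_fact: "summable (\<lambda>k. (R::real) ^ k / sqrt (fact k))"
proof -
  \<comment> \<open>Makes the ratio |R| / sqrt (n + 1) of consecutive terms at most 1/2.\<close>
  obtain N :: nat where N: "4 * R\<^sup>2 \<le> real N" using real_arch_simple by blast
  show ?thesis
  proof (rule summable_ratio_test[of "1 / 2" N])
    fix n assume n: "n \<ge> N"
    have "4 * R\<^sup>2 \<le> real (Suc n)" using N n by simp
    hence "sqrt (4 * R\<^sup>2) \<le> sqrt (real (Suc n))" by (rule real_sqrt_le_mono)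
    hence "2 * \<bar>R\<bar> \<le> sqrt (real (Suc n))" by (simp add: real_sqrt_mult)
    hence *: "\<bar>R\<bar> / sqrt (real (Suc n)) \<le> 1 / 2" by (simp add: divide_le_eq del: of_nat_Suc)
    have "norm (R ^ Suc n / sqrt (fact (Suc n))) = \<bar>R\<bar> / sqrt (real (Suc n)) * norm (R ^ n / sqrt (fact n))"
      by (simp add: abs_mult real_sqrt_mult del: of_nat_Suc)
    also have "\<dots> \<le> 1 / 2 * norm (R ^ n / sqrt (fact n))" by (intro mult_right_mono *) simp
    finally show "norm (R ^ Suc n / sqrt (fact (Suc n))) \<le> 1 / 2 * norm (R ^ n / sqrt (fact n))" .
  qed simp
qed

lemma char_normal_density:
  assumes "\<sigma> > 0"
  shows "char (density lborel (normal_density 0 \<sigma>)) u = exp (- (\<sigma>\<^sup>2 * u\<^sup>2) / 2)"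
proof -
  have "char (density lborel (normal_density 0 \<sigma>)) u = (\<integral>x. normal_density 0 \<sigma> x *\<^sub>R iexp (u * x) \<partial>lborel)"
    unfolding char_def by (rule integral_density) auto
  also have "\<dots> = \<sigma> *\<^sub>R (\<integral>x. normal_density 0 \<sigma> (\<sigma> * x) *\<^sub>R iexp (u * (\<sigma> * x)) \<partial>lborel)"
    using lborel_integral_real_affine[of \<sigma> "\<lambda>x. normal_density 0 \<sigma> x *\<^sub>R iexp (u * x)" 0] assms by simp
  also have "\<dots> = \<sigma> *\<^sub>R (\<integral>x. (std_normal_density x / \<sigma>) *\<^sub>R iexp (u * (\<sigma> * x)) \<partial>lborel)"
  proof -
    have "normal_density 0 \<sigma> (\<sigma> * x) = std_normal_density x / \<sigma>" for x
      using assms by (simp add: normal_density_def real_sqrt_mult power_mult_distrib)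
    thus ?thesis by (simp only:)
  qed
  also have "\<dots> =
      (\<integral>x. \<sigma> *\<^sub>R (std_normal_density x / \<sigma>) *\<^sub>R iexp (u * (\<sigma> * x)) \<partial>lborel)"
    by (rule integral_scaleR_right[symmetric])
  also have "\<dots> = (\<integral>x. std_normal_density x *\<^sub>R iexp ((u * \<sigma>) * x) \<partial>lborel)"
    using assms by (intro Bochner_Integration.integral_cong) (auto simp: mult_ac)
  also have "\<dots> = char std_normal_distribution (u * \<sigma>)"
    unfolding char_def by (rule integral_density[symmetric]) auto
  also have "\<dots> = exp (- (\<sigma>\<^sup>2 * u\<^sup>2) / 2)"
    by (simp add: char_std_normal_distribution power_mult_distrib mult.commute)
  finally show ?thesis .
qed

definition half_normal :: "real measure" where
  "half_normal = density lborel (normal_density 0 (sqrt (1/2)))"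

lemma prob_space_half_normal: "prob_space half_normal"
  unfolding half_normal_def by (rule prob_space_normal_density) simp

lemma sets_half_normal [measurable_cong, simp]: "sets half_normal = sets borel" "space half_normal = UNIV"
  by (auto simp: half_normal_def)

lemma std_complex_normal_eq: "std_complex_normal = distr (half_normal \<Otimes>\<^sub>M half_normal) borel (\<lambda>(x, y). Complex x y)"
  by (simp add: std_complex_normal_def half_normal_def)

lemma measurable_Complex [measurable]: "(\<lambda>(x, y). Complex x y) \<in> borel_measurable (half_normal \<Otimes>\<^sub>M half_normal)"
proof -
  have "(\<lambda>p. of_real (fst p) + \<i> * of_real (snd p)) \<in> borel_measurable (half_normal \<Otimes>\<^sub>M half_normal)" by measurable
  thus ?thesis by (simp add: Complex_eq case_prod_beta')
qed

text \<open>Re (\<kappa> * z) is a combination of the two independent coordinates, each of variance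
  1/2, so its variance is |\<kappa>|^2 / 2.\<close>

lemma std_complex_normal_char:
  "(\<integral>z. cis (Re (\<kappa> * z)) \<partial>std_complex_normal) = exp (- (norm \<kappa>)\<^sup>2 / 4)"
proof -
  interpret H: prob_space half_normal by (rule prob_space_half_normal)
  interpret HH: pair_prob_space half_normal half_normal ..
  have i1: "iexp (Re \<kappa> * x) * iexp (- Im \<kappa> * y) = cis (Re (\<kappa> * Complex x y))" for x y
    unfolding cis_conv_exp[symmetric] cis_mult by simp
  have int: "integrable (half_normal \<Otimes>\<^sub>M half_normal) (\<lambda>p. iexp (Re \<kappa> * fst p) * iexp (- Im \<kappa> * snd p))"
    by (rule HH.integrable_const_bound[of _ 1]) (auto simp: norm_mult)
  have "(\<integral>z. cis (Re (\<kappa> * z)) \<partial>std_complex_normal) =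
        (\<integral>p. cis (Re (\<kappa> * Complex (fst p) (snd p))) \<partial>(half_normal \<Otimes>\<^sub>M half_normal))"
    unfolding std_complex_normal_eq
    by (subst integral_distr) (auto simp: case_prod_beta' cis_conv_exp)
  also have "\<dots> = (\<integral>p. iexp (Re \<kappa> * fst p) * iexp (- Im \<kappa> * snd p) \<partial>(half_normal \<Otimes>\<^sub>M half_normal))"
    by (simp only: i1)
  also have "\<dots> = (\<integral>x. (\<integral>y. iexp (Re \<kappa> * x) * iexp (- Im \<kappa> * y) \<partial>half_normal) \<partial>half_normal)"
    using HH.integral_fst'[OF int] by simp
  also have "\<dots> = char half_normal (Re \<kappa>) * char half_normal (- Im \<kappa>)"
    unfolding char_def by simp
  also have "\<dots> = exp (- (norm \<kappa>)\<^sup>2 / 4)"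
    unfolding half_normal_def 
    by (simp add: char_normal_density cmod_power2 exp_add[symmetric] real_sqrt_divide power_divide field_simps
        flip: of_real_mult)
  finally show ?thesis .
qed

lemma std_complex_normal_norm_finite: "(\<integral>\<^sup>+z. ennreal (norm z) \<partial>std_complex_normal) < \<infinity>"
proof -
  interpret H: prob_space half_normal by (rule prob_space_half_normal)
  have "integrable lborel (\<lambda>x. normal_density 0 (sqrt (1/2)) x * \<bar>x\<bar>)"
    using integrable_normal_moment_abs[of "sqrt (1/2)" 0 1] by simp
  hence "integrable half_normal (\<lambda>x. \<bar>x\<bar>)"
    unfolding half_normal_def by (subst integrable_density) simp_all
  hence fin: "(\<integral>\<^sup>+x. ennreal \<bar>x\<bar> \<partial>half_normal) < \<infinity>" by (simp add: integrable_iff_bounded)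
  have "(\<integral>\<^sup>+z. ennreal (norm z) \<partial>std_complex_normal) =
        (\<integral>\<^sup>+x. \<integral>\<^sup>+y. ennreal (norm (Complex x y)) \<partial>half_normal \<partial>half_normal)"
    unfolding std_complex_normal_eq
    by (subst nn_integral_distr, measurable) (subst H.nn_integral_fst[symmetric], auto simp: case_prod_beta')
  also have "\<dots> \<le> (\<integral>\<^sup>+x. \<integral>\<^sup>+y. ennreal \<bar>x\<bar> + ennreal \<bar>y\<bar> \<partial>half_normal \<partial>half_normal)"
  proof (intro nn_integral_mono)
    fix x y
    show "ennreal (norm (Complex x y)) \<le> ennreal \<bar>x\<bar> + ennreal \<bar>y\<bar>"
      using cmod_le[of "Complex x y"] by (simp add: ennreal_plus[symmetric] ennreal_leI del: ennreal_plus)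
  qed
  also have "\<dots> = (\<integral>\<^sup>+x. ennreal \<bar>x\<bar> \<partial>half_normal) + (\<integral>\<^sup>+y. ennreal \<bar>y\<bar> \<partial>half_normal)"
    by (simp add: nn_integral_add H.emeasure_space_1[simplified])
  also have "\<dots> < \<infinity>" using fin by simp
  finally show ?thesis .
qed

section \<open>Convergence, moments and characteristic function of the random series\<close>

locale gaf_setup = prob_space P for P :: "'b measure" +
  fixes \<zeta> :: "nat \<Rightarrow> 'b \<Rightarrow> complex"
  assumes indep: "indep_vars (\<lambda>_. borel) \<zeta> UNIV"
    and law: "\<And>k. distr P borel (\<zeta> k) = std_complex_normal"
begin

lemma \<zeta>_measurable [measurable]: "\<zeta> k \<in> borel_measurable P"
  using indep by (auto simp: indep_vars_def)

lemma \<zeta>_norm: "(\<integral>\<^sup>+\<omega>. norm (\<zeta> k \<omega>) \<partial>P) = (\<integral>\<^sup>+z. ennreal (norm z) \<partial>std_complex_normal)"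
  by (subst law[of k, symmetric], subst nn_integral_distr) auto

text \<open>The majorant of the series on the disc of radius \<open>R\<close>, valued in
  \<open>ennreal\<close> so that it can be integrated before its finiteness is known. A finite mean
  yields both almost sure convergence and the moment bounds.\<close>

definition series_norm :: "real \<Rightarrow> 'b \<Rightarrow> ennreal" where
  "series_norm R \<omega> = (\<Sum>k. ennreal (norm (\<zeta> k \<omega>) * (R ^ k / sqrt (fact k))))"

lemma series_norm_measurable [measurable]: "series_norm R \<in> borel_measurable P"
  unfolding series_norm_def[abs_def] by measurable

lemma series_norm_finite:
  assumes "R \<ge> 0"
  shows "(\<integral>\<^sup>+\<omega>. series_norm R \<omega> \<partial>P) < \<infinity>"
proof -
  let ?c = "\<integral>\<^sup>+z. ennreal (norm z) \<partial>std_complex_normal"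
  have "(\<integral>\<^sup>+\<omega>. series_norm R \<omega> \<partial>P) = (\<Sum>k. \<integral>\<^sup>+\<omega>. ennreal (norm (\<zeta> k \<omega>) * (R ^ k / sqrt (fact k))) \<partial>P)"
    unfolding series_norm_def by (rule nn_integral_suminf) measurable
  also have "\<dots> = (\<Sum>k. ?c * ennreal (R ^ k / sqrt (fact k)))"
  proof (rule suminf_cong)
    fix k
    have "(\<integral>\<^sup>+\<omega>. ennreal (norm (\<zeta> k \<omega>) * (R ^ k / sqrt (fact k))) \<partial>P) =
          (\<integral>\<^sup>+\<omega>. ennreal (norm (\<zeta> k \<omega>)) * ennreal (R ^ k / sqrt (fact k)) \<partial>P)"
      using assms by (intro nn_integral_cong ennreal_mult) auto
    also have "\<dots> = ?c * ennreal (R ^ k / sqrt (fact k))"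
      by (subst nn_integral_multc) (simp_all only: \<zeta>_norm, measurable)
    finally show "(\<integral>\<^sup>+\<omega>. ennreal (norm (\<zeta> k \<omega>) * (R ^ k / sqrt (fact k))) \<partial>P) = ?c * ennreal (R ^ k / sqrt (fact k))" .
  qed
  also have "\<dots> = ?c * ennreal (\<Sum>k. R ^ k / sqrt (fact k))"
    using assms by (simp add: suminf_ennreal2 summable_power_div_sqrt_fact)
  also have "\<dots> < \<infinity>" using std_complex_normal_norm_finite by (simp add: ennreal_mult_less_top)
  finally show ?thesis .
qed

lemma norm_term_le:
  assumes "norm s \<le> R"
  shows "norm (\<zeta> k \<omega> * s ^ k / of_real (sqrt (fact k))) \<le> norm (\<zeta> k \<omega>) * (R ^ k / sqrt (fact k))"
proof -
  have "norm s ^ k \<le> R ^ k" using assms by (intro power_mono) auto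
  hence "norm (\<zeta> k \<omega>) * norm s ^ k / sqrt (fact k) \<le> norm (\<zeta> k \<omega>) * R ^ k / sqrt (fact k)"
    by (intro divide_right_mono mult_left_mono) auto
  thus ?thesis by (simp add: norm_mult norm_divide norm_power)
qed

lemma summable_of_series_norm:
  assumes "series_norm R \<omega> \<noteq> \<infinity>" "norm s \<le> R"
  shows "summable (\<lambda>k. norm (\<zeta> k \<omega> * s ^ k / of_real (sqrt (fact k))))"
    and "ennreal (norm (\<Sum>k. \<zeta> k \<omega> * s ^ k / of_real (sqrt (fact k)))) \<le> series_norm R \<omega>"
proof -
  have R: "R \<ge> 0" using assms(2) norm_ge_zero order_trans by blast
  have s: "summable (\<lambda>k. norm (\<zeta> k \<omega>) * (R ^ k / sqrt (fact k)))"
    using assms(1) R unfolding series_norm_def by (intro summable_suminf_not_top) auto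
  show "summable (\<lambda>k. norm (\<zeta> k \<omega> * s ^ k / of_real (sqrt (fact k))))"
    by (rule summable_comparison_test'[OF s, of 0]) (use norm_term_le[OF assms(2)] in auto)
  have "norm (\<Sum>k. \<zeta> k \<omega> * s ^ k / of_real (sqrt (fact k))) \<le> (\<Sum>k. norm (\<zeta> k \<omega>) * (R ^ k / sqrt (fact k)))"
    using norm_term_le[OF assms(2)] s by (rule norm_suminf_le)
  also have "ennreal \<dots> = series_norm R \<omega>"
    unfolding series_norm_def using R s by (intro suminf_ennreal2[symmetric]) auto
  finally show "ennreal (norm (\<Sum>k. \<zeta> k \<omega> * s ^ k / of_real (sqrt (fact k)))) \<le> series_norm R \<omega>"
    by (simp add: ennreal_leI)
qed

definition summable_everywhere :: "'b \<Rightarrow> bool" where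
  "summable_everywhere \<omega> \<longleftrightarrow> (\<forall>s::complex. summable (\<lambda>k. \<zeta> k \<omega> * s ^ k / of_real (sqrt (fact k))))"

lemma AE_summable_everywhere: "AE \<omega> in P. summable_everywhere \<omega>"
proof -
  have "AE \<omega> in P. series_norm (real R) \<omega> \<noteq> \<infinity>" for R :: nat
    by (rule nn_integral_PInf_AE[OF series_norm_measurable]) (use series_norm_finite[of "real R"] in simp)
  hence "AE \<omega> in P. \<forall>R::nat. series_norm (real R) \<omega> \<noteq> \<infinity>" by (simp add: AE_all_countable)
  thus ?thesis
  proof eventually_elim
    case (elim \<omega>)
    show ?case unfolding summable_everywhere_def
    proof
      fix s :: complex
      obtain R :: nat where "norm s \<le> real R" using real_arch_simple by blast
      thus "summable (\<lambda>k. \<zeta> k \<omega> * s ^ k / of_real (sqrt (fact k)))"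
        using summable_norm_cancel[OF summable_of_series_norm(1)] elim by blast
    qed
  qed
qed

text \<open>A power series converges inside the disc given by any convergence point, so countably
  many conditions suffice, which makes the event measurable.\<close>

lemma summable_everywhere_iff: "summable_everywhere \<omega> \<longleftrightarrow> (\<forall>R::nat. summable (\<lambda>k. \<zeta> k \<omega> * of_nat R ^ k / of_real (sqrt (fact k))))"
proof
  assume *: "\<forall>R::nat. summable (\<lambda>k. \<zeta> k \<omega> * of_nat R ^ k / of_real (sqrt (fact k)))"
  show "summable_everywhere \<omega>" unfolding summable_everywhere_def
  proof
    fix s :: complex
    obtain R :: nat where R: "norm s < real R" using reals_Archimedean2 by blast
    have "summable (\<lambda>k. (\<zeta> k \<omega> / of_real (sqrt (fact k))) * s ^ k)"
      by (rule powser_inside[of _ "of_nat R"]) (use * R in auto)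
    thus "summable (\<lambda>k. \<zeta> k \<omega> * s ^ k / of_real (sqrt (fact k)))" by simp
  qed
qed (auto simp: summable_everywhere_def)

lemma summable_everywhere_measurable [measurable]: "Measurable.pred P summable_everywhere"
  unfolding summable_everywhere_iff[abs_def] summable_iff_convergent Cauchy_convergent_iff[symmetric]
  by measurable

lemma plane_GAF_alt:
  "plane_GAF \<zeta> \<omega> t = (if summable_everywhere \<omega> then exp (- (t ^ 2) / 2) * (\<Sum>k. \<zeta> k \<omega> * t ^ k / of_real (sqrt (fact k))) else 0)"
  by (simp add: plane_GAF_def summable_everywhere_def)

lemma plane_GAF_measurable [measurable]: "(\<lambda>\<omega>. plane_GAF \<zeta> \<omega> t) \<in> borel_measurable P"
  unfolding plane_GAF_alt by measurable

lemma plane_GAF_holomorphic: "plane_GAF \<zeta> \<omega> holomorphic_on UNIV"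
proof (cases "summable_everywhere \<omega>")
  case True
  let ?g = "\<lambda>t. \<Sum>k. \<zeta> k \<omega> * t ^ k / of_real (sqrt (fact k))"
  have "?g holomorphic_on ball 0 r" for r
    using True by (intro power_series_holomorphic[of _ _ "\<lambda>k. \<zeta> k \<omega> / of_real (sqrt (fact k))"])
       (auto simp: summable_everywhere_def summable_sums)
  hence "?g field_differentiable at z" for z
    by (rule holomorphic_on_imp_differentiable_at[of _ "ball 0 (norm z + 1)"]) auto
  hence "?g holomorphic_on UNIV" by (auto simp: holomorphic_on_def field_differentiable_at_within)
  hence "(\<lambda>t. exp (- (t ^ 2) / 2) * ?g t) holomorphic_on UNIV" by (intro holomorphic_intros) auto
  thus ?thesis using True by (simp add: plane_GAF_alt[abs_def])
next
  case False
  thus ?thesis by (simp add: plane_GAF_alt[abs_def])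
qed

lemma plane_GAF_moment:
  assumes "R \<ge> 0"
  shows "\<exists>C. \<forall>t. norm t \<le> R \<longrightarrow> (\<integral>\<^sup>+\<omega>. norm (plane_GAF \<zeta> \<omega> t) \<partial>P) \<le> ennreal C"
proof -
  obtain c where c: "(\<integral>\<^sup>+\<omega>. series_norm R \<omega> \<partial>P) = ennreal c" "c \<ge> 0"
    using series_norm_finite[OF assms] by (cases "\<integral>\<^sup>+\<omega>. series_norm R \<omega> \<partial>P") auto
  have "(\<integral>\<^sup>+\<omega>. norm (plane_GAF \<zeta> \<omega> t) \<partial>P) \<le> ennreal (exp (R\<^sup>2 / 2) * c)" if t: "norm t \<le> R" for t
  proof -
    have "norm (exp (- (t\<^sup>2) / 2)) \<le> exp (R\<^sup>2 / 2)"
    proof -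
      have "norm (exp (- (t\<^sup>2) / 2)) \<le> exp (norm (- (t\<^sup>2) / 2))" by (rule norm_exp)
      also have "\<dots> \<le> exp (R\<^sup>2 / 2)" using t by (simp add: norm_divide norm_power power_mono)
      finally show ?thesis .
    qed
    \<comment> \<open>Holds for every realization: where the majorant is infinite the right-hand
      side is infinite too.\<close>
    hence "ennreal (norm (plane_GAF \<zeta> \<omega> t)) \<le> ennreal (exp (R\<^sup>2 / 2)) * series_norm R \<omega>" for \<omega>
      using summable_of_series_norm(2)[OF _ t, of \<omega>]
      by (cases "series_norm R \<omega> = \<infinity>")
         (auto simp: plane_GAF_alt norm_mult ennreal_mult ennreal_mult_top intro!: mult_mono ennreal_leI)
    hence "(\<integral>\<^sup>+\<omega>. norm (plane_GAF \<zeta> \<omega> t) \<partial>P) \<le> (\<integral>\<^sup>+\<omega>. ennreal (exp (R\<^sup>2 / 2)) * series_norm R \<omega> \<partial>P)"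
      by (rule nn_integral_mono)
    also have "\<dots> = ennreal (exp (R\<^sup>2 / 2)) * ennreal c"
      using c(1) by (subst nn_integral_cmult) auto
    also have "\<dots> = ennreal (exp (R\<^sup>2 / 2) * c)" using c(2) by (simp add: ennreal_mult)
    finally show ?thesis .
  qed
  thus ?thesis by blast
qed

text \<open>\<open>\<kappa> k\<close> collects the total coefficient of \<open>\<zeta> k\<close> in
  the linear functional. Partial sums have independent terms, and summing |\<kappa> k|^2 over k
  rebuilds the exponential series of s t * cnj (s u), hence \<open>gaf_var\<close>.\<close>

lemma plane_GAF_char:
  fixes s lam :: "complex \<Rightarrow> complex"
  assumes I: "finite I"
  shows "(\<integral>\<omega>. cis (lin I lam (\<lambda>t. plane_GAF \<zeta> \<omega> (s t))) \<partial>P) = exp (- Re (gaf_var I lam s) / 4)"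
proof -
  define \<kappa> where "\<kappa> k = (\<Sum>t\<in>I. lam t * exp (- (s t)\<^sup>2 / 2) * s t ^ k / of_real (sqrt (fact k)))" for k
  define S where "S m \<omega> = (\<Sum>k<m. Re (\<kappa> k * \<zeta> k \<omega>))" for m \<omega>
  have [measurable]: "S m \<in> borel_measurable P" for m unfolding S_def by measurable
  have lim: "AE \<omega> in P. (\<lambda>m. cis (S m \<omega>)) \<longlonglongrightarrow> cis (lin I lam (\<lambda>t. plane_GAF \<zeta> \<omega> (s t)))"
    using AE_summable_everywhere
  proof eventually_elim
    case (elim \<omega>)
    let ?f = "\<lambda>t m. \<Sum>k<m. \<zeta> k \<omega> * s t ^ k / of_real (sqrt (fact k))"
    have "(\<lambda>m. ?f t m) \<longlonglongrightarrow> (\<Sum>k. \<zeta> k \<omega> * s t ^ k / of_real (sqrt (fact k)))" for t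
      using elim by (intro summable_LIMSEQ) (auto simp: summable_everywhere_def)
    hence "(\<lambda>m. Re (\<Sum>t\<in>I. lam t * (exp (- (s t)\<^sup>2 / 2) * ?f t m))) \<longlonglongrightarrow>
      Re (\<Sum>t\<in>I. lam t * (exp (- (s t)\<^sup>2 / 2) * (\<Sum>k. \<zeta> k \<omega> * s t ^ k / of_real (sqrt (fact k)))))"
      by (intro tendsto_Re tendsto_sum tendsto_mult tendsto_const)
    also have "Re (\<Sum>t\<in>I. lam t * (exp (- (s t)\<^sup>2 / 2) * (\<Sum>k. \<zeta> k \<omega> * s t ^ k / of_real (sqrt (fact k))))) =
      lin I lam (\<lambda>t. plane_GAF \<zeta> \<omega> (s t))"
      using elim by (simp only: lin_def plane_GAF_alt if_True)
    finally have "(\<lambda>m. Re (\<Sum>t\<in>I. lam t * (exp (- (s t)\<^sup>2 / 2) * ?f t m))) \<longlonglongrightarrow> lin I lam (\<lambda>t. plane_GAF \<zeta> \<omega> (s t))" .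
    moreover have "Re (\<Sum>t\<in>I. lam t * (exp (- (s t)\<^sup>2 / 2) * ?f t m)) = S m \<omega>" for m
    proof -
      have "(\<Sum>t\<in>I. lam t * (exp (- (s t)\<^sup>2 / 2) * ?f t m)) = (\<Sum>k<m. \<kappa> k * \<zeta> k \<omega>)"
        unfolding \<kappa>_def sum_distrib_left sum_distrib_right
        by (subst sum.swap) (intro sum.cong refl, simp add: mult_ac)
      thus ?thesis by (simp add: S_def)
    qed
    ultimately have "(\<lambda>m. S m \<omega>) \<longlonglongrightarrow> lin I lam (\<lambda>t. plane_GAF \<zeta> \<omega> (s t))" by simp
    thus ?case unfolding cis_conv_exp by (intro tendsto_intros)
  qed
  have [measurable]: "(\<lambda>\<omega>. lin I lam (\<lambda>t. plane_GAF \<zeta> \<omega> (s t))) \<in> borel_measurable P"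
    unfolding lin_def by measurable
  have "(\<lambda>m. \<integral>\<omega>. cis (S m \<omega>) \<partial>P) \<longlonglongrightarrow> (\<integral>\<omega>. cis (lin I lam (\<lambda>t. plane_GAF \<zeta> \<omega> (s t))) \<partial>P)"
    by (rule integral_dominated_convergence[OF _ _ _ lim, of "\<lambda>_. 1"]) (auto simp: cis_conv_exp)
  moreover have "(\<integral>\<omega>. cis (S m \<omega>) \<partial>P) = exp (- (\<Sum>k<m. (norm (\<kappa> k))\<^sup>2) / 4)" for m
  proof -
    have "(\<integral>\<omega>. cis (S m \<omega>) \<partial>P) = char (distr P borel (\<lambda>\<omega>. \<Sum>k<m. Re (\<kappa> k * \<zeta> k \<omega>))) 1"
      unfolding char_def S_def by (subst integral_distr) (auto simp: cis_conv_exp)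
    also have "\<dots> = (\<Prod>k<m. char (distr P borel (\<lambda>\<omega>. Re (\<kappa> k * \<zeta> k \<omega>))) 1)"
      using indep_vars_compose2[OF indep_vars_subset[OF indep subset_UNIV], of "{..<m}" "\<lambda>k z. Re (\<kappa> k * z)" "\<lambda>_. borel"]
      by (intro char_distr_sum) simp
    also have "\<dots> = (\<Prod>k<m. complex_of_real (exp (- (norm (\<kappa> k))\<^sup>2 / 4)))"
    proof (intro prod.cong refl)
      fix k
      have "char (distr P borel (\<lambda>\<omega>. Re (\<kappa> k * \<zeta> k \<omega>))) 1 = (\<integral>\<omega>. cis (Re (\<kappa> k * \<zeta> k \<omega>)) \<partial>P)"
        unfolding char_def by (subst integral_distr) (auto simp: cis_conv_exp)
      also have "\<dots> = (\<integral>z. cis (Re (\<kappa> k * z)) \<partial>distr P borel (\<zeta> k))"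
        by (subst integral_distr) (auto simp: cis_conv_exp)
      finally show "char (distr P borel (\<lambda>\<omega>. Re (\<kappa> k * \<zeta> k \<omega>))) 1 = complex_of_real (exp (- (norm (\<kappa> k))\<^sup>2 / 4))"
        by (simp only: law std_complex_normal_char)
    qed
    also have "\<dots> = of_real (\<Prod>k<m. exp (- (norm (\<kappa> k))\<^sup>2 / 4))" by simp
    also have "(\<Prod>k<m. exp (- (norm (\<kappa> k))\<^sup>2 / 4)) = exp (- (\<Sum>k<m. (norm (\<kappa> k))\<^sup>2) / 4)"
      by (subst exp_sum[symmetric]) (auto simp: sum_negf sum_divide_distrib)
    finally show ?thesis .
  qed
  moreover have "(\<lambda>m. \<Sum>k<m. (norm (\<kappa> k))\<^sup>2) \<longlonglongrightarrow> Re (gaf_var I lam s)"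
  proof -
    have kk: "of_real ((norm (\<kappa> k))\<^sup>2) = (\<Sum>t\<in>I. \<Sum>u\<in>I. lam t * cnj (lam u) * exp (- (s t)\<^sup>2 / 2) * exp (- (cnj (s u))\<^sup>2 / 2)
           * ((s t * cnj (s u)) ^ k /\<^sub>R fact k))" for k
    proof -
      have "complex_of_real (sqrt (fact k)) * complex_of_real (sqrt (fact k)) = of_real (fact k)"
        unfolding of_real_mult[symmetric] by simp
      hence sq: "z /\<^sub>R fact k = z / (of_real (sqrt (fact k)) * of_real (sqrt (fact k)))" for z :: complex
        by (simp only: scaleR_conv_of_real of_real_inverse divide_inverse mult.commute[of z])
      have "of_real ((norm (\<kappa> k))\<^sup>2) = \<kappa> k * cnj (\<kappa> k)" by (rule complex_norm_square)
      also have "\<dots> = (\<Sum>t\<in>I. \<Sum>u\<in>I. lam t * cnj (lam u) * exp (- (s t)\<^sup>2 / 2) * exp (- (cnj (s u))\<^sup>2 / 2)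
           * ((s t * cnj (s u)) ^ k / (of_real (sqrt (fact k)) * of_real (sqrt (fact k)))))"
        unfolding \<kappa>_def cnj_sum sum_product
        by (intro sum.cong refl) (simp add: exp_cnj power_mult_distrib)
      finally show ?thesis unfolding sq .
    qed
    have "(\<lambda>k. complex_of_real ((norm (\<kappa> k))\<^sup>2)) sums (\<Sum>t\<in>I. \<Sum>u\<in>I. lam t * cnj (lam u) * exp (- (s t)\<^sup>2 / 2) * exp (- (cnj (s u))\<^sup>2 / 2)
           * exp (s t * cnj (s u)))"
      unfolding kk by (intro sums_sum sums_mult exp_converges)
    also have "(\<Sum>t\<in>I. \<Sum>u\<in>I. lam t * cnj (lam u) * exp (- (s t)\<^sup>2 / 2) * exp (- (cnj (s u))\<^sup>2 / 2)
           * exp (s t * cnj (s u))) = gaf_var I lam s"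
      unfolding gaf_var_def
      by (intro sum.cong refl) (simp add: mult.assoc exp_add[symmetric] algebra_simps)
    finally have "(\<lambda>k. Re (complex_of_real ((norm (\<kappa> k))\<^sup>2))) sums Re (gaf_var I lam s)" by (rule sums_Re)
    thus ?thesis by (simp add: sums_def)
  qed
  hence "(\<lambda>m. complex_of_real (exp (- (\<Sum>k<m. (norm (\<kappa> k))\<^sup>2) / 4))) \<longlonglongrightarrow> of_real (exp (- Re (gaf_var I lam s) / 4))"
    by (intro tendsto_intros) auto
  ultimately show ?thesis by (simp add: LIMSEQ_unique)
qed

end

section \<open>The limit theorem\<close>

text \<open>Outside the open disc a point of the strip is a limit of points of F, obtained by moving
  radially outwards; hence it lies in the excluded closure.\<close>

lemma region_E_strip:
  assumes "\<beta> \<in> region_E s" "2 * \<bar>Re \<beta>\<bar> < s" "\<beta> \<noteq> 0"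
  shows "2 * (norm \<beta>)\<^sup>2 < s\<^sup>2"
proof (rule ccontr)
  assume "\<not> ?thesis"
  hence ge: "2 * (norm \<beta>)\<^sup>2 \<ge> s\<^sup>2" by simp
  \<comment> \<open>The dilation strictly increases the norm because \<beta> is nonzero, and the
    open strip condition persists for large \<open>k\<close>.\<close>
  define f where "f k = of_real (1 + inverse (real (Suc k))) * \<beta>" for k
  have "f \<longlonglongrightarrow> of_real (1 + 0) * \<beta>"
    unfolding f_def by (intro tendsto_intros LIMSEQ_inverse_real_of_nat)
  hence f: "f \<longlonglongrightarrow> \<beta>" by simp
  have "(\<lambda>k. 2 * \<bar>Re (f k)\<bar>) \<longlonglongrightarrow> 2 * \<bar>Re \<beta>\<bar>" by (intro tendsto_intros f)
  hence ev: "\<forall>\<^sub>F k in sequentially. 2 * \<bar>Re (f k)\<bar> < s" using assms(2) by (rule order_tendstoD)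
  have big: "2 * (norm (f k))\<^sup>2 > s\<^sup>2" for k
  proof -
    have "norm \<beta> < norm (f k)" using assms(3) by (simp add: f_def norm_mult del: of_real_add of_nat_Suc)
    hence "(norm \<beta>)\<^sup>2 < (norm (f k))\<^sup>2" by (intro power_strict_mono) auto
    thus ?thesis using ge by simp
  qed
  have "\<forall>\<^sub>F k in sequentially. f k \<in> closure (region_G s \<union> region_F s)"
    using ev
  proof eventually_elim
    case (elim k)
    hence "f k \<in> region_F s" using big[of k] by (simp add: region_F_def cmod_power2)
    thus ?case using closure_subset[of "region_G s \<union> region_F s"] by (meson UnI2 subsetD)
  qed
  hence "\<beta> \<in> closure (region_G s \<union> region_F s)"
    by (intro Lim_in_closed_set[OF closed_closure _ _ f]) auto
  thus False using assms(1) by (simp add: region_E_def)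
qed

text \<open>Subcritical growth is beaten by \<alpha>^n. The term of order sqrt n is included because
  \<beta> is perturbed by t / sqrt n; with sqrt n as variable the exponent is a quadratic
  polynomial.\<close>

lemma exp_over_branching_tendsto_0:
  fixes Nn :: "nat \<Rightarrow> nat"
  assumes r: "(\<lambda>n. real (Nn n) / \<alpha> ^ n) \<longlonglongrightarrow> 1" and \<alpha>: "\<alpha> > 1" and c: "c < ln \<alpha>"
  shows "(\<lambda>n. exp (c * real n + k * sqrt (real n) + l) / real (Nn n)) \<longlonglongrightarrow> 0"
proof -
  have "filterlim (\<lambda>n. sqrt (real n)) at_top sequentially"
    by (rule filterlim_compose[OF sqrt_at_top filterlim_real_sequentially])
  from exp_quadratic_tendsto_0[OF _ this, of "of_real (c - ln \<alpha>)" "of_real k" "of_real l"] c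
  have "(\<lambda>n. norm (exp (of_real (c - ln \<alpha>) * of_real (sqrt (real n)) ^ 2 + of_real k * of_real (sqrt (real n)) + complex_of_real l))) \<longlonglongrightarrow> 0"
    by (intro tendsto_norm_zero) simp
  moreover have "norm (exp (of_real (c - ln \<alpha>) * of_real (sqrt (real n)) ^ 2 + of_real k * of_real (sqrt (real n)) + complex_of_real l))
      = exp ((c - ln \<alpha>) * real n + k * sqrt (real n) + l)" for n
    by (simp flip: of_real_power)
  ultimately have 1: "(\<lambda>n. exp ((c - ln \<alpha>) * real n + k * sqrt (real n) + l)) \<longlonglongrightarrow> 0" by simp
  have "(\<lambda>n. inverse (real (Nn n) / \<alpha> ^ n)) \<longlonglongrightarrow> inverse 1" by (intro tendsto_inverse r) simp
  from tendsto_mult[OF 1 this]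
  have "(\<lambda>n. exp ((c - ln \<alpha>) * real n + k * sqrt (real n) + l) * inverse (real (Nn n) / \<alpha> ^ n)) \<longlonglongrightarrow> 0" by simp
  moreover have "exp ((c - ln \<alpha>) * real n + k * sqrt (real n) + l) * inverse (real (Nn n) / \<alpha> ^ n)
     = exp (c * real n + k * sqrt (real n) + l) / real (Nn n)" for n
  proof -
    have "\<alpha> ^ n = exp (real n * ln \<alpha>)" using \<alpha> by (simp add: exp_of_nat_mult)
    moreover have "exp ((c - ln \<alpha>) * real n + k * sqrt (real n) + l) * exp (real n * ln \<alpha>) = exp (c * real n + k * sqrt (real n) + l)"
      unfolding exp_add[symmetric] by (simp add: algebra_simps)
    ultimately show ?thesis by (simp add: field_simps)
  qed
  ultimately show ?thesis by (simp only:)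
qed

lemma branching_at_top:
  fixes Nn :: "nat \<Rightarrow> nat"
  assumes r: "(\<lambda>n. real (Nn n) / \<alpha> ^ n) \<longlonglongrightarrow> 1" and \<alpha>: "\<alpha> > 1"
  shows "filterlim Nn at_top sequentially"
proof -
  have "filterlim (\<lambda>n. \<alpha> ^ n) at_top sequentially" 
    using \<alpha> by (intro filterlim_at_infinity_imp_filterlim_at_top[OF filterlim_realpow_sequentially_gt1]) auto
  from filterlim_tendsto_pos_mult_at_top[OF r _ this]
  have "filterlim (\<lambda>n. real (Nn n) / \<alpha> ^ n * \<alpha> ^ n) at_top sequentially" by simp
  moreover have "real (Nn n) / \<alpha> ^ n * \<alpha> ^ n = real (Nn n)" for n using \<alpha> by simp
  ultimately show ?thesis by (simp add: filterlim_sequentially_iff_filterlim_real)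
qed

text \<open>The product of zeros in the limit equals 1 for \<open>m = 0\<close>, where it is empty,
  and 0 otherwise. One statement thus gives boundedness of the leading term and decay of the
  others.\<close>

lemma fluct_bound_tendsto:
  assumes r: "\<And>j. j \<in> {1..d} \<Longrightarrow> (\<lambda>n. real (N n j) / \<alpha> j ^ n) \<longlonglongrightarrow> 1"
    and \<alpha>: "\<And>j. j \<in> {1..d} \<Longrightarrow> \<alpha> j > 1"
    and sub: "\<And>j. j \<in> {1..d} \<Longrightarrow> a j * (norm \<beta>s)\<^sup>2 < ln (\<alpha> j)"
    and m: "m < d"
  shows "(\<lambda>n. fluct_bound a N n m \<beta>s R) \<longlonglongrightarrow> exp (2 * a 1 * R\<^sup>2) * (\<Prod>j=2..Suc m. 0)"
  unfolding fluct_bound_def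
proof (intro tendsto_intros)
  fix j assume "j \<in> {2..Suc m}"
  hence j: "j \<in> {1..d}" using m by auto
  have "a j * (norm \<beta>s * sqrt (real n) + R)\<^sup>2 =
     a j * (norm \<beta>s)\<^sup>2 * real n + (2 * a j * norm \<beta>s * R) * sqrt (real n) + a j * R\<^sup>2" for n
    by (simp add: power2_sum power_mult_distrib algebra_simps)
  thus "(\<lambda>n. exp (a j * (norm \<beta>s * sqrt (real n) + R)\<^sup>2) / real (N n j)) \<longlonglongrightarrow> 0"
    using exp_over_branching_tendsto_0[OF r[OF j] \<alpha>[OF j] sub[OF j]] by simp
qed

theorem theorem2p20:
  fixes d :: nat
    and a \<alpha> :: "nat \<Rightarrow> real"
    and N :: "nat \<Rightarrow> nat \<Rightarrow> nat"
    and M :: "nat \<Rightarrow> 'a measure"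
    and \<xi> :: "nat \<Rightarrow> nat list \<Rightarrow> 'a \<Rightarrow> real"
    and P :: "'b measure"
    and \<zeta> :: "nat \<Rightarrow> 'b \<Rightarrow> complex"
    and \<beta>s :: complex
  assumes "d \<ge> 1"
    and "\<And>j. j \<in> {1..d} \<Longrightarrow> a j > 0"
    and "\<And>j. j \<in> {1..d} \<Longrightarrow> \<alpha> j > 1"
    and "\<And>j. j \<in> {1..d} \<Longrightarrow> (\<lambda>n. real (N n j) / \<alpha> j ^ n) \<longlonglongrightarrow> 1"
    and "strict_mono_on {1..d} (grem_sigma a \<alpha>)"
    and "\<And>n. prob_space (M n)"
    and "\<And>n. prob_space.indep_vars (M n) (\<lambda>_. borel) (\<xi> n) (\<Union>j\<in>{1..d}. grem_words N n j)"
    and "\<And>n j w. j \<in> {1..d} \<Longrightarrow> w \<in> grem_words N n j \<Longrightarrow>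
           distributed (M n) lborel (\<xi> n w) std_normal_density"
    and "prob_space P"
    and "prob_space.indep_vars P (\<lambda>_. borel) \<zeta> UNIV"
    and "\<And>k. distr P borel (\<zeta> k) = std_complex_normal"
    and "\<beta>s \<in> region_E (grem_sigma a \<alpha> 1) \<inter> {\<beta>. \<bar>Re \<beta>\<bar> < grem_sigma a \<alpha> 1 / 2}"
    and "Im \<beta>s \<noteq> 0"
  shows "weakly_converges entire_topology M
           (\<lambda>n \<omega> t. let h = t / of_real (sqrt (real n)) in
              (grem_Z d a N (\<xi> n) n (\<beta>s + h) \<omega> - (\<integral>\<omega>'. grem_Z d a N (\<xi> n) n (\<beta>s + h) \<omega>' \<partial>M n)) /
              (of_real (sqrt (real (N n 1))) *
               exp (of_real (a 1) * (of_real (Re \<beta>s) + h) ^ 2 * of_nat n) *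
               exp (grem_c d a N n (\<beta>s + h))))
           P
           (\<lambda>\<omega> t. plane_GAF \<zeta> \<omega> (of_real (sqrt (a 1)) * t))"
proof -
  note d = assms(1) and a = assms(2) and \<alpha> = assms(3) and N = assms(4) and M = assms(6)
  have d1: "1 \<in> {1..d}" using d by simp
  interpret G: gaf_setup P \<zeta>
    by (intro gaf_setup.intro gaf_setup_axioms.intro assms)
  have sig2: "(grem_sigma a \<alpha> j)\<^sup>2 = 2 * ln (\<alpha> j) / a j" "grem_sigma a \<alpha> j > 0" if "j \<in> {1..d}" for j
    using a[OF that] \<alpha>[OF that] by (auto simp: grem_sigma_def)
  have strip: "2 * \<bar>Re \<beta>s\<bar> < grem_sigma a \<alpha> 1" using assms(12) by auto
  have norm\<beta>: "2 * (norm \<beta>s)\<^sup>2 < (grem_sigma a \<alpha> 1)\<^sup>2"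
  proof (rule region_E_strip[OF _ strip])
    show "\<beta>s \<noteq> 0" using assms(13) by auto
  qed (use assms(12) in blast)
  \<comment> \<open>The disc condition at \<sigma>_1 passes to every level, since \<sigma>_1 is the
    smallest critical value.\<close>
  have sub: "a j * (norm \<beta>s)\<^sup>2 < ln (\<alpha> j)" if j: "j \<in> {1..d}" for j
  proof -
    have "grem_sigma a \<alpha> 1 \<le> grem_sigma a \<alpha> j"
      using strict_mono_on_leD[OF assms(5) d1 j] j by auto
    hence "(grem_sigma a \<alpha> 1)\<^sup>2 \<le> (grem_sigma a \<alpha> j)\<^sup>2"
      using sig2(2)[OF d1] by (intro power_mono) auto
    hence "2 * (norm \<beta>s)\<^sup>2 < 2 * ln (\<alpha> j) / a j" using norm\<beta> sig2(1)[OF j] by simp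
    thus ?thesis using a[OF j] by (simp add: field_simps)
  qed
  \<comment> \<open>The squared strip condition, in the form that controls the size of a shifted
    summand.\<close>
  have sub1: "2 * (Re \<beta>s)\<^sup>2 * a 1 < ln (\<alpha> 1)"
  proof -
    have "(2 * \<bar>Re \<beta>s\<bar>)\<^sup>2 < (grem_sigma a \<alpha> 1)\<^sup>2"
      using strip by (intro power_strict_mono) auto
    hence "4 * (Re \<beta>s)\<^sup>2 < 2 * ln (\<alpha> 1) / a 1"
      unfolding sig2(1)[OF d1] by (simp add: power_mult_distrib)
    thus ?thesis using a[OF d1] by (simp add: field_simps)
  qed
  have "\<forall>\<^sub>F n in sequentially. \<forall>j\<in>{1..d}. N n j > 0"
  proof (intro eventually_ball_finite ballI)
    fix j assume j: "j \<in> {1..d}"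
    show "\<forall>\<^sub>F n in sequentially. N n j > 0"
      using branching_at_top[OF N[OF j] \<alpha>[OF j]] eventually_gt_at_top[of 0]
      by (simp add: filterlim_iff)
  qed simp
  then obtain n0 where "\<forall>n\<ge>n0. \<forall>j\<in>{1..d}. N n j > 0"
    unfolding eventually_sequentially by blast
  hence n0: "N n j > 0" if "n \<ge> n0" "j \<in> {1..d}" for n j using that by blast
  have gs: "grem_setup (M n) d a N n (\<xi> n)" if "\<And>j. j \<in> {1..d} \<Longrightarrow> N n j > 0" for n
    using that by (intro grem_setup.intro grem_setup_axioms.intro assms) auto
  \<comment> \<open>With an empty level there are no words and the partition function vanishes; the
    zero function keeps measurability and analyticity valid for such \<open>n\<close>.\<close>
  have Z0: "fluct d a N n (M n) (\<xi> n) \<beta>s \<omega> = (\<lambda>_. 0)" if nz: "\<not> (\<forall>j\<in>{1..d}. N n j > 0)" for n \<omega>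
  proof -
    obtain j where "j \<in> {1..d}" "N n j = 0" using nz by blast
    hence "card (grem_words N n d) = 0" unfolding card_grem_words by (intro prod_zero) auto
    hence "grem_words N n d = {}" by (simp add: finite_grem_words)
    hence "grem_Z d a N (\<xi> n) n \<beta> = (\<lambda>_. 0)" for \<beta> by (simp add: grem_Z_def fun_eq_iff)
    thus ?thesis by (simp add: fluct_def fun_eq_iff)
  qed
  let ?X = "\<lambda>n. fluct d a N n (M n) (\<xi> n) \<beta>s" and ?Y = "\<lambda>\<omega> t. plane_GAF \<zeta> \<omega> (of_real (sqrt (a 1)) * t)"
  have "weakly_converges entire_topology M ?X P ?Y"
  \<comment> \<open>From \<open>n0\<close> on all branching numbers are positive; the 1 excludes n =
    0, where t / sqrt n degenerates.\<close>
  proof (rule weakly_converges_entireI[OF M assms(9), where start = "max 1 n0"])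
    show "?X n \<omega> \<in> entire_functions" for n \<omega>
    proof (cases "\<forall>j\<in>{1..d}. N n j > 0")
      case True
      thus ?thesis by (intro grem_setup.fluct_entire[OF gs d]) auto
    qed (simp add: Z0 entire_functions_def)
    show "(\<lambda>\<omega>. ?X n \<omega> t) \<in> borel_measurable (M n)" for n t
    proof (cases "\<forall>j\<in>{1..d}. N n j > 0")
      case True
      thus ?thesis by (intro grem_setup.fluct_measurable[OF gs]) auto
    qed (simp add: Z0)
    show "?Y \<omega> \<in> entire_functions" for \<omega>
      using holomorphic_on_compose[of "\<lambda>t. of_real (sqrt (a 1)) * t" UNIV "plane_GAF \<zeta> \<omega>"]
        holomorphic_on_subset[OF G.plane_GAF_holomorphic[of \<omega>] subset_UNIV]
      by (simp add: entire_functions_def o_def holomorphic_intros)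
    show "(\<lambda>\<omega>. ?Y \<omega> t) \<in> borel_measurable P" for t by (rule G.plane_GAF_measurable)
    show "\<exists>C. \<forall>t. norm t = R \<longrightarrow> (\<integral>\<^sup>+\<omega>. norm (?Y \<omega> t) \<partial>P) \<le> ennreal C" if "R > 0" for R
    proof -
      have "sqrt (a 1) * R \<ge> 0" using that a[OF d1] by simp
      from G.plane_GAF_moment[OF this] obtain C where
        C: "\<And>t. norm t \<le> sqrt (a 1) * R \<Longrightarrow> (\<integral>\<^sup>+\<omega>. norm (plane_GAF \<zeta> \<omega> t) \<partial>P) \<le> ennreal C" by blast
      show ?thesis
      proof (intro exI[of _ C] allI impI C)
        fix t :: complex assume "norm t = R"
        thus "norm (complex_of_real (sqrt (a 1)) * t) \<le> sqrt (a 1) * R"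
          using less_imp_le[OF a[OF d1]] by (simp add: norm_mult)
      qed
    qed
    show "\<exists>C. \<forall>n\<ge>max 1 n0. \<forall>t. norm t = R \<longrightarrow> (\<integral>\<^sup>+\<omega>. norm (?X n \<omega> t) \<partial>M n) \<le> ennreal C" for R
    proof -
      have "(\<lambda>n. \<Sum>m<d. sqrt (fluct_bound a N n m \<beta>s R)) \<longlonglongrightarrow> (\<Sum>m<d. sqrt (exp (2 * a 1 * R\<^sup>2) * (\<Prod>j=2..Suc m. 0)))"
        by (intro tendsto_sum tendsto_real_sqrt fluct_bound_tendsto[OF N \<alpha> sub]) auto
      hence "Bseq (\<lambda>n. \<Sum>m<d. sqrt (fluct_bound a N n m \<beta>s R))" by (intro convergent_imp_Bseq convergentI)
      then obtain C where C: "\<And>n. norm (\<Sum>m<d. sqrt (fluct_bound a N n m \<beta>s R)) \<le> C" by (auto simp: Bseq_def)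
      show ?thesis
      proof (intro exI[of _ C] allI impI)
        fix n t assume n: "n \<ge> max 1 n0" and t: "norm (t::complex) = R"
        have "(\<integral>\<^sup>+\<omega>. norm (?X n \<omega> t) \<partial>M n) \<le> ennreal (\<Sum>m<d. sqrt (fluct_bound a N n m \<beta>s R))"
          using n t n0 by (intro grem_setup.fluct_moment[OF gs] d) auto
        also have "\<dots> \<le> ennreal C" using C[of n] by (intro ennreal_leI) simp
        finally show "(\<integral>\<^sup>+\<omega>. norm (?X n \<omega> t) \<partial>M n) \<le> ennreal C" .
      qed
    qed
    show "(\<lambda>n. \<integral>\<omega>. cis (lin I lam (?X n \<omega>)) \<partial>M n) \<longlonglongrightarrow> (\<integral>\<omega>. cis (lin I lam (?Y \<omega>)) \<partial>P)"
      if I: "finite I" for I lam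
    proof -
      let ?s = "\<lambda>t. complex_of_real (sqrt (a 1)) * t"
      define U where "U n = (\<integral>\<omega>. cis (Re ((\<Sum>v\<in>grem_words N n 1. tilt_sum I lam ?s \<beta>s (sqrt (n * a 1)) (\<xi> n v \<omega>)
          - (\<integral>x. tilt_sum I lam ?s \<beta>s (sqrt (n * a 1)) x \<partial>std_normal_distribution))
          / sqrt (card (grem_words N n 1)))) \<partial>M n)" for n
      have card: "card (grem_words N n 1) = N n 1" for n by (simp add: card_grem_words)
      have words1: "grem_words N n 1 \<subseteq> (\<Union>j\<in>{1..d}. grem_words N n j)" for n using d1 by blast
      have U: "U \<longlonglongrightarrow> exp (- Re (gaf_var I lam ?s) / 4)"
        unfolding U_def
      proof (rule tilt_sum_clt[OF M])
        show "prob_space.indep_vars (M n) (\<lambda>_. borel) (\<xi> n) (grem_words N n 1)" for n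
          by (rule prob_space.indep_vars_subset[OF M assms(7) words1])
        show "distr (M n) borel (\<xi> n v) = std_normal_distribution" if "v \<in> grem_words N n 1" for n v
          using assms(8)[OF d1 that] by (simp add: distributed_def cong: distr_cong)
        have "filterlim (\<lambda>n. sqrt (a 1) * sqrt (real n)) at_top sequentially"
          using a[OF d1] by (intro filterlim_tendsto_pos_mult_at_top[OF tendsto_const]
              filterlim_compose[OF sqrt_at_top filterlim_real_sequentially]) auto
        thus "filterlim (\<lambda>n. sqrt (n * a 1)) at_top sequentially" by (simp add: real_sqrt_mult mult.commute)
        show "filterlim (\<lambda>n. card (grem_words N n 1)) at_top sequentially"
          unfolding card by (rule branching_at_top[OF N[OF d1] \<alpha>[OF d1]])
        fix y
        \<comment> \<open>The quotient required by the central limit theorem is the square root of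
          an expression with exponential rate 2 (Re \<beta>s)^2 a_1, which \<open>sub1\<close>
          places below log \<alpha>_1.\<close>
        have "(\<lambda>n. sqrt (exp (2 * (Re \<beta>s)\<^sup>2 * a 1 * real n + (2 * Re \<beta>s * sqrt (a 1) * y) * sqrt (real n) + 0) / real (N n 1))) \<longlonglongrightarrow> sqrt 0"
          by (intro tendsto_real_sqrt exp_over_branching_tendsto_0[OF N[OF d1] \<alpha>[OF d1] sub1])
        moreover have "sqrt (exp (2 * (Re \<beta>s)\<^sup>2 * a 1 * real n + (2 * Re \<beta>s * sqrt (a 1) * y) * sqrt (real n) + 0) / real (N n 1))
          = exp (Re \<beta>s * sqrt (n * a 1) * y + (Re \<beta>s * sqrt (n * a 1))\<^sup>2) / sqrt (card (grem_words N n 1))" for n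
        proof -
          have "exp (2 * (Re \<beta>s)\<^sup>2 * a 1 * real n + (2 * Re \<beta>s * sqrt (a 1) * y) * sqrt (real n) + 0)
             = (exp (Re \<beta>s * sqrt (n * a 1) * y + (Re \<beta>s * sqrt (n * a 1))\<^sup>2))\<^sup>2"
            using a[OF d1] by (simp add: exp_double[symmetric] power_mult_distrib real_sqrt_mult algebra_simps)
          thus ?thesis unfolding card by (simp add: real_sqrt_divide)
        qed
        ultimately show "(\<lambda>n. exp (Re \<beta>s * sqrt (n * a 1) * y + (Re \<beta>s * sqrt (n * a 1))\<^sup>2) / sqrt (card (grem_words N n 1))) \<longlonglongrightarrow> 0"
          by simp
      qed (rule assms(13))
      have "(\<lambda>n. (\<integral>\<omega>. cis (lin I lam (?X n \<omega>)) \<partial>M n) - U n) \<longlonglongrightarrow> 0"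
      proof (rule Lim_null_comparison)
        have "(\<lambda>n. \<Sum>t\<in>I. norm (lam t) * (\<Sum>m=1..<d. sqrt (fluct_bound a N n m \<beta>s (norm t)))) \<longlonglongrightarrow>
           (\<Sum>t\<in>I. norm (lam t) * (\<Sum>m=1..<d. sqrt (exp (2 * a 1 * (norm t)\<^sup>2) * (\<Prod>j=2..Suc m. 0))))"
          by (intro tendsto_sum tendsto_mult tendsto_const tendsto_real_sqrt fluct_bound_tendsto[OF N \<alpha> sub]) auto
        \<comment> \<open>For m \<ge> 1 the product contains the level j = 2 and is therefore
          zero.\<close>
        also have "(\<Sum>t\<in>I. norm (lam t) * (\<Sum>m=1..<d. sqrt (exp (2 * a 1 * (norm t)\<^sup>2) * (\<Prod>j=2..Suc m. 0)))) = 0"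
          by (auto simp: power_0_left intro!: sum.neutral)
        finally show "(\<lambda>n. \<Sum>t\<in>I. norm (lam t) * (\<Sum>m=1..<d. sqrt (fluct_bound a N n m \<beta>s (norm t)))) \<longlonglongrightarrow> 0" .
        show "\<forall>\<^sub>F n in sequentially. norm ((\<integral>\<omega>. cis (lin I lam (?X n \<omega>)) \<partial>M n) - U n)
            \<le> (\<Sum>t\<in>I. norm (lam t) * (\<Sum>m=1..<d. sqrt (fluct_bound a N n m \<beta>s (norm t))))"
          using eventually_ge_at_top[of "max 1 n0"]
        proof eventually_elim
          case (elim n)
          show ?case unfolding U_def
            using elim n0 by (intro grem_setup.fluct_char_tilt[OF gs _ d I]) auto
        qed
      qed
      from tendsto_add[OF this U] show ?thesis
        unfolding G.plane_GAF_char[OF I, of lam ?s] by simp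
    qed
  qed
  thus ?thesis by (simp add: fluct_def[abs_def] Let_def)
qed

end
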